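(* Let $S$ be a homology sphere and let $F$ be a face of $S$. If $S$ and $\mathrm{lk}(F,S)$ are HL, then the stellar subdivision $\mathrm{Stellar}(F,S)$ is HL.
   Context: A homology sphere is a pure simplicial complex $S$ such that for every face $G$ (including $\emptyset$), $\mathrm{lk}(G,S)=\{T\in S:T\cap G=\emptyset,T\cup G\in S\}$ has the (integral) homology of a sphere of dimension $\dim\mathrm{lk}(G,S)$. The stellar subdivision at a face $F$ is $\mathrm{Stellar}(F,S)=(S\setminus\mathrm{st}(F,S))\cup(\{v_F\}*\partial F*\mathrm{lk}(F,S))$, where $\mathrm{st}(F,S)=\{T\in S:T\cup F\in S\}$... more precisely $S\setminus\mathrm{st}(F,S)$ denotes the set of faces of $S$ not containing $F$, $v_F$ is a new vertex, $\partial F$ is the boundary complex of the simplex $F$, and $*$ denotes join. For a $(D-1)$-dimensional complex $K$ on vertex set $V$, $\mathbb{R}[K]=\mathbb{R}[x_v:v\in V]/I_K$ with $I_K$ generated by $\prod_{v\in T}x_v$, $T\notin K$; an l.s.o.p. is $\Theta=(\theta_1,\dots,\theta_D)$ of degree-one elements with $H(K,\Theta)=\mathbb{R}[K]/(\Theta)=\bigoplus_iH_i$ finite-dimensional. A Cohen–Macaulay complex with symmetric $h$-vector is HL if there exist an l.s.o.p. $\Theta$ and a degree-one $\omega$ with $\omega^{D-2i}:H_i\to H_{D-i}$ an isomorphism for all $0\le i\le\lfloor D/2\rfloor$. *)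

theory Defs
  imports "HOL-Algebra.Algebra" "HOL-Library.Poly_Mapping"
begin

section \<open>Simplicial complexes\<close>

text \<open>The empty face belongs to every complex except the void complex \<open>{}\<close>.\<close>

definition simplicial_complex :: "'v set set \<Rightarrow> bool" where
  "simplicial_complex K \<longleftrightarrow>
     finite K \<and> (\<forall>T\<in>K. finite T) \<and> (\<forall>T\<in>K. \<forall>U. U \<subseteq> T \<longrightarrow> U \<in> K)"

definition vertices :: "'v set set \<Rightarrow> 'v set" where
  "vertices K = \<Union>K"

text \<open>
  \<open>cdim K\<close> is \<open>D = dim K + 1\<close>, the largest cardinality of a face, so that no negative
  dimension is needed: \<open>cdim {{}} = 0\<close>. Since the supremum of the empty set of natural
  numbers is \<open>0\<close>, also \<open>cdim {} = 0\<close>.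
\<close>

definition cdim :: "'v set set \<Rightarrow> nat" where
  "cdim K = Sup (card ` K)"

definition pure_complex :: "'v set set \<Rightarrow> bool" where
  "pure_complex K \<longleftrightarrow>
     (\<forall>T\<in>K. (\<forall>U\<in>K. T \<subseteq> U \<longrightarrow> U = T) \<longrightarrow> card T = cdim K)"

definition link :: "'v set \<Rightarrow> 'v set set \<Rightarrow> 'v set set" where
  "link G S = {T \<in> S. T \<inter> G = {} \<and> T \<union> G \<in> S}"

text \<open>The join is only used for complexes on disjoint vertex sets.\<close>

definition complex_join :: "'v set set \<Rightarrow> 'v set set \<Rightarrow> 'v set set" where
  "complex_join K L = {A \<union> B | A B. A \<in> K \<and> B \<in> L}"

text \<open>\<open>v\<close> is the new vertex; the subdivision is meaningful for \<open>v \<notin> vertices S\<close>.\<close>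

definition stellar :: "'v \<Rightarrow> 'v set \<Rightarrow> 'v set set \<Rightarrow> 'v set set" where
  "stellar v F S =
     {T \<in> S. \<not> F \<subseteq> T} \<union> complex_join (complex_join {{}, {v}} {B. B \<subset> F}) (link F S)"


section \<open>Integral simplicial homology and homology spheres\<close>

text \<open>
  Oriented simplicial chains: an element of \<open>chain_group K n\<close> assigns an integer to each
  ordering of each face with \<open>n\<close> vertices (a face of dimension \<open>n - 1\<close>), changing sign
  under transpositions. The case \<open>n = 0\<close> is the augmentation in degree \<open>-1\<close>, so the
  homology below is reduced homology.

  The coefficient of the boundary of \<open>c\<close> at an oriented simplex \<open>\<tau>\<close> is the sum of
  \<open>c (v # \<tau>)\<close> over the vertices \<open>v\<close>: as \<open>c\<close> is alternating, this is the usual formula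
  \<open>[v\<^sub>0, \<dots>, v\<^sub>p] \<mapsto> \<Sum>\<^sub>i (-1)\<^sup>i [v\<^sub>0, \<dots>, v\<^sub>i\<^sub>-\<^sub>1, v\<^sub>i\<^sub>+\<^sub>1, \<dots>, v\<^sub>p]\<close>.
\<close>

definition simplicial_chains :: "'v set set \<Rightarrow> nat \<Rightarrow> ('v list \<Rightarrow> int) set" where
  "simplicial_chains K n = {c.
     (\<forall>xs. c xs \<noteq> 0 \<longrightarrow> distinct xs \<and> set xs \<in> K \<and> length xs = n) \<and>
     (\<forall>us x y ws. c (us @ x # y # ws) = - c (us @ y # x # ws))}"

definition chain_group :: "'v set set \<Rightarrow> nat \<Rightarrow> ('v list \<Rightarrow> int) monoid" where
  "chain_group K n =
     \<lparr>carrier = simplicial_chains K n,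
      monoid.mult = (\<lambda>c d xs. c xs + d xs), monoid.one = (\<lambda>xs. 0)\<rparr>"

definition boundary :: "'v set set \<Rightarrow> ('v list \<Rightarrow> int) \<Rightarrow> 'v list \<Rightarrow> int" where
  "boundary K c = (\<lambda>xs. \<Sum>v\<in>vertices K. c (v # xs))"

definition cycles :: "'v set set \<Rightarrow> nat \<Rightarrow> ('v list \<Rightarrow> int) set" where
  "cycles K n = {c \<in> simplicial_chains K n. boundary K c = (\<lambda>xs. 0)}"

definition boundaries :: "'v set set \<Rightarrow> nat \<Rightarrow> ('v list \<Rightarrow> int) set" where
  "boundaries K n = boundary K ` simplicial_chains K (Suc n)"

text \<open>\<open>simplicial_homology K n\<close> is the reduced integral homology in degree \<open>n - 1\<close>.\<close>

definition simplicial_homology :: "'v set set \<Rightarrow> nat \<Rightarrow> ('v list \<Rightarrow> int) set monoid" where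
  "simplicial_homology K n =
     (chain_group K n)\<lparr>carrier := cycles K n\<rparr> Mod boundaries K n"

text \<open>
  The reduced homology of a sphere of dimension \<open>d - 1\<close> is infinite cyclic in degree
  \<open>d - 1\<close> and zero in all other degrees; the sphere of dimension \<open>-1\<close> is empty.
\<close>

definition homology_of_sphere :: "nat \<Rightarrow> 'v set set \<Rightarrow> bool" where
  "homology_of_sphere d K \<longleftrightarrow>
     (\<forall>n. if n = d then simplicial_homology K n \<cong> integer_group
          else trivial_group (simplicial_homology K n))"

definition homology_sphere :: "'v set set \<Rightarrow> bool" where
  "homology_sphere S \<longleftrightarrow>
     simplicial_complex S \<and> S \<noteq> {} \<and> pure_complex S \<and>
     (\<forall>G\<in>S. homology_of_sphere (cdim (link G S)) (link G S))"


section \<open>Face rings\<close>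

text \<open>
  Polynomials with real coefficients, as finitely supported functions on monomials;
  monomials are finitely supported exponent functions.
\<close>

type_synonym 'v mpoly = "('v \<Rightarrow>\<^sub>0 nat) \<Rightarrow>\<^sub>0 real"

definition Var :: "'v \<Rightarrow> 'v mpoly" where
  "Var v = Poly_Mapping.single (Poly_Mapping.single v 1) 1"

definition Const :: "real \<Rightarrow> 'v mpoly" where
  "Const c = Poly_Mapping.single 0 c"

definition polys_in :: "'v set \<Rightarrow> 'v mpoly set" where
  "polys_in V = {p. \<forall>m\<in>Poly_Mapping.keys p. Poly_Mapping.keys m \<subseteq> V}"

definition poly_ring :: "'v set \<Rightarrow> 'v mpoly ring" where
  "poly_ring V =
     \<lparr>carrier = polys_in V, monoid.mult = (*), monoid.one = 1, ring.zero = 0, ring.add = (+)\<rparr>"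

definition homogeneous :: "nat \<Rightarrow> 'v mpoly \<Rightarrow> bool" where
  "homogeneous i p \<longleftrightarrow>
     (\<forall>m\<in>Poly_Mapping.keys p.
        (\<Sum>v\<in>Poly_Mapping.keys m. Poly_Mapping.lookup m v) = i)"

definition face_ideal :: "'v set set \<Rightarrow> 'v mpoly set" where
  "face_ideal K =
     Idl\<^bsub>poly_ring (vertices K)\<^esub> {\<Prod>v\<in>T. Var v | T. T \<subseteq> vertices K \<and> T \<notin> K}"

definition face_ring :: "'v set set \<Rightarrow> 'v mpoly set ring" where
  "face_ring K = poly_ring (vertices K) Quot face_ideal K"

definition face_ring_class :: "'v set set \<Rightarrow> 'v mpoly \<Rightarrow> 'v mpoly set" where
  "face_ring_class K p = face_ideal K +>\<^bsub>poly_ring (vertices K)\<^esub> p"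

definition face_ring_deg :: "'v set set \<Rightarrow> nat \<Rightarrow> 'v mpoly set set" where
  "face_ring_deg K i =
     face_ring_class K ` {p \<in> polys_in (vertices K). homogeneous i p}"

text \<open>
  A sequence \<open>\<Theta>\<close> of length \<open>D\<close> is a function on \<open>nat\<close> of which only the values at
  \<open>0, \<dots>, D - 1\<close> are used.
\<close>

definition theta_ideal :: "'v set set \<Rightarrow> (nat \<Rightarrow> 'v mpoly set) \<Rightarrow> nat \<Rightarrow> 'v mpoly set set" where
  "theta_ideal K \<Theta> n = Idl\<^bsub>face_ring K\<^esub> (\<Theta> ` {..<n})"

definition H :: "'v set set \<Rightarrow> (nat \<Rightarrow> 'v mpoly set) \<Rightarrow> 'v mpoly set set ring" where
  "H K \<Theta> = face_ring K Quot theta_ideal K \<Theta> (cdim K)"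

definition H_class ::
    "'v set set \<Rightarrow> (nat \<Rightarrow> 'v mpoly set) \<Rightarrow> 'v mpoly set \<Rightarrow> 'v mpoly set set" where
  "H_class K \<Theta> a = theta_ideal K \<Theta> (cdim K) +>\<^bsub>face_ring K\<^esub> a"

definition H_deg ::
    "'v set set \<Rightarrow> (nat \<Rightarrow> 'v mpoly set) \<Rightarrow> nat \<Rightarrow> 'v mpoly set set set" where
  "H_deg K \<Theta> i = H_class K \<Theta> ` face_ring_deg K i"

text \<open>The copy of the real numbers in \<open>H K \<Theta>\<close>.\<close>

definition H_reals :: "'v set set \<Rightarrow> (nat \<Rightarrow> 'v mpoly set) \<Rightarrow> 'v mpoly set set set" where
  "H_reals K \<Theta> = range (\<lambda>c. H_class K \<Theta> (face_ring_class K (Const c)))"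

definition lsop :: "'v set set \<Rightarrow> (nat \<Rightarrow> 'v mpoly set) \<Rightarrow> bool" where
  "lsop K \<Theta> \<longleftrightarrow>
     (\<forall>i<cdim K. \<Theta> i \<in> face_ring_deg K 1) \<and>
     ring.finite_dimension (H K \<Theta>) (H_reals K \<Theta>) (carrier (H K \<Theta>))"


section \<open>Cohen--Macaulay complexes and the HL property\<close>

text \<open>
  Cohen--Macaulay over the real numbers: some l.s.o.p. is a regular sequence on the face
  ring (equivalently, every l.s.o.p. is).
\<close>

definition regular_seq :: "'v set set \<Rightarrow> (nat \<Rightarrow> 'v mpoly set) \<Rightarrow> bool" where
  "regular_seq K \<Theta> \<longleftrightarrow>
     (\<forall>i<cdim K. \<forall>a\<in>carrier (face_ring K).
        \<Theta> i \<otimes>\<^bsub>face_ring K\<^esub> a \<in> theta_ideal K \<Theta> i \<longrightarrow> a \<in> theta_ideal K \<Theta> i)"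

definition cohen_macaulay :: "'v set set \<Rightarrow> bool" where
  "cohen_macaulay K \<longleftrightarrow> (\<exists>\<Theta>. lsop K \<Theta> \<and> regular_seq K \<Theta>)"

text \<open>\<open>f_num K j\<close> is the number of faces with \<open>j\<close> vertices, usually written \<open>f\<^sub>j\<^sub>-\<^sub>1\<close>.\<close>

definition f_num :: "'v set set \<Rightarrow> nat \<Rightarrow> nat" where
  "f_num K j = card {T \<in> K. card T = j}"

definition h_num :: "'v set set \<Rightarrow> nat \<Rightarrow> int" where
  "h_num K i =
     (\<Sum>j\<le>i. (-1) ^ (i - j) * int ((cdim K - j) choose (i - j)) * int (f_num K j))"

definition symmetric_h :: "'v set set \<Rightarrow> bool" where
  "symmetric_h K \<longleftrightarrow> (\<forall>i\<le>cdim K. h_num K i = h_num K (cdim K - i))"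

text \<open>
  Multiplication by a power of \<open>\<omega>\<close> is linear, so it is an isomorphism between graded
  pieces exactly when it is a bijection between them.
\<close>

definition HL :: "'v set set \<Rightarrow> bool" where
  "HL K \<longleftrightarrow>
     cohen_macaulay K \<and> symmetric_h K \<and>
     (\<exists>\<Theta> \<omega>. lsop K \<Theta> \<and> \<omega> \<in> H_deg K \<Theta> 1 \<and>
        (\<forall>i\<le>cdim K div 2.
           bij_betw (\<lambda>a. (\<omega> [^]\<^bsub>H K \<Theta>\<^esub> (cdim K - 2 * i)) \<otimes>\<^bsub>H K \<Theta>\<^esub> a)
             (H_deg K \<Theta> i) (H_deg K \<Theta> (cdim K - i))))"

end

theory Submission
  imports Defs "Jordan_Normal_Form.Determinant"
    "HOL-Computational_Algebra.Formal_Power_Series"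
begin

text \<open>All conditions in HL are rank conditions on spaces of forms, so they are open along lines of
  parameters. After the substitution \<open>x\<^sub>u \<mapsto> x\<^sub>u + x\<^sub>v\<close> for \<open>u\<close> in \<open>F\<close> and \<open>x\<^sub>v \<mapsto> s x\<^sub>v\<close>, the face ring of
  the subdivision becomes the ring of \<open>S \<union> v * star F S\<close> modulo \<open>\<Prod>u\<in>F. (s x\<^sub>u - x\<^sub>v)\<close>, and it suffices
  to verify the conditions in the limit \<open>s = 0\<close>. There, for a parameter \<open>\<theta>\<close> that is generic for both \<open>S\<close>
  and the star of \<open>F\<close>, the quotient by \<open>\<theta>\<close> is the quotient for \<open>S\<close> plus the sum over \<open>1 \<le> j < card F\<close> of
  \<open>x\<^sub>v ^ j\<close> times the quotient for the link, so its Hilbert function is the h-vector of the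
  subdivision. As a Lefschetz element one takes \<open>\<omega> - x\<^sub>v\<close>: modulo the multiples of \<open>x\<^sub>v\<close> it is
  the one of \<open>S\<close>, and on these multiples it behaves as on the tensor product of the quotient for
  the link with \<open>\<real>[x] / x ^ (card F - 1)\<close>. Surjectivity and the symmetry of the h-vector give
  bijectivity, and the dimension bound gives the Cohen-Macaulay property.\<close>

text \<open>HL supplies separate witnesses: the l.s.o.p. showing Cohen-Macaulayness need not be the
  one carrying the Lefschetz element, and the link has its own. They must be merged into one
  parameter, which is why every condition is phrased as a lower bound on the dimension of a graded
  piece of an ideal: such bounds hold generically once they hold somewhere, and they pass along
  surjections of quotients. Exact dimensions and injectivity do not degenerate well, so they are
  recovered only for the subdivision itself. The link enters through the star of \<open>F\<close>,
  whose face ring is a polynomial ring over that of the link in the variables of \<open>F\<close>.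
  As \<open>D = d + k\<close> with \<open>d = cdim (link F S)\<close> and \<open>k = card F\<close>,
  the same number of parameters fits \<open>S\<close> and the star. The substitution is the algebra
  of a blow-up: the missing face \<open>F\<close> of the subdivision turns into a relation whose
  limit \<open>(- x_v) ^ k\<close> involves no variable of \<open>F\<close>, so in the limit the
  ideal can be studied one power of \<open>x_v\<close> at a time.\<close>

abbreviation keys :: "('a \<Rightarrow>\<^sub>0 'b::zero) \<Rightarrow> 'a set" where
  "keys \<equiv> Poly_Mapping.keys"

abbreviation lookup :: "('a \<Rightarrow>\<^sub>0 'b::zero) \<Rightarrow> 'a \<Rightarrow> 'b" where
  "lookup \<equiv> Poly_Mapping.lookup"

abbreviation single :: "'a \<Rightarrow> 'b \<Rightarrow> 'a \<Rightarrow>\<^sub>0 'b::zero" where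
  "single \<equiv> Poly_Mapping.single"

section \<open>Dimensions\<close>

context vector_space
begin

text \<open>The polynomials form an infinite-dimensional space, where \<open>dim\<close> of a large
  subset is a meaningless 0. Hence the lemmas here carry a finite spanning set
  \<open>B\<close>.\<close>

lemma finite_dim_basis:
  assumes "finite B" "V \<subseteq> span B"
  obtains C where "C \<subseteq> V" "independent C" "V \<subseteq> span C" "card C = dim V" "finite C"
  by (metis assms basis_exists independent_span_bound order_trans)

lemma dim_mono_finite:
  assumes "finite B" "W \<subseteq> span B" "V \<subseteq> span W"
  shows "dim V \<le> dim W"
proof -
  obtain C where C: "C \<subseteq> W" "independent C" "W \<subseteq> span C" "card C = dim W" "finite C"
    using finite_dim_basis[OF assms(1,2)] .
  have "V \<subseteq> span C"
    using assms(3) C(3) by (metis span_minimal subspace_span subset_trans)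
  then show ?thesis using dim_le_card[OF _ C(5)] C(4) by metis
qed

lemma complement_basis:
  assumes "finite B" "W \<subseteq> span B" "subspace V" "V \<subseteq> W"
  obtains C E where "independent C" "C \<subseteq> V" "span C = V" "card C = dim V" "finite C"
    "E \<subseteq> W" "C \<inter> E = {}" "independent (C \<union> E)" "W \<subseteq> span (C \<union> E)"
    "card E + dim V = dim W" "finite E"
proof -
  obtain C where C: "C \<subseteq> V" "independent C" "V \<subseteq> span C" "card C = dim V" "finite C"
    using finite_dim_basis[of B V] assms by blast
  obtain A where A: "C \<subseteq> A" "A \<subseteq> W" "independent A" "W \<subseteq> span A"
    using maximal_independent_subset_extend[of C W] C assms(4) by blast
  have fA: "finite A" using independent_span_bound[OF assms(1) A(3)] A(2) assms(2) by blast
  have cA: "card A = dim W" using basis_card_eq_dim A by blast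
  have "span C = V" using C assms(3) by (metis span_subspace)
  moreover have "card (A - C) + dim V = dim W"
    using cA C(4,5) A(1) fA by (metis add.commute card_Diff_subset card_mono le_add_diff_inverse)
  ultimately show ?thesis
    using that[of C "A - C"] C A fA by (auto simp: Un_absorb1)
qed

lemma subspace_eq_of_dim_le:
  assumes "finite B" "W \<subseteq> span B" "subspace V" "V \<subseteq> W" "dim W \<le> dim V"
  shows "V = W"
proof -
  obtain C E where *: "span C = V" "W \<subseteq> span (C \<union> E)" "card E + dim V = dim W" "finite E"
    using complement_basis[OF assms(1-4)] by metis
  then have "card E = 0" using assms(5) by linarith
  then have "E = {}" using * by simp
  then show ?thesis using * assms(4) by auto
qed

lemma dim_le_dim_add_card:
  assumes "finite B" "N \<subseteq> span B" "finite C" "P \<subseteq> span (N \<union> C)"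
  shows "dim P \<le> dim N + card C"
proof -
  obtain A where A: "A \<subseteq> N" "N \<subseteq> span A" "card A = dim N" "finite A"
    using finite_dim_basis[OF assms(1,2)] by metis
  have "N \<union> C \<subseteq> span (A \<union> C)"
    using A(2) span_mono[of A "A \<union> C"] span_superset[of "A \<union> C"] by blast
  then have "P \<subseteq> span (A \<union> C)"
    using assms(4) by (metis span_minimal subspace_span subset_trans)
  then have "dim P \<le> card (A \<union> C)" using dim_le_card A(4) assms(3) by blast
  also have "\<dots> \<le> dim N + card C" using card_Un_le[of A C] A(3) by simp
  finally show ?thesis .
qed

text \<open>Rank-nullity for the map from \<open>A\<close> to the quotient by \<open>U\<close>,
  stated without forming the quotient: the image has dimension \<open>dim (U + f A) - dim U\<close>,
  the kernel is the preimage of \<open>U\<close>.\<close>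

lemma dim_image_preimage:
  assumes lin: "Vector_Spaces.linear scale scale f"
    and A: "finite B" "A \<subseteq> span B" "subspace A"
    and U: "finite C" "U \<subseteq> span C" "subspace U"
  shows "dim (span (U \<union> f ` A)) + dim {a\<in>A. f a \<in> U} = dim U + dim A"
proof -
  have hom: "module_hom scale scale f" using lin by (simp add: module_hom_iff_linear)
  note f_add = module_hom.add[OF hom] and f_scale = module_hom.scale[OF hom]
    and f_zero = module_hom.zero[OF hom] and f_diff = module_hom.diff[OF hom]
    and f_sum = module_hom.sum[OF hom] and f_span_image = module_hom.span_image[OF hom]
  let ?K = "{a\<in>A. f a \<in> U}"
  have sK: "subspace ?K"
    using A(3) U(3) f_add f_scale f_zero
    unfolding subspace_def by auto
  obtain Y E where Y: "independent Y" "Y \<subseteq> ?K" "span Y = ?K" "card Y = dim ?K" "finite Y"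
    and E: "E \<subseteq> A" "Y \<inter> E = {}" "independent (Y \<union> E)" "A \<subseteq> span (Y \<union> E)"
    "card E + dim ?K = dim A" "finite E"
    using complement_basis[OF A(1,2) sK] by (metis (no_types, lifting) mem_Collect_eq subsetI)
  obtain Z where Z: "Z \<subseteq> U" "independent Z" "U \<subseteq> span Z" "card Z = dim U" "finite Z"
    using finite_dim_basis[OF U(1,2)] by metis
  have spZ: "span Z = U" using Z U(3) by (metis span_subspace)
  \<comment> \<open>\<open>E\<close> is independent modulo the kernel: a combination mapped into
    \<open>U\<close> lies in the span of \<open>Y\<close>, and \<open>Y \<union> E\<close> is
    independent. Injectivity on \<open>E\<close>, disjointness from \<open>Z\<close> and
    independence of the union all follow from this.\<close>
  have key: "\<forall>e\<in>E. c e = 0" if "f (\<Sum>e\<in>E. scale (c e) e) \<in> U" for c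
  proof -
    have "(\<Sum>e\<in>E. scale (c e) e) \<in> A"
      using E(1) A(3) by (intro subspace_sum subspace_scale) auto
    then have "(\<Sum>e\<in>E. scale (c e) e) \<in> span Y" using that Y(3) by simp
    then obtain d where d: "(\<Sum>e\<in>E. scale (c e) e) = (\<Sum>x\<in>Y. scale (d x) x)"
      using span_finite[OF Y(5)] by auto
    define g where "g x = (if x \<in> E then c x else - d x)" for x
    have "(\<Sum>x\<in>Y \<union> E. scale (g x) x) = (\<Sum>x\<in>Y. scale (g x) x) + (\<Sum>x\<in>E. scale (g x) x)"
      using E(2,6) Y(5) by (simp add: sum.union_disjoint)
    also have "(\<Sum>x\<in>Y. scale (g x) x) = (\<Sum>x\<in>Y. - scale (d x) x)"
      using E(2) by (intro sum.cong) (auto simp: g_def)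
    also have "(\<Sum>x\<in>E. scale (g x) x) = (\<Sum>x\<in>E. scale (c x) x)"
      by (intro sum.cong) (auto simp: g_def)
    also have "(\<Sum>x\<in>Y. - scale (d x) x) + \<dots> = 0" using d by (simp add: sum_negf)
    finally have "\<forall>x\<in>Y \<union> E. g x = 0"
      using independentD[OF E(3), of "Y \<union> E" g] Y(5) E(6) by blast
    then have "g e = 0" if "e \<in> E" for e using that by blast
    then show ?thesis by (simp add: g_def)
  qed
  have inj: "inj_on f E"
  proof (rule inj_onI, rule ccontr)
    fix x y assume xy: "x \<in> E" "y \<in> E" "f x = f y" "x \<noteq> y"
    define c where "c z = (if z = x then 1 else if z = y then - 1 else (0::'a))" for z
    have "(\<Sum>e\<in>E. scale (c e) e) = (\<Sum>e\<in>{x,y}. scale (c e) e)"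
      using xy E(6) by (intro sum.mono_neutral_right) (auto simp: c_def)
    also have "\<dots> = x - y" using xy by (simp add: c_def)
    finally have "f (\<Sum>e\<in>E. scale (c e) e) = 0" using xy(3) by (simp add: f_diff)
    then have "c x = 0" using key[of c] U(3) xy(1) by (simp add: subspace_0)
    then show False by (simp add: c_def)
  qed
  have disj: "Z \<inter> f ` E = {}"
  proof (rule ccontr)
    assume "Z \<inter> f ` E \<noteq> {}"
    then obtain x where x: "x \<in> E" "f x \<in> U" using Z(1) by auto
    have "(\<Sum>e\<in>E. scale (if e = x then 1 else 0) e) = x"
      using x(1) E(6) by (simp add: if_distrib[of "\<lambda>r. scale r _"] cong: if_cong)
    then have "f (\<Sum>e\<in>E. scale (if e = x then 1 else 0) e) \<in> U" using x(2) by simp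
    from key[OF this] show False using x(1) by auto
  qed
  have ind: "independent (Z \<union> f ` E)"
  proof (rule independent_if_scalars_zero)
    show "finite (Z \<union> f ` E)" using Z(5) E(6) by simp
    fix g x assume s: "(\<Sum>x\<in>Z \<union> f ` E. scale (g x) x) = 0" and x: "x \<in> Z \<union> f ` E"
    have "(\<Sum>x\<in>Z \<union> f ` E. scale (g x) x) = (\<Sum>x\<in>Z. scale (g x) x) + (\<Sum>x\<in>f ` E. scale (g x) x)"
      using Z(5) E(6) disj by (simp add: sum.union_disjoint)
    also have "(\<Sum>x\<in>f ` E. scale (g x) x) = (\<Sum>e\<in>E. scale (g (f e)) (f e))"
      using sum.reindex[OF inj] by simp
    also have "\<dots> = f (\<Sum>e\<in>E. scale (g (f e)) e)" by (simp add: f_sum f_scale)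
    finally have eq: "(\<Sum>x\<in>Z. scale (g x) x) + f (\<Sum>e\<in>E. scale (g (f e)) e) = 0" using s by simp
    have zU: "(\<Sum>x\<in>Z. scale (g x) x) \<in> U"
      using Z(1) U(3) by (intro subspace_sum subspace_scale) auto
    have "f (\<Sum>e\<in>E. scale (g (f e)) e) = - (\<Sum>x\<in>Z. scale (g x) x)"
      using eq by (simp add: add_eq_0_iff)
    then have "f (\<Sum>e\<in>E. scale (g (f e)) e) \<in> U" using zU U(3) by (simp add: subspace_neg)
    from key[OF this] have z: "\<forall>e\<in>E. g (f e) = 0" .
    then have "(\<Sum>x\<in>Z. scale (g x) x) = 0" using eq f_zero by simp
    then have "\<forall>x\<in>Z. g x = 0" using independentD[OF Z(2)] Z(5) by blast
    then show "g x = 0" using z x by auto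
  qed
  have "span (U \<union> f ` A) = span (Z \<union> f ` E)"
  proof
    have "f ` A \<subseteq> f ` span (Y \<union> E)" using E(4) by blast
    also have "\<dots> = span (f ` Y \<union> f ` E)" by (simp add: f_span_image[symmetric] image_Un)
    also have "\<dots> \<subseteq> span (Z \<union> f ` E)"
    proof (rule span_minimal)
      have "f ` Y \<subseteq> span Z" using Y(2) spZ by auto
      then show "f ` Y \<union> f ` E \<subseteq> span (Z \<union> f ` E)"
        using span_mono[of Z "Z \<union> f ` E"] span_superset[of "Z \<union> f ` E"] by blast
    qed simp
    finally have "f ` A \<subseteq> span (Z \<union> f ` E)" .
    then show "span (U \<union> f ` A) \<subseteq> span (Z \<union> f ` E)"
      using spZ span_mono[of Z "Z \<union> f ` E"] by (intro span_minimal) auto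
    show "span (Z \<union> f ` E) \<subseteq> span (U \<union> f ` A)"
      using Z(1) E(1) by (intro span_mono) auto
  qed
  then have "dim (span (U \<union> f ` A)) = card (Z \<union> f ` E)"
    using dim_eq_card_independent[OF ind] by simp
  also have "\<dots> = dim U + card E"
    using disj Z(4,5) E(6) card_image[OF inj] by (simp add: card_Un_disjoint)
  finally show ?thesis using E(5) by simp
qed

lemma card_le_dim_if_independent_family:
  assumes B: "finite B" "V \<subseteq> span B" and V: "\<And>j. j < r \<Longrightarrow> f j \<in> V"
    and ind: "\<And>c. (\<Sum>j<r. scale (c j) (f j)) = 0 \<Longrightarrow> \<forall>j<r. c j = 0"
  shows "r \<le> dim V"
proof -
  have inj: "inj_on f {..<r}"
  proof (rule inj_onI, rule ccontr)
    fix x y assume xy: "x \<in> {..<r}" "y \<in> {..<r}" "f x = f y" "x \<noteq> y"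
    define c where "c z = (if z = x then 1 else if z = y then - 1 else (0::'a))" for z
    have "(\<Sum>e<r. scale (c e) (f e)) = (\<Sum>e\<in>{x,y}. scale (c e) (f e))"
      using xy by (intro sum.mono_neutral_right) (auto simp: c_def)
    also have "\<dots> = 0" using xy by (simp add: c_def)
    finally have "c x = 0" using ind[of c] xy(1) by simp
    then show False by (simp add: c_def)
  qed
  have "independent (f ` {..<r})"
  proof (rule independent_if_scalars_zero)
    fix g x assume s: "(\<Sum>x\<in>f ` {..<r}. scale (g x) x) = 0" and x: "x \<in> f ` {..<r}"
    have "(\<Sum>x\<in>f ` {..<r}. scale (g x) x) = (\<Sum>j<r. scale (g (f j)) (f j))"
      using sum.reindex[OF inj] by simp
    then show "g x = 0" using ind[of "\<lambda>j. g (f j)"] s x by auto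
  qed simp
  moreover obtain C where C: "C \<subseteq> V" "V \<subseteq> span C" "card C = dim V" "finite C"
    using finite_dim_basis[OF B] by metis
  moreover have "f ` {..<r} \<subseteq> span C" using V C(2) by auto
  ultimately have "card (f ` {..<r}) \<le> dim V" using independent_span_bound by metis
  then show ?thesis using card_image[OF inj] by simp
qed

lemma codim_complement:
  assumes "finite B" "W \<subseteq> span B" "subspace V" "V \<subseteq> W"
  obtains E where "finite E" "E \<subseteq> W" "card E + dim V = dim W" "W \<subseteq> span (V \<union> E)"
proof -
  obtain C E where *: "span C = V" "W \<subseteq> span (C \<union> E)" "card E + dim V = dim W" "finite E"
     "C \<subseteq> V" "E \<subseteq> W"
    using complement_basis[OF assms(1-4)] by metis
  then have "W \<subseteq> span (V \<union> E)" using span_mono[of "C \<union> E" "V \<union> E"] by blast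
  then show ?thesis using that * by blast
qed

end

section \<open>Spaces of polynomials\<close>

abbreviation mlinear :: "('v mpoly \<Rightarrow> 'w mpoly) \<Rightarrow> bool" where
  "mlinear \<equiv> module_hom (\<lambda>c p. Const c * p) (\<lambda>c p. Const c * p)"

abbreviation mon :: "('v \<Rightarrow>\<^sub>0 nat) \<Rightarrow> 'v mpoly" where
  "mon m \<equiv> single m 1"

lemma Const_simps [simp]:
  "Const 0 = 0" "Const 1 = 1" "Const (a + b) = Const a + Const b"
  "Const (a * b) = Const a * Const b" "Const (- a) = - Const a" "Const (a - b) = Const a - Const b"
  by (simp_all add: Const_def single_add mult_single single_uminus single_diff)

lemma Const_power: "Const (a ^ n) = Const a ^ n"
  by (induction n) auto

lemma lookup_Const_mult [simp]: "lookup (Const c * p) m = c * lookup p m"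
  unfolding Const_def mult_map_scale_conv_mult[symmetric]
  by (simp add: Poly_Mapping.map.rep_eq when_def)

interpretation mp: vector_space "\<lambda>c (p::'v mpoly). Const c * p"
  by unfold_locales (auto simp: algebra_simps)

lemma linear_mult: "Vector_Spaces.linear (\<lambda>c p. Const c * p) (\<lambda>c p. Const c * p) (\<lambda>p. g * p)"
  for g :: "'v mpoly"
  by unfold_locales (auto simp: algebra_simps)

lemma keys_plus_nat: "keys (a + b) = keys a \<union> keys b"
  for a b :: "'v \<Rightarrow>\<^sub>0 nat"
  by (auto simp: in_keys_iff lookup_add)

definition mdeg :: "('v \<Rightarrow>\<^sub>0 nat) \<Rightarrow> nat" where
  "mdeg m = (\<Sum>v\<in>keys m. lookup m v)"

lemma mdeg_superset:
  "finite A \<Longrightarrow> keys m \<subseteq> A \<Longrightarrow> mdeg m = (\<Sum>v\<in>A. lookup m v)"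
  unfolding mdeg_def by (intro sum.mono_neutral_left) (auto simp: in_keys_iff)

lemma mdeg_plus [simp]: "mdeg (a + b) = mdeg a + mdeg b"
proof -
  let ?A = "keys a \<union> keys b"
  show ?thesis
    using mdeg_superset[of ?A "a + b"] mdeg_superset[of ?A a] mdeg_superset[of ?A b]
    by (simp add: keys_plus_nat lookup_add sum.distrib)
qed

lemma mdeg_0 [simp]: "mdeg 0 = 0"
  by (simp add: mdeg_def)

lemma mdeg_single [simp]: "mdeg (single v k) = k"
  by (simp add: mdeg_def)

definition mspan :: "('v \<Rightarrow>\<^sub>0 nat) set \<Rightarrow> 'v mpoly set" where
  "mspan M = {p. keys p \<subseteq> M}"

lemma mpoly_sum_monomials:
  "p = (\<Sum>m\<in>keys p. Const (lookup p m) * mon m)" for p :: "'v mpoly"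
proof (rule poly_mapping_eqI)
  fix k
  show "lookup p k =
    lookup (\<Sum>m\<in>keys p. Const (lookup p m) * mon m) k"
    by (simp add: lookup_sum lookup_single when_def if_distrib[of "\<lambda>x. _ * x"] not_in_keys_iff_lookup_eq_zero
        cong: if_cong)
qed

lemma subspace_mspan: "mp.subspace (mspan M)"
proof (rule mp.subspaceI)
  fix p q :: "'a mpoly" assume "p \<in> mspan M" "q \<in> mspan M"
  then show "p + q \<in> mspan M" using keys_add[of p q] by (auto simp: mspan_def)
qed (auto simp: mspan_def in_keys_iff)

lemma mon_in_mspan [simp]: "mon m \<in> mspan M \<longleftrightarrow> m \<in> M"
  by (simp add: mspan_def)

lemma mon_inject [simp]: "mon m = mon n \<longleftrightarrow> m = n"
  by (auto dest: arg_cong[of _ _ keys])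

lemma mspan_eq_span: "mspan M = mp.span (mon ` M)"
proof
  show "mp.span (mon ` M) \<subseteq> mspan M"
    by (rule mp.span_minimal) (auto simp: subspace_mspan)
  show "mspan M \<subseteq> mp.span (mon ` M)"
  proof
    fix p :: "'a mpoly" assume "p \<in> mspan M"
    then show "p \<in> mp.span (mon ` M)"
      by (subst mpoly_sum_monomials)
        (intro mp.span_sum mp.span_scale mp.span_base, auto simp: mspan_def)
  qed
qed

lemma independent_mon: "mp.independent (mon ` M)"
  unfolding mp.independent_explicit_module
proof safe
  fix t u v assume t: "finite t" "t \<subseteq> mon ` M" "(\<Sum>v\<in>t. Const (u v) * v) = 0" "v \<in> t"
  then obtain m where m: "v = mon m" by auto
  have "0 = lookup (\<Sum>v\<in>t. Const (u v) * v) m" using t(3) by simp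
  also have "\<dots> = (\<Sum>v\<in>t. u v * lookup v m)" by (simp add: lookup_sum)
  also have "\<dots> = (\<Sum>v\<in>t. if v = mon m then u v else 0)"
  proof (rule sum.cong)
    fix v assume "v \<in> t"
    then obtain m' where "v = mon m'" using t(2) by auto
    then show "u v * lookup v m = (if v = mon m then u v else 0)"
      by (auto simp: lookup_single when_def)
  qed simp
  also have "\<dots> = u v" using t(1,4) m by simp
  finally show "u v = 0" by simp
qed

lemma dim_mspan: "finite M \<Longrightarrow> mp.dim (mspan M) = card M"
  unfolding mspan_eq_span mp.dim_span_eq_card_independent[OF independent_mon]
  by (rule card_image) (simp add: inj_on_def)

lemma mspan_mono: "M \<subseteq> N \<Longrightarrow> mspan M \<subseteq> mspan N"
  by (auto simp: mspan_def)

lemma mspan_mult: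
  assumes "p \<in> mspan M" "q \<in> mspan N" "\<And>a b. a \<in> M \<Longrightarrow> b \<in> N \<Longrightarrow> a + b \<in> L"
  shows "p * q \<in> mspan L"
  unfolding mspan_def
proof safe
  fix m assume "m \<in> keys (p * q)"
  then obtain a b where "m = a + b" "a \<in> keys p" "b \<in> keys q"
    using keys_mult[of p q] by auto
  then show "m \<in> L" using assms by (auto simp: mspan_def)
qed

definition mons :: "'v set \<Rightarrow> nat \<Rightarrow> ('v \<Rightarrow>\<^sub>0 nat) set" where
  "mons W n = {m. keys m \<subseteq> W \<and> mdeg m = n}"

definition forms :: "'v set \<Rightarrow> nat \<Rightarrow> 'v mpoly set" where
  "forms W n = mspan (mons W n)"

lemma finite_mons:
  assumes "finite W" shows "finite (mons W n)"
proof -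
  have "mons W n \<subseteq> {m. \<forall>v. lookup m v \<in> (if v \<in> W then {..n} else {0})}"
  proof
    fix m :: "'a \<Rightarrow>\<^sub>0 nat" assume m: "m \<in> mons W n"
    have "lookup m v \<le> n" if "v \<in> W" for v
    proof (cases "v \<in> keys m")
      case True
      then have "lookup m v \<le> mdeg m" unfolding mdeg_def by (intro member_le_sum) auto
      then show ?thesis using m by (simp add: mons_def)
    qed (simp add: not_in_keys_iff_lookup_eq_zero)
    then show "m \<in> {m. \<forall>v. lookup m v \<in> (if v \<in> W then {..n} else {0})}"
      using m by (auto simp: mons_def in_keys_iff)
  qed
  moreover have "finite \<dots>"
  proof (rule finite_imageD)
    have "finite {f::'a \<Rightarrow> nat. \<forall>v. (v \<in> W \<longrightarrow> f v \<in> {..n}) \<and> (v \<notin> W \<longrightarrow> f v = 0)}"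
      using assms by (intro finite_set_of_finite_funs) auto
    then show "finite (lookup ` {m. \<forall>v. lookup m v \<in> (if v \<in> W then {..n} else {0})})"
      by (rule rev_finite_subset) auto
    show "inj_on lookup {m::'a \<Rightarrow>\<^sub>0 nat. \<forall>v. lookup m v \<in> (if v \<in> W then {..n} else {0})}"
      by (auto simp: inj_on_def poly_mapping_eqI)
  qed
  ultimately show ?thesis by (rule finite_subset)
qed

lemma mons_plus: "a \<in> mons W i \<Longrightarrow> b \<in> mons W j \<Longrightarrow> a + b \<in> mons W (i + j)"
  by (auto simp: mons_def keys_plus_nat)

lemma mons_mono: "W \<subseteq> V \<Longrightarrow> mons W n \<subseteq> mons V n"
  by (auto simp: mons_def)

lemma forms_mono: "W \<subseteq> V \<Longrightarrow> forms W n \<subseteq> forms V n"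
  unfolding forms_def by (intro mspan_mono mons_mono)

lemma forms_mult: "p \<in> forms W i \<Longrightarrow> q \<in> forms W j \<Longrightarrow> p * q \<in> forms W (i + j)"
  unfolding forms_def by (erule mspan_mult) (auto simp: mons_plus)

lemma subspace_forms: "mp.subspace (forms W n)"
  unfolding forms_def by (rule subspace_mspan)

lemma mon_in_forms [simp]: "mon m \<in> forms W n \<longleftrightarrow> m \<in> mons W n"
  by (simp add: forms_def)

lemma forms_eq_span: "forms W n = mp.span (mon ` mons W n)"
  unfolding forms_def by (rule mspan_eq_span)

lemma one_in_forms: "1 \<in> forms W 0"
  using mon_in_forms[of 0 W 0] by (simp add: mons_def)

lemma forms_power: "p \<in> forms W i \<Longrightarrow> p ^ e \<in> forms W (e * i)"
  by (induction e) (auto simp: one_in_forms intro: forms_mult)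

lemma Var_in_forms: "v \<in> W \<Longrightarrow> Var v \<in> forms W 1"
  by (simp add: Var_def mons_def)

lemma forms_prod:
  "finite F \<Longrightarrow> (\<And>u. u \<in> F \<Longrightarrow> f u \<in> forms W 1) \<Longrightarrow> (\<Prod>u\<in>F. f u) \<in> forms W (card F)"
proof (induction F rule: finite_induct)
  case (insert x F)
  then have "f x * prod f F \<in> forms W (1 + card F)" by (intro forms_mult) auto
  then show ?case using insert by simp
qed (simp add: one_in_forms)

section \<open>Polynomial curves\<close>

text \<open>A path polynomial in \<open>t\<close> with coefficients in the polynomial ring.
  Evaluating a univariate \<open>Q\<close> at a constant makes closure under ring operations a
  property of \<open>poly\<close>.\<close>

definition curve :: "(real \<Rightarrow> 'v mpoly) \<Rightarrow> bool" where
  "curve f \<longleftrightarrow> (\<exists>Q. \<forall>t. f t = poly Q (Const t))"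

lemma curve_const: "curve (\<lambda>t. c)"
  unfolding curve_def by (rule exI[of _ "[:c:]"]) simp

lemma curve_Const: "curve Const"
  unfolding curve_def by (rule exI[of _ "[:0,1:]"]) simp

lemma curve_add: "curve f \<Longrightarrow> curve g \<Longrightarrow> curve (\<lambda>t. f t + g t)"
  unfolding curve_def by (metis poly_add)

lemma curve_diff: "curve f \<Longrightarrow> curve g \<Longrightarrow> curve (\<lambda>t. f t - g t)"
  unfolding curve_def by (metis poly_diff)

lemma curve_mult: "curve f \<Longrightarrow> curve g \<Longrightarrow> curve (\<lambda>t. f t * g t)"
  unfolding curve_def by (metis poly_mult)

lemma curve_power: "curve f \<Longrightarrow> curve (\<lambda>t. f t ^ n)"
  unfolding curve_def by (metis poly_power)

lemma curve_prod: "(\<And>u. u \<in> F \<Longrightarrow> curve (f u)) \<Longrightarrow> curve (\<lambda>t. \<Prod>u\<in>F. f u t)"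
  by (induction F rule: infinite_finite_induct) (auto intro: curve_mult curve_const)

lemma linear_functional_curve:
  fixes \<phi> :: "'v mpoly \<Rightarrow> real"
  assumes "curve f" and "\<And>p q. \<phi> (p + q) = \<phi> p + \<phi> q" "\<And>c p. \<phi> (Const c * p) = c * \<phi> p"
  shows "\<exists>q. \<forall>t. \<phi> (f t) = poly q t"
proof -
  obtain Q where Q: "\<And>t. f t = poly Q (Const t)" using assms(1) by (auto simp: curve_def)
  have "\<exists>q. \<forall>t. \<phi> (poly Q (Const t)) = poly q t"
  proof (induction Q)
    case 0
    have "\<phi> 0 = 0" using assms(3)[of 0 0] by simp
    then show ?case by (intro exI[of _ 0]) simp
  next
    case (pCons a Q)
    then obtain q where q: "\<And>t. \<phi> (poly Q (Const t)) = poly q t" by auto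
    show ?case by (rule exI[of _ "pCons (\<phi> a) q"]) (simp add: assms q)
  qed
  then show ?thesis using Q by auto
qed

text \<open>The rank is lower semicontinuous: some minor is nonzero at \<open>t0\<close>, and as a
  polynomial in \<open>t\<close> it has finitely many zeros.\<close>

lemma dim_curve_generic:
  fixes f :: "'a \<Rightarrow> real \<Rightarrow> 'v mpoly"
  assumes A: "finite A" and f: "\<And>a. a \<in> A \<Longrightarrow> curve (f a)"
  shows "finite {t. mp.dim ((\<lambda>a. f a t) ` A) < mp.dim ((\<lambda>a. f a t0) ` A)}"
proof -
  let ?S = "\<lambda>t. (\<lambda>a. f a t) ` A"
  obtain C where C: "C \<subseteq> ?S t0" "mp.independent C" "card C = mp.dim (?S t0)" "finite C"
    using mp.finite_dim_basis[of "?S t0" "?S t0"] A mp.span_superset by (metis finite_imageI)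
  define r where "r = card C"
  obtain e where e: "bij_betw e {..<r} C"
    using ex_bij_betw_nat_finite[OF C(4)] by (auto simp: r_def atLeast0LessThan)
  have "\<forall>j<r. \<exists>a\<in>A. f a t0 = e j" using e C(1) by (fastforce simp: bij_betw_def)
  then obtain a where a: "\<And>j. j < r \<Longrightarrow> a j \<in> A \<and> f (a j) t0 = e j" by metis
  \<comment> \<open>Coordinates with respect to a basis extending \<open>C\<close> give functionals
    \<open>\<phi> i\<close> dual to the vectors \<open>e j\<close>.\<close>
  define B where "B = mp.extend_basis C"
  have B: "mp.independent B" "mp.span B = UNIV" "C \<subseteq> B"
    unfolding B_def using C(2) mp.independent_extend_basis mp.extend_basis_superset by auto
  define \<phi> where "\<phi> i p = mp.representation B p (e i)" for i p
  have \<phi>_add: "\<phi> i (p + q) = \<phi> i p + \<phi> i q" for i p q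
    unfolding \<phi>_def using B by (simp add: mp.representation_add)
  have \<phi>_scale: "\<phi> i (Const c * p) = c * \<phi> i p" for i c p
    unfolding \<phi>_def using B by (simp add: mp.representation_scale)
  have \<phi>_e: "\<phi> i (e j) = (if i = j then 1 else 0)" if "i < r" "j < r" for i j
  proof -
    have "e j \<in> B" using e that B(3) by (auto simp: bij_betw_def)
    moreover have "e j = e i \<longleftrightarrow> i = j" using e that by (auto simp: bij_betw_def inj_on_def)
    ultimately show ?thesis unfolding \<phi>_def using mp.representation_basis[OF B(1)] by auto
  qed
  define q where "q i j = (SOME q. \<forall>t. \<phi> i (f (a j) t) = poly q t)" for i j
  have ex: "\<exists>q. \<forall>t. \<phi> i (f (a j) t) = poly q t" if "j < r" for i j
    using linear_functional_curve[of "f (a j)" "\<phi> i"] f a[OF that] \<phi>_add \<phi>_scale by blast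
  have q: "\<phi> i (f (a j) t) = poly (q i j) t" if "j < r" for i j t
    using someI_ex[OF ex[OF that, of i]] unfolding q_def[symmetric] by (rule spec)
  \<comment> \<open>The minor: a square matrix of polynomials in \<open>t\<close> that becomes the
    identity at \<open>t0\<close>, so its determinant is a nonzero polynomial.\<close>
  define M where "M = mat r r (\<lambda>(i,j). q i j)"
  have M: "M \<in> carrier_mat r r" by (simp add: M_def)
  let ?M = "\<lambda>t. map_mat (\<lambda>p. poly p t) M"
  have Mc: "?M t \<in> carrier_mat r r" for t by (simp add: M_def)
  have det: "Determinant.det (?M t) = poly (Determinant.det M) t" for t
  proof -
    interpret h: comm_ring_hom "\<lambda>p. poly p t" by unfold_locales auto
    show ?thesis by (rule h.hom_det)
  qed
  have "?M t0 = 1\<^sub>m r"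
  proof (rule eq_matI)
    fix i j assume "i < dim_row (1\<^sub>m r :: real mat)" "j < dim_col (1\<^sub>m r :: real mat)"
    then have ij: "i < r" "j < r" by auto
    then have "poly (q i j) t0 = (if i = j then 1 else 0)"
      using q[of j i t0] a[of j] \<phi>_e[of i j] by simp
    then show "?M t0 $$ (i, j) = 1\<^sub>m r $$ (i, j)" using ij by (simp add: M_def)
  qed (auto simp: M_def)
  then have "poly (Determinant.det M) t0 = 1" using det[of t0] by simp
  then have "Determinant.det M \<noteq> 0" by auto
  then have fin: "finite {t. poly (Determinant.det M) t = 0}" by (rule poly_roots_finite)
  have "r \<le> mp.dim (?S t)" if "poly (Determinant.det M) t \<noteq> 0" for t
  proof (rule mp.card_le_dim_if_independent_family[where f = "\<lambda>j. f (a j) t"])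
    show "finite (?S t)" using A by simp
    show "?S t \<subseteq> mp.span (?S t)" by (rule mp.span_superset)
    show "f (a j) t \<in> ?S t" if "j < r" for j using a that by auto
    fix c assume c: "(\<Sum>j<r. Const (c j) * f (a j) t) = 0"
    have \<phi>_sum: "\<phi> i (\<Sum>j\<in>N. g j) = (\<Sum>j\<in>N. \<phi> i (g j))" for i g and N :: "nat set"
      using \<phi>_scale[of i 0 0] by (induction N rule: infinite_finite_induct) (auto simp: \<phi>_add)
    have "(\<Sum>j<r. poly (q i j) t * c j) = \<phi> i (\<Sum>j<r. Const (c j) * f (a j) t)" for i
      by (simp add: \<phi>_sum \<phi>_scale q mult.commute)
    then have z: "(\<Sum>j<r. poly (q i j) t * c j) = 0" for i using c \<phi>_scale[of i 0 0] by simp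
    \<comment> \<open>A linear relation among the vectors \<open>f (a j) t\<close> is a kernel
      vector of the minor, hence trivial where the determinant is nonzero.\<close>
    have "?M t *\<^sub>v vec r c = 0\<^sub>v r"
      by (rule eq_vecI) (auto simp: M_def scalar_prod_def z atLeast0LessThan)
    moreover have "Determinant.det (?M t) \<noteq> 0" using that det by simp
    ultimately have v: "vec r c = 0\<^sub>v r"
      using det_0_iff_vec_prod_zero_field[OF Mc[of t]] vec_carrier[of r c] by blast
    show "\<forall>j<r. c j = 0"
    proof safe
      fix j assume "j < r"
      then show "c j = 0" using arg_cong[OF v, of "\<lambda>w. w $ j"] by simp
    qed
  qed
  then have "{t. mp.dim (?S t) < mp.dim (?S t0)} \<subseteq> {t. poly (Determinant.det M) t = 0}"
    using C(3) r_def by (auto simp: not_le[symmetric])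
  then show ?thesis using fin by (rule finite_subset)
qed

section \<open>Graded pieces of homogeneous ideals\<close>

text \<open>\<open>part W K G n\<close> is the degree \<open>n\<close> piece of the ideal generated by the non-faces of \<open>K\<close>
  (including the variables in \<open>W\<close> that are not vertices of \<open>K\<close>) and by the forms \<open>g\<close> with
  \<open>(g, d) \<in> G\<close>, where \<open>d\<close> is the degree of \<open>g\<close>.\<close>

definition nonface_mons :: "'v set \<Rightarrow> 'v set set \<Rightarrow> nat \<Rightarrow> ('v \<Rightarrow>\<^sub>0 nat) set" where
  "nonface_mons W K n = {m \<in> mons W n. keys m \<notin> K}"

definition gens :: "'v set \<Rightarrow> 'v set set \<Rightarrow> ('v mpoly \<times> nat) set \<Rightarrow> nat \<Rightarrow> 'v mpoly set" where
  "gens W K G n = mon ` nonface_mons W K n \<union>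
     {g * mon m | g d m. (g, d) \<in> G \<and> d \<le> n \<and> m \<in> mons W (n - d)}"

definition part :: "'v set \<Rightarrow> 'v set set \<Rightarrow> ('v mpoly \<times> nat) set \<Rightarrow> nat \<Rightarrow> 'v mpoly set" where
  "part W K G n = mp.span (gens W K G n)"

definition graded_gens :: "'v set \<Rightarrow> ('v mpoly \<times> nat) set \<Rightarrow> bool" where
  "graded_gens W G \<longleftrightarrow> (\<forall>(g, d)\<in>G. g \<in> forms W d)"

definition down_closed :: "'v set set \<Rightarrow> bool" where
  "down_closed K \<longleftrightarrow> (\<forall>T\<in>K. \<forall>U\<subseteq>T. U \<in> K)"

lemma finite_nonface_mons: "finite W \<Longrightarrow> finite (nonface_mons W K n)"
  unfolding nonface_mons_def by (rule finite_subset[OF _ finite_mons[of W n]]) auto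

lemma subspace_part: "mp.subspace (part W K G n)"
  by (simp add: part_def)

lemma part_add: "p \<in> part W K G n \<Longrightarrow> q \<in> part W K G n \<Longrightarrow> p + q \<in> part W K G n"
  by (rule mp.subspace_add[OF subspace_part])

lemma part_scale: "p \<in> part W K G n \<Longrightarrow> Const c * p \<in> part W K G n"
  by (rule mp.subspace_scale[OF subspace_part])

lemma part_0: "0 \<in> part W K G n"
  by (rule mp.subspace_0[OF subspace_part])

lemma part_sum: "(\<And>i. i \<in> A \<Longrightarrow> f i \<in> part W K G n) \<Longrightarrow> sum f A \<in> part W K G n"
  by (rule mp.subspace_sum[OF subspace_part])

lemma gens_mono: "K' \<subseteq> K \<Longrightarrow> G \<subseteq> G' \<Longrightarrow> gens W K G n \<subseteq> gens W K' G' n"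
  unfolding gens_def nonface_mons_def by blast

lemma part_mono: "K' \<subseteq> K \<Longrightarrow> G \<subseteq> G' \<Longrightarrow> part W K G n \<subseteq> part W K' G' n"
  unfolding part_def by (intro mp.span_mono gens_mono)

lemma part_monomial: "m \<in> mons W n \<Longrightarrow> keys m \<notin> K \<Longrightarrow> mon m \<in> part W K G n"
  unfolding part_def gens_def nonface_mons_def by (intro mp.span_base) auto

lemma part_gen_mon: "(g, d) \<in> G \<Longrightarrow> m \<in> mons W k \<Longrightarrow> g * mon m \<in> part W K G (d + k)"
  unfolding part_def gens_def by (intro mp.span_base UnI2 CollectI exI[of _ g] exI[of _ d] exI[of _ m]) auto

lemma part_subset_forms: "graded_gens W G \<Longrightarrow> part W K G n \<subseteq> forms W n"
  unfolding part_def
proof (rule mp.span_minimal)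
  assume G: "graded_gens W G"
  have "g * mon m \<in> forms W n" if "(g, d) \<in> G" "d \<le> n" "m \<in> mons W (n - d)" for g d m
    using forms_mult[of g W d "mon m" "n - d"] that G by (auto simp: graded_gens_def)
  then show "gens W K G n \<subseteq> forms W n"
    by (auto simp: gens_def nonface_mons_def)
qed (rule subspace_forms)

lemma forms_induct [consumes 1, case_names zero add scale mon]:
  assumes "p \<in> forms W n" "Q 0" "\<And>p q. Q p \<Longrightarrow> Q q \<Longrightarrow> Q (p + q)" "\<And>c p. Q p \<Longrightarrow> Q (Const c * p)"
    "\<And>m. m \<in> mons W n \<Longrightarrow> Q (mon m)"
  shows "Q p"
  using assms(1) unfolding forms_eq_span
  by (rule mp.span_induct) (auto simp: mp.subspace_def assms)

lemma part_induct [consumes 1, case_names zero add scale monomial gen]: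
  assumes "p \<in> part W K G n" "Q 0" "\<And>p q. Q p \<Longrightarrow> Q q \<Longrightarrow> Q (p + q)" "\<And>c p. Q p \<Longrightarrow> Q (Const c * p)"
    "\<And>m. m \<in> mons W n \<Longrightarrow> keys m \<notin> K \<Longrightarrow> Q (mon m)"
    "\<And>g d m. (g, d) \<in> G \<Longrightarrow> d \<le> n \<Longrightarrow> m \<in> mons W (n - d) \<Longrightarrow> Q (g * mon m)"
  shows "Q p"
  using assms(1) unfolding part_def
  by (rule mp.span_induct) (auto simp: mp.subspace_def gens_def nonface_mons_def assms)

lemma part_gen_forms:
  assumes "(g, d) \<in> G" "p \<in> forms W k" shows "g * p \<in> part W K G (d + k)"
  using assms(2)
proof (induction rule: forms_induct)
  case (scale c p)
  then show ?case using part_scale[of "g * p"] by (simp add: mult.left_commute)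
qed (auto simp: part_0 distrib_left part_add part_gen_mon[OF assms(1)])

text \<open>Multiplying can only enlarge the support of a monomial, and supersets of non-faces are
  non-faces because \<open>K\<close> is closed under subsets.\<close>

lemma part_mult:
  assumes K: "down_closed K" and p: "p \<in> part W K G n" and q: "q \<in> forms W j"
  shows "p * q \<in> part W K G (n + j)"
  using p
proof (induction rule: part_induct)
  case (add p q)
  then show ?case by (simp add: distrib_right part_add)
next
  case (scale c p)
  then show ?case by (simp add: mult.assoc part_scale)
next
  case (monomial m)
  from q show ?case
  proof (induction rule: forms_induct)
    case (add p q)
    then show ?case by (simp add: distrib_left part_add)
  next
    case (scale c p)
    then show ?case using part_scale by (metis mult.left_commute)
  next
    case (mon m')
    have "keys (m + m') \<notin> K"
      using K monomial(2) by (auto simp: keys_plus_nat down_closed_def)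
    then have "mon (m + m') \<in> part W K G (n + j)"
      using monomial(1) mon by (intro part_monomial mons_plus)
    then show ?case by (simp add: mult_single)
  qed (simp add: part_0)
next
  case (gen g d m)
  have "mon m * q \<in> forms W (n - d + j)"
    using gen(3) q by (intro forms_mult) auto
  then have "g * (mon m * q) \<in> part W K G (d + (n - d + j))"
    by (rule part_gen_forms[OF gen(1)])
  then show ?case using gen(2) by (simp add: mult.assoc)
qed (simp add: part_0)

text \<open>A new generator contributes exactly the image of multiplication by it, which is the
  shape \<open>dim_image_preimage\<close> expects.\<close>

lemma part_Un_gens:
  "part W K (insert (g, d) G) (d + n) = mp.span (part W K G (d + n) \<union> (\<lambda>p. g * p) ` forms W n)"
proof
  show "part W K (insert (g, d) G) (d + n) \<subseteq> mp.span (part W K G (d + n) \<union> (\<lambda>p. g * p) ` forms W n)"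
    unfolding part_def[of W K "insert (g, d) G"]
  proof (rule mp.span_minimal)
    show "gens W K (insert (g, d) G) (d + n) \<subseteq> mp.span (part W K G (d + n) \<union> (\<lambda>p. g * p) ` forms W n)"
    proof
      fix x assume "x \<in> gens W K (insert (g, d) G) (d + n)"
      then have "x \<in> gens W K G (d + n) \<or> x \<in> (\<lambda>p. g * p) ` forms W n"
        by (auto simp: gens_def)
      then show "x \<in> mp.span (part W K G (d + n) \<union> (\<lambda>p. g * p) ` forms W n)"
        using mp.span_superset[of "gens W K G (d + n)"]
        by (intro mp.span_base) (auto simp: part_def)
    qed
  qed simp
  show "mp.span (part W K G (d + n) \<union> (\<lambda>p. g * p) ` forms W n) \<subseteq> part W K (insert (g, d) G) (d + n)"
    using part_mono[of K K G "insert (g, d) G" W "d + n"] part_gen_forms[of g d "insert (g, d) G" _ W n K]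
    by (intro mp.span_minimal subspace_part) auto
qed

lemma part_insert_lower: "n < d \<Longrightarrow> part W K (insert (g, d) G) n = part W K G n"
proof -
  assume "n < d"
  then have "gens W K (insert (g, d) G) n = gens W K G n"
    unfolding gens_def by auto
  then show ?thesis by (simp add: part_def)
qed

lemma part_insert_decomp:
  assumes "p \<in> part W K (insert (g, d) G) (d + n)"
  obtains a b where "a \<in> part W K G (d + n)" "b \<in> forms W n" "p = a + g * b"
proof -
  have "p \<in> mp.span (part W K G (d + n) \<union> (\<lambda>p. g * p) ` forms W n)"
    using assms by (simp only: part_Un_gens)
  then obtain x y where "p = x + y" "x \<in> mp.span (part W K G (d + n))" "y \<in> mp.span ((\<lambda>p. g * p) ` forms W n)"
    unfolding mp.span_Un by auto
  moreover have "mp.span ((\<lambda>p. g * p) ` forms W n) = (\<lambda>p. g * p) ` forms W n"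
    using module_hom.subspace_image[OF linear_mult[of g, folded module_hom_iff_linear] subspace_forms]
    by (simp add: mp.span_eq_iff)
  moreover have "mp.span (part W K G (d + n)) = part W K G (d + n)"
    using subspace_part by (simp add: mp.span_eq_iff)
  ultimately show ?thesis using that by auto
qed

section \<open>Hilbert series\<close>

definition thetas :: "(nat \<Rightarrow> 'v mpoly) \<Rightarrow> nat \<Rightarrow> ('v mpoly \<times> nat) set" where
  "thetas \<theta> r = (\<lambda>i. (\<theta> i, 1)) ` {..<r}"

lemma thetas_Suc: "thetas \<theta> (Suc r) = insert (\<theta> r, 1) (thetas \<theta> r)"
  by (simp add: thetas_def lessThan_Suc)

lemma thetas_0 [simp]: "thetas \<theta> 0 = {}"
  by (simp add: thetas_def)

lemma finite_thetas [simp]: "finite (thetas \<theta> r)"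
  by (simp add: thetas_def)

definition hilb :: "'v set \<Rightarrow> 'v set set \<Rightarrow> ('v mpoly \<times> nat) set \<Rightarrow> real fps" where
  "hilb W K G = Abs_fps (\<lambda>n. real (mp.dim (forms W n)) - real (mp.dim (part W K G n)))"

text \<open>The degree \<open>n\<close> piece of the colon ideal by a linear form \<open>g\<close>.
  Modulo the ideal it is the kernel of multiplication by \<open>g\<close> on the quotient, whose
  Hilbert series is \<open>hilb_ker\<close>.\<close>

definition colon_part :: "'v set \<Rightarrow> 'v set set \<Rightarrow> ('v mpoly \<times> nat) set \<Rightarrow> 'v mpoly \<Rightarrow> nat \<Rightarrow> 'v mpoly set" where
  "colon_part W K G g n = {p \<in> forms W n. g * p \<in> part W K G (Suc n)}"

definition hilb_ker :: "'v set \<Rightarrow> 'v set set \<Rightarrow> ('v mpoly \<times> nat) set \<Rightarrow> 'v mpoly \<Rightarrow> real fps" where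
  "hilb_ker W K G g = Abs_fps (\<lambda>n. real (mp.dim (colon_part W K G g n)) - real (mp.dim (part W K G n)))"

lemma finite_spanning_forms: "finite W \<Longrightarrow> finite (mon ` mons W n) \<and> forms W n \<subseteq> mp.span (mon ` mons W n)"
  by (simp add: finite_mons forms_eq_span)

lemma dim_mono_forms:
  "finite W \<Longrightarrow> B \<subseteq> forms W n \<Longrightarrow> A \<subseteq> B \<Longrightarrow> mp.dim A \<le> mp.dim B"
  using finite_spanning_forms[of W n] mp.dim_mono_finite[of "mon ` mons W n" B A] mp.span_superset[of B]
  by blast

lemma eq_of_dim_forms:
  "finite W \<Longrightarrow> B \<subseteq> forms W n \<Longrightarrow> mp.subspace A \<Longrightarrow> A \<subseteq> B \<Longrightarrow> mp.dim B \<le> mp.dim A \<Longrightarrow> A = B"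
  using finite_spanning_forms[of W n] mp.subspace_eq_of_dim_le[of "mon ` mons W n" B A]
  by blast

lemma part_subset_colon:
  assumes "graded_gens W G" "g \<in> forms W 1" "down_closed K"
  shows "part W K G n \<subseteq> colon_part W K G g n"
  using part_subset_forms[OF assms(1), of K n] part_mult[OF assms(3) _ assms(2), of _ G n]
  by (auto simp: colon_part_def mult.commute)

lemma dim_mult_step:
  assumes W: "finite W" and G: "graded_gens W G" and g: "g \<in> forms W d"
  shows "mp.dim (part W K (insert (g, d) G) (d + n)) + mp.dim {p \<in> forms W n. g * p \<in> part W K G (d + n)}
    = mp.dim (part W K G (d + n)) + mp.dim (forms W n)"
  unfolding part_Un_gens
  using mp.dim_image_preimage[OF linear_mult[of g], of "mon ` mons W n" "forms W n" "mon ` mons W (d + n)" "part W K G (d + n)"]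
    finite_spanning_forms[OF W] subspace_forms subspace_part part_subset_forms[OF G, of K "d + n"] by blast

text \<open>The Euler characteristic of the exact sequence kernel, quotient, quotient, quotient
  modulo \<open>g\<close>, with multiplication by \<open>g\<close> raising the degree by
  one.\<close>

lemma hilb_step:
  assumes W: "finite W" and G: "graded_gens W G" and g: "g \<in> forms W 1"
  shows "hilb W K (insert (g, 1) G) = (1 - fps_X) * hilb W K G + fps_X * hilb_ker W K G g"
proof (rule fps_ext)
  fix n
  show "fps_nth (hilb W K (insert (g, 1) G)) n =
    fps_nth ((1 - fps_X) * hilb W K G + fps_X * hilb_ker W K G g) n"
  proof (cases n)
    case 0
    then show ?thesis by (simp add: hilb_def left_diff_distrib part_insert_lower)
  next
    case (Suc k)
    have "real (mp.dim (part W K (insert (g, 1) G) (Suc k))) + real (mp.dim (colon_part W K G g k))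
      = real (mp.dim (part W K G (Suc k))) + real (mp.dim (forms W k))"
      using dim_mult_step[OF W G g, of K k] unfolding colon_part_def by simp
    then show ?thesis using Suc by (simp add: hilb_def hilb_ker_def left_diff_distrib)
  qed
qed

section \<open>The h-polynomial and the Hilbert series of a face ring\<close>

lemma one_minus_X_power_nth:
  "fps_nth ((1 - fps_X) ^ m :: real fps) k = (-1) ^ k * real (m choose k)"
proof (induction m arbitrary: k)
  case 0
  then show ?case by (cases k) auto
next
  case (Suc m)
  then show ?case by (cases k) (auto simp: left_diff_distrib algebra_simps)
qed

text \<open>The h-polynomial, written as a sum over faces so that it can be split along sets of
  faces, and kept as a power series so that it compares directly with Hilbert series.\<close>

definition hpoly :: "'v set set \<Rightarrow> real fps" where
  "hpoly K = (\<Sum>T\<in>K. fps_X ^ card T * (1 - fps_X) ^ (cdim K - card T))"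

lemma card_le_cdim: "finite K \<Longrightarrow> T \<in> K \<Longrightarrow> card T \<le> cdim K"
  unfolding cdim_def by (intro cSup_upper) (auto intro: bdd_above_finite)

lemma hpoly_nth:
  assumes K: "finite K"
  shows "fps_nth (hpoly K) i = of_int (h_num K i)"
proof -
  have "fps_nth (hpoly K) i = (\<Sum>T\<in>K. if card T \<le> i then (-1) ^ (i - card T) * real ((cdim K - card T) choose (i - card T)) else 0)"
    unfolding hpoly_def fps_sum_nth
    by (intro sum.cong) (auto simp: fps_X_power_mult_nth one_minus_X_power_nth)
  also have "\<dots> = (\<Sum>T\<in>{T\<in>K. card T \<in> {..i}}. (-1) ^ (i - card T) * real ((cdim K - card T) choose (i - card T)))"
    using K by (intro sum.mono_neutral_cong_right) auto
  also have "\<dots> = (\<Sum>j\<le>i. \<Sum>T\<in>{T\<in>{T\<in>K. card T \<in> {..i}}. card T = j}. (-1) ^ (i - card T) * real ((cdim K - card T) choose (i - card T)))"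
    using K by (intro sum.group[symmetric]) auto
  also have "\<dots> = (\<Sum>j\<le>i. (-1) ^ (i - j) * real ((cdim K - j) choose (i - j)) * real (f_num K j))"
  proof (rule sum.cong)
    fix j assume "j \<in> {..i}"
    then have "{T\<in>{T\<in>K. card T \<in> {..i}}. card T = j} = {T\<in>K. card T = j}" by auto
    moreover have "(\<Sum>T\<in>{T\<in>K. card T = j}. (-1) ^ (i - card T) * real ((cdim K - card T) choose (i - card T)))
      = (\<Sum>T\<in>{T\<in>K. card T = j}. (-1) ^ (i - j) * real ((cdim K - j) choose (i - j)))"
      by (intro sum.cong) auto
    ultimately show "(\<Sum>T\<in>{T\<in>{T\<in>K. card T \<in> {..i}}. card T = j}. (-1) ^ (i - card T) * real ((cdim K - card T) choose (i - card T)))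
       = (-1) ^ (i - j) * real ((cdim K - j) choose (i - j)) * real (f_num K j)"
      by (simp add: f_num_def)
  qed simp
  finally show ?thesis by (simp add: h_num_def)
qed

lemma hpoly_nth_beyond:
  assumes "finite K" "cdim K < i" shows "fps_nth (hpoly K) i = 0"
  unfolding hpoly_def fps_sum_nth
proof (rule sum.neutral, safe)
  fix T assume "T \<in> K"
  then have "card T \<le> cdim K" by (rule card_le_cdim[OF assms(1)])
  then show "fps_nth (fps_X ^ card T * (1 - fps_X) ^ (cdim K - card T)) i = (0::real)"
    using assms(2) by (auto simp: fps_X_power_mult_nth one_minus_X_power_nth)
qed

definition exact_mons :: "'v set \<Rightarrow> nat \<Rightarrow> ('v \<Rightarrow>\<^sub>0 nat) set" where
  "exact_mons T n = {m. keys m = T \<and> mdeg m = n}"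

lemma finite_exact_mons:
  assumes "finite T" shows "finite (exact_mons T n)"
proof (rule finite_subset)
  show "exact_mons T n \<subseteq> mons T n"
  proof
    fix m assume "m \<in> exact_mons T n"
    then show "m \<in> mons T n" by (simp add: exact_mons_def mons_def)
  qed
  show "finite (mons T n)" using assms by (rule finite_mons)
qed

text \<open>Dividing by the variable of \<open>v\<close> either keeps \<open>v\<close> in the
  support or removes it; this is the recursion behind the next series.\<close>

lemma exact_mons_insert_Suc:
  assumes "v \<notin> T"
  shows "exact_mons (insert v T) (Suc n) =
    (\<lambda>m. m + single v 1) ` (exact_mons (insert v T) n \<union> exact_mons T n)"
proof
  show "(\<lambda>m. m + single v 1) ` (exact_mons (insert v T) n \<union> exact_mons T n)
    \<subseteq> exact_mons (insert v T) (Suc n)"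
  proof
    fix m assume "m \<in> (\<lambda>m. m + single v 1) ` (exact_mons (insert v T) n \<union> exact_mons T n)"
    then obtain m' where "m = m' + single v 1" "m' \<in> exact_mons (insert v T) n \<union> exact_mons T n"
      by blast
    then show "m \<in> exact_mons (insert v T) (Suc n)"
      by (elim UnE) (simp_all add: exact_mons_def keys_plus_nat)
  qed
  show "exact_mons (insert v T) (Suc n) \<subseteq>
    (\<lambda>m. m + single v 1) ` (exact_mons (insert v T) n \<union> exact_mons T n)"
  proof
    fix m assume m: "m \<in> exact_mons (insert v T) (Suc n)"
    define m' where "m' = m - single v 1"
    have v: "lookup m v \<ge> 1"
    proof -
      have "v \<in> keys m" using m by (simp add: exact_mons_def)
      then show ?thesis by (simp add: in_keys_iff)
    qed
    have eq: "m = m' + single v 1"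
      using v by (intro poly_mapping_eqI) (auto simp: m'_def lookup_add lookup_minus lookup_single when_def)
    have "keys m = insert v T" "mdeg m = Suc n" using m by (auto simp: exact_mons_def)
    then have k: "insert v T = insert v (keys m')" and "mdeg m' = n"
      using arg_cong[OF eq, of keys] arg_cong[OF eq, of mdeg]
      by (simp_all add: keys_plus_nat)
    have "keys m' = insert v T \<or> keys m' = T"
    proof (cases "v \<in> keys m'")
      case True
      then show ?thesis using k by (simp add: insert_absorb)
    next
      case False
      then show ?thesis using k assms by (metis Diff_insert_absorb)
    qed
    then show "m \<in> (\<lambda>m. m + single v 1) ` (exact_mons (insert v T) n \<union> exact_mons T n)"
      using eq \<open>mdeg m' = n\<close> by (intro image_eqI[of _ _ m']) (simp_all add: exact_mons_def)
  qed
qed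

text \<open>Each variable of \<open>T\<close> contributes \<open>x / (1 - x)\<close> because its
  exponent is at least 1; the denominators are cleared.\<close>

lemma exact_mons_series:
  assumes "finite T"
  shows "(1 - fps_X) ^ card T * Abs_fps (\<lambda>n. real (card (exact_mons T n))) = fps_X ^ card T"
  using assms
proof (induction T rule: finite_induct)
  case empty
  have "exact_mons {} n = (if n = 0 then {0 :: 'a \<Rightarrow>\<^sub>0 nat} else {})" for n
    by (auto simp: exact_mons_def)
  then show ?case by (auto intro!: fps_ext)
next
  case (insert v T)
  let ?F = "\<lambda>T. Abs_fps (\<lambda>n. real (card (exact_mons T n)))"
  have 0: "exact_mons (insert v T) 0 = {}"
  proof -
    have "mdeg m \<noteq> 0" if "keys m = insert v T" for m
    proof
      assume "mdeg m = 0"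
      then have "\<forall>v\<in>keys m. lookup m v = 0" by (simp add: mdeg_def)
      moreover have "v \<in> keys m" using that by simp
      ultimately show False by (metis in_keys_iff)
    qed
    then show ?thesis unfolding exact_mons_def by blast
  qed
  have S: "card (exact_mons (insert v T) (Suc n)) = card (exact_mons (insert v T) n) + card (exact_mons T n)" for n
  proof -
    have "card (exact_mons (insert v T) (Suc n)) = card (exact_mons (insert v T) n \<union> exact_mons T n)"
      unfolding exact_mons_insert_Suc[OF insert.hyps(2)]
      by (intro card_image) (simp add: inj_on_def)
    also have "\<dots> = card (exact_mons (insert v T) n) + card (exact_mons T n)"
    proof (intro card_Un_disjoint finite_exact_mons)
      show "exact_mons (insert v T) n \<inter> exact_mons T n = {}"
        using insert.hyps(2) by (simp add: exact_mons_def disjoint_iff) blast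
    qed (use insert.hyps in simp_all)
    finally show ?thesis .
  qed
  have "(1 - fps_X) * ?F (insert v T) = fps_X * ?F T"
  proof (rule fps_ext)
    fix n show "fps_nth ((1 - fps_X) * ?F (insert v T)) n = fps_nth (fps_X * ?F T) n"
      by (cases n) (auto simp: left_diff_distrib 0 S)
  qed
  then have "(1 - fps_X) ^ card T * ((1 - fps_X) * ?F (insert v T)) = fps_X * ((1 - fps_X) ^ card T * ?F T)"
    by (simp add: mult.left_commute)
  then show ?case using insert by (simp add: mult.assoc mult.left_commute)
qed

lemma dim_forms: "finite W \<Longrightarrow> mp.dim (forms W n) = card (mons W n)"
  unfolding forms_def by (intro dim_mspan finite_mons)

lemma part_no_gens: "part W K {} n = mspan (nonface_mons W K n)"
  by (simp add: part_def gens_def mspan_eq_span)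

text \<open>Monomials supported on faces form a basis of the face ring, and grouping them by their
  exact support gives one term of \<open>hpoly\<close> per face.\<close>

lemma hilb_face_ring:
  assumes W: "finite W" and K: "finite K" "\<And>T. T \<in> K \<Longrightarrow> T \<subseteq> W"
  shows "(1 - fps_X) ^ cdim K * hilb W K {} = hpoly K"
proof -
  let ?F = "\<lambda>T. Abs_fps (\<lambda>n. real (card (exact_mons T n)))"
  have fT: "finite T" if "T \<in> K" for T using K(2)[OF that] W finite_subset by auto
  have "hilb W K {} = (\<Sum>T\<in>K. ?F T)"
  proof (rule fps_ext)
    fix n
    have fin: "finite (mons W n)" "finite (nonface_mons W K n)"
      using W by (auto simp: nonface_mons_def finite_mons)
    have "fps_nth (hilb W K {}) n = real (card (mons W n)) - real (card (nonface_mons W K n))"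
      using W fin by (simp add: hilb_def dim_forms part_no_gens dim_mspan)
    also have "\<dots> = real (card (mons W n - nonface_mons W K n))"
      using fin by (subst card_Diff_subset) (auto simp: nonface_mons_def of_nat_diff card_mono)
    also have "mons W n - nonface_mons W K n = (\<Union>T\<in>K. exact_mons T n)"
    proof (rule Set.set_eqI)
      fix m
      show "m \<in> mons W n - nonface_mons W K n \<longleftrightarrow> m \<in> (\<Union>T\<in>K. exact_mons T n)"
        using K(2)[of "keys m"] unfolding nonface_mons_def mons_def exact_mons_def by simp blast
    qed
    also have "card \<dots> = (\<Sum>T\<in>K. card (exact_mons T n))"
    proof (rule card_UN_disjoint)
      show "\<forall>T\<in>K. finite (exact_mons T n)" using fT finite_exact_mons by blast
      show "\<forall>T\<in>K. \<forall>T'\<in>K. T \<noteq> T' \<longrightarrow> exact_mons T n \<inter> exact_mons T' n = {}"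
        unfolding exact_mons_def by blast
    qed (rule K(1))
    finally show "fps_nth (hilb W K {}) n = fps_nth (\<Sum>T\<in>K. ?F T) n" by (simp add: fps_sum_nth)
  qed
  then have "(1 - fps_X) ^ cdim K * hilb W K {} = (\<Sum>T\<in>K. (1 - fps_X) ^ cdim K * ?F T)"
    by (simp add: sum_distrib_left)
  also have "\<dots> = hpoly K" unfolding hpoly_def
  proof (rule sum.cong)
    fix T assume T: "T \<in> K"
    have "(1 - fps_X) ^ cdim K = (1 - fps_X) ^ (cdim K - card T) * (1 - fps_X :: real fps) ^ card T"
      using card_le_cdim[OF K(1) T] by (simp add: power_add[symmetric])
    then show "(1 - fps_X) ^ cdim K * ?F T = fps_X ^ card T * (1 - fps_X) ^ (cdim K - card T)"
      using exact_mons_series[OF fT[OF T]] by (simp add: mult.assoc mult.commute)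
  qed simp
  finally show ?thesis .
qed

section \<open>Regular sequences and Hilbert series\<close>

definition nonneg_fps :: "real fps \<Rightarrow> bool" where
  "nonneg_fps f \<longleftrightarrow> (\<forall>n. 0 \<le> fps_nth f n)"

lemma nonneg_fps_mult: "nonneg_fps f \<Longrightarrow> nonneg_fps g \<Longrightarrow> nonneg_fps (f * g)"
  unfolding nonneg_fps_def fps_mult_nth by (auto intro!: sum_nonneg)

lemma nonneg_fps_power: "nonneg_fps f \<Longrightarrow> nonneg_fps (f ^ n)"
  by (induction n) (auto intro: nonneg_fps_mult simp: nonneg_fps_def[of 1])

lemma nonneg_fps_X: "nonneg_fps fps_X"
  by (simp add: nonneg_fps_def fps_X_def)

text \<open>With \<open>f r\<close> and \<open>k r\<close> the Hilbert series of the \<open>r\<close>-th quotient and of the kernel of the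
  next parameter, \<open>f D / (1 - x) ^ D = f 0 + (\<Sum>r<D. x * k r / (1 - x) ^ (r + 1))\<close>, so the kernels
  vanish as soon as \<open>f D\<close> does not exceed \<open>(1 - x) ^ D * f 0\<close>.\<close>

lemma kernels_vanish:
  fixes f k :: "nat \<Rightarrow> real fps"
  assumes step: "\<And>r. r < D \<Longrightarrow> f (Suc r) = (1 - fps_X) * f r + fps_X * k r"
    and k: "\<And>r. r < D \<Longrightarrow> nonneg_fps (k r)"
    and le: "nonneg_fps ((1 - fps_X) ^ D * f 0 - f D)"
  shows "\<forall>r<D. k r = 0"
proof -
  define g :: "real fps" where "g = Abs_fps (\<lambda>n. 1)"
  have g: "nonneg_fps g" by (simp add: g_def nonneg_fps_def)
  have g1: "(1 - fps_X) * g = 1"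
    by (rule fps_ext, rename_tac n, case_tac n) (auto simp: g_def left_diff_distrib)
  have sum: "f r * g ^ r = f 0 + (\<Sum>i<r. fps_X * k i * g ^ Suc i)" if "r \<le> D" for r
    using that
  proof (induction r)
    case (Suc r)
    have "f (Suc r) * g ^ Suc r = ((1 - fps_X) * g) * (f r * g ^ r) + fps_X * k r * g ^ Suc r"
      using Suc.prems by (simp add: step algebra_simps)
    then show ?case using Suc by (simp add: g1)
  qed simp
  define s where "s = (\<Sum>i<D. fps_X * k i * g ^ Suc i)"
  have "((1 - fps_X) ^ D * f 0 - f D) * g ^ D = ((1 - fps_X) ^ D * g ^ D) * f 0 - f D * g ^ D"
    by (simp add: algebra_simps)
  also have "(1 - fps_X) ^ D * g ^ D = ((1 - fps_X) * g) ^ D"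
    by (rule power_mult_distrib[symmetric])
  also have "((1 - fps_X) * g) ^ D * f 0 - f D * g ^ D = f 0 - f D * g ^ D" by (simp add: g1)
  also have "\<dots> = - s" using sum[of D] by (simp add: g1 s_def)
  finally have neg: "nonneg_fps (- s)"
    using nonneg_fps_mult[OF le nonneg_fps_power[OF g, of D]] by simp
  \<comment> \<open>All summands of \<open>s\<close> have nonnegative coefficients, while
    \<open>- s\<close> does too, so each summand is zero.\<close>
  have summand: "nonneg_fps (fps_X * k i * g ^ Suc i)" if "i < D" for i
    using k[OF that] g by (intro nonneg_fps_mult nonneg_fps_power nonneg_fps_X)
  have "fps_X * k r * g ^ Suc r = 0" if r: "r < D" for r
  proof (rule fps_ext)
    fix n
    have "fps_nth (fps_X * k r * g ^ Suc r) n \<le> (\<Sum>i<D. fps_nth (fps_X * k i * g ^ Suc i) n)"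
      using r summand by (intro member_le_sum) (auto simp: nonneg_fps_def)
    also have "\<dots> = fps_nth s n" by (simp add: s_def fps_sum_nth)
    also have "\<dots> \<le> 0" using neg by (simp add: nonneg_fps_def)
    finally show "fps_nth (fps_X * k r * g ^ Suc r) n = fps_nth 0 n"
      using summand[OF r] by (auto simp: nonneg_fps_def intro: antisym)
  qed
  moreover have "g \<noteq> 0" using g1 by auto
  ultimately show ?thesis by auto
qed

section \<open>Generic parameters\<close>

text \<open>The generators are indexed by a set that does not depend on \<open>t\<close>: non-face
  monomials, which stay constant, and pairs of a moving form and a monomial multiplier. So
  \<open>dim_curve_generic\<close> applies.\<close>

lemma dim_part_generic:
  assumes W: "finite W" and A: "finite A" and g: "\<And>a. a \<in> A \<Longrightarrow> curve (g a)"
  shows "finite {t. mp.dim (part W K ((\<lambda>a. (g a t, d a)) ` A) n)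
    < mp.dim (part W K ((\<lambda>a. (g a t0, d a)) ` A) n)}"
proof -
  let ?I = "Inl ` nonface_mons W K n \<union> Inr ` (SIGMA a:{a\<in>A. d a \<le> n}. mons W (n - d a))"
  define f where "f x t = (case x of Inl m \<Rightarrow> mon m | Inr (a, m) \<Rightarrow> g a t * mon m)" for x t
  have gens: "gens W K ((\<lambda>a. (g a t, d a)) ` A) n = (\<lambda>x. f x t) ` ?I" for t
    unfolding gens_def f_def image_Un image_image by (intro arg_cong2[where f = "(\<union>)"]) force+
  have "finite ?I" using W A by (auto intro!: finite_SigmaI finite_nonface_mons finite_mons)
  moreover have "curve (f x)" if x: "x \<in> ?I" for x
  proof (cases x)
    case (Inl m)
    then have "f x = (\<lambda>t. mon m)" by (simp add: f_def fun_eq_iff)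
    then show ?thesis by (simp add: curve_const)
  next
    case (Inr y)
    then obtain a m where am: "x = Inr (a, m)" "a \<in> A" using x by auto
    then have "f x = (\<lambda>t. g a t * mon m)" by (simp add: f_def fun_eq_iff)
    then show ?thesis using g[OF am(2)] by (simp add: curve_mult curve_const)
  qed
  ultimately show ?thesis
    unfolding part_def mp.dim_span gens by (rule dim_curve_generic)
qed

text \<open>A parameter is a sequence of linear forms \<open>\<theta>\<close>; the first \<open>D\<close> of them are the
  candidate l.s.o.p., and \<open>\<theta> D\<close> is the candidate Lefschetz element.\<close>

definition linear_forms :: "'v set \<Rightarrow> (nat \<Rightarrow> 'v mpoly) \<Rightarrow> bool" where
  "linear_forms W \<theta> \<longleftrightarrow> (\<forall>i. \<theta> i \<in> forms W 1)"

definition line :: "(nat \<Rightarrow> 'v mpoly) \<Rightarrow> (nat \<Rightarrow> 'v mpoly) \<Rightarrow> real \<Rightarrow> nat \<Rightarrow> 'v mpoly" where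
  "line \<theta> \<theta>' t i = \<theta> i + Const t * (\<theta>' i - \<theta> i)"

text \<open>\<open>E = {}\<close> yields the ideal of the parameters alone, \<open>E = {e}\<close>
  the ideal whose equality with all forms in some degree expresses surjectivity of the
  \<open>e\<close>-th power of \<open>\<theta> D\<close>. One notion serves both kinds of
  conditions.\<close>

definition power_gens :: "(nat \<Rightarrow> 'v mpoly) \<Rightarrow> nat \<Rightarrow> nat set \<Rightarrow> ('v mpoly \<times> nat) set" where
  "power_gens \<theta> D E = thetas \<theta> D \<union> (\<lambda>e. (\<theta> D ^ e, e)) ` E"

lemma power_gens_empty [simp]: "power_gens \<theta> D {} = thetas \<theta> D"
  by (simp add: power_gens_def)

lemma power_gens_single: "power_gens \<theta> D {e} = insert (\<theta> D ^ e, e) (thetas \<theta> D)"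
  by (simp add: power_gens_def)

text \<open>A replacement for Zariski openness that needs one real variable only.\<close>

definition line_open :: "((nat \<Rightarrow> 'v mpoly) \<Rightarrow> bool) \<Rightarrow> bool" where
  "line_open C \<longleftrightarrow> (\<forall>\<theta> \<theta>' t0. C (line \<theta> \<theta>' t0) \<longrightarrow> finite {t. \<not> C (line \<theta> \<theta>' t)})"

lemma line_openD:
  assumes "line_open C" "C (line \<theta> \<theta>' t0)" shows "finite {t. \<not> C (line \<theta> \<theta>' t)}"
proof -
  have "C (line \<theta> \<theta>' t0) \<longrightarrow> finite {t. \<not> C (line \<theta> \<theta>' t)}"
    using assms(1) unfolding line_open_def by (elim allE)
  then show ?thesis using assms(2) by (rule mp)
qed

lemma linear_forms_line:
  "linear_forms W \<theta> \<Longrightarrow> linear_forms W \<theta>' \<Longrightarrow> linear_forms W (line \<theta> \<theta>' t)"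
  unfolding linear_forms_def line_def
  by (auto intro!: mp.subspace_add mp.subspace_scale mp.subspace_diff subspace_forms)

lemma curve_line: "curve (\<lambda>t. line \<theta> \<theta>' t i)"
  unfolding line_def by (intro curve_add curve_mult curve_const curve_Const)

lemma line_open_dim_part:
  assumes "finite W" "finite E"
  shows "line_open (\<lambda>\<theta>. c \<le> mp.dim (part W K (power_gens \<theta> D E) n))"
  unfolding line_open_def
proof safe
  fix \<theta> \<theta>' :: "nat \<Rightarrow> 'a mpoly" and t0
  let ?L = "\<lambda>t. line \<theta> \<theta>' t"
  let ?A = "Inl ` {..<D} \<union> Inr ` E"
  define g where "g a t = (case a of Inl i \<Rightarrow> ?L t i | Inr e \<Rightarrow> ?L t D ^ e)" for a :: "nat + nat" and t
  define d where "d a = (case a of Inl i \<Rightarrow> 1 | Inr e \<Rightarrow> e)" for a :: "nat + nat"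
  have G: "power_gens (?L t) D E = (\<lambda>a. (g a t, d a)) ` ?A" for t
    by (simp add: power_gens_def thetas_def image_Un image_image g_def d_def)
  assume c: "c \<le> mp.dim (part W K (power_gens (?L t0) D E) n)"
  have "finite {t. mp.dim (part W K ((\<lambda>a. (g a t, d a)) ` ?A) n)
    < mp.dim (part W K ((\<lambda>a. (g a t0, d a)) ` ?A) n)}"
  proof (rule dim_part_generic)
    show "finite ?A" using assms(2) by simp
    show "curve (g a)" if "a \<in> ?A" for a
      using that curve_line curve_power[OF curve_line] unfolding g_def[abs_def] by (cases a) simp_all
  qed (rule assms(1))
  then show "finite {t. \<not> c \<le> mp.dim (part W K (power_gens (?L t) D E) n)}"
    unfolding G by (rule rev_finite_subset) (use c G in auto)
qed

text \<open>Join a parameter good for the earlier conditions to one good for the new condition by a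
  line. Each condition holds at one end, hence off a finite set, and the line is infinite.\<close>

lemma common_parameter:
  assumes "finite J" and "\<And>j. j \<in> J \<Longrightarrow> line_open (C j)"
    and "\<And>j. j \<in> J \<Longrightarrow> \<exists>\<theta>. linear_forms W \<theta> \<and> C j \<theta>"
  shows "\<exists>\<theta>. linear_forms W \<theta> \<and> (\<forall>j\<in>J. C j \<theta>)"
  using assms
proof (induction J rule: finite_induct)
  case empty
  have "linear_forms W (\<lambda>_. 0)"
    by (simp add: linear_forms_def mp.subspace_0[OF subspace_forms])
  then show ?case by auto
next
  case (insert x J)
  then obtain \<theta> where \<theta>: "linear_forms W \<theta>" "\<forall>j\<in>J. C j \<theta>" by auto
  obtain \<theta>' where \<theta>': "linear_forms W \<theta>'" "C x \<theta>'" using insert.prems(2)[of x] by auto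
  have l0: "line \<theta> \<theta>' 0 = \<theta>" and l1: "line \<theta> \<theta>' 1 = \<theta>'"
    by (auto simp: line_def)
  have "finite {t. \<not> C j (line \<theta> \<theta>' t)}" if j: "j \<in> insert x J" for j
  proof -
    have "line_open (C j)" using insert.prems(1) j .
    obtain t0 where "C j (line \<theta> \<theta>' t0)"
    proof (cases "j = x")
      case True
      then show ?thesis using \<theta>'(2) by (intro that[of 1]) (simp add: l1)
    next
      case False
      then show ?thesis using \<theta>(2) j by (intro that[of 0]) (simp add: l0)
    qed
    with \<open>line_open (C j)\<close> show ?thesis by (rule line_openD)
  qed
  then have "finite (\<Union>j\<in>insert x J. {t. \<not> C j (line \<theta> \<theta>' t)})"
    using insert.hyps(1) by blast
  from ex_new_if_finite[OF infinite_UNIV_char_0 this]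
  obtain t where t: "t \<notin> (\<Union>j\<in>insert x J. {t. \<not> C j (line \<theta> \<theta>' t)})" ..
  then have "\<forall>j\<in>insert x J. C j (line \<theta> \<theta>' t)" by simp
  then show ?case using linear_forms_line[OF \<theta>(1) \<theta>'(1), of t] by (intro exI[of _ "line \<theta> \<theta>' t"] conjI)
qed

section \<open>Regularity and injectivity from dimension counts\<close>

lemma mons_split:
  "m \<in> mons W (a + b) \<Longrightarrow> \<exists>m1\<in>mons W a. \<exists>m2\<in>mons W b. m = m1 + m2"
proof (induction a arbitrary: m)
  case 0
  then show ?case by (intro bexI[of _ 0] bexI[of _ m]) (auto simp: mons_def)
next
  case (Suc a)
  then have m: "keys m \<subseteq> W" "mdeg m = Suc (a + b)" by (auto simp: mons_def)
  then have "keys m \<noteq> {}" by (auto simp: mdeg_def)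
  then obtain v where v: "v \<in> keys m" by blast
  define m' where "m' = m - single v 1"
  have "lookup m v \<ge> 1" using v by (simp add: in_keys_iff)
  then have eq: "m = m' + single v 1"
    by (intro poly_mapping_eqI) (auto simp: m'_def lookup_add lookup_minus lookup_single when_def)
  have "m' \<in> mons W (a + b)"
    using m arg_cong[OF eq, of mdeg] arg_cong[OF eq, of keys]
    by (auto simp: mons_def keys_plus_nat)
  then obtain m1 m2 where "m1 \<in> mons W a" "m2 \<in> mons W b" "m' = m1 + m2"
    using Suc.IH by blast
  moreover have "single v 1 \<in> mons W 1" using v m(1) by (auto simp: mons_def)
  ultimately show ?case
    using eq mons_plus[of m1 W a "single v 1" 1]
    by (intro bexI[of _ "m1 + single v 1"] bexI[of _ m2]) (auto simp: ac_simps)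
qed

lemma part_eq_forms_add:
  assumes "graded_gens W G" "down_closed K" "part W K G n = forms W n"
  shows "part W K G (n + j) = forms W (n + j)"
proof
  show "part W K G (n + j) \<subseteq> forms W (n + j)" by (rule part_subset_forms[OF assms(1)])
  show "forms W (n + j) \<subseteq> part W K G (n + j)"
    unfolding forms_eq_span
  proof (rule mp.span_minimal[OF _ subspace_part], safe)
    fix m assume "m \<in> mons W (n + j)"
    then obtain m1 m2 where m: "m1 \<in> mons W n" "m2 \<in> mons W j" "m = m1 + m2"
      using mons_split by blast
    then have "mon m1 * mon m2 \<in> part W K G (n + j)"
      using assms(3) by (intro part_mult[OF assms(2)]) auto
    then show "mon m \<in> part W K G (n + j)" using m(3) by (simp add: mult_single)
  qed
qed

lemma graded_gens_thetas: "linear_forms W \<theta> \<Longrightarrow> graded_gens W (thetas \<theta> r)"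
  by (auto simp: graded_gens_def thetas_def linear_forms_def)

lemma graded_gens_power_gens: "linear_forms W \<theta> \<Longrightarrow> graded_gens W (power_gens \<theta> D E)"
  using forms_power[of "\<theta> D" W 1]
  by (auto simp: graded_gens_def power_gens_def thetas_def linear_forms_def)

text \<open>Regularity tested on homogeneous elements only, which is what dimension counts can
  detect; \<open>regular_seq_iff\<close> identifies it with the ungraded notion.\<close>

definition regular_forms :: "'v set \<Rightarrow> 'v set set \<Rightarrow> (nat \<Rightarrow> 'v mpoly) \<Rightarrow> nat \<Rightarrow> bool" where
  "regular_forms W K \<theta> D \<longleftrightarrow>
     (\<forall>r<D. \<forall>n. \<forall>p\<in>forms W n. \<theta> r * p \<in> part W K (thetas \<theta> r) (Suc n) \<longrightarrow> p \<in> part W K (thetas \<theta> r) n)"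

context
  fixes W :: "'v set" and K :: "'v set set" and \<theta> :: "nat \<Rightarrow> 'v mpoly"
  assumes W: "finite W" and K: "finite K" "\<And>T. T \<in> K \<Longrightarrow> T \<subseteq> W" "down_closed K"
    and \<theta>: "linear_forms W \<theta>"
begin

lemma hilb_thetas_Suc:
  "hilb W K (thetas \<theta> (Suc r)) =
     (1 - fps_X) * hilb W K (thetas \<theta> r) + fps_X * hilb_ker W K (thetas \<theta> r) (\<theta> r)"
  unfolding thetas_Suc
  by (rule hilb_step[OF W graded_gens_thetas[OF \<theta>]]) (use \<theta> in \<open>simp add: linear_forms_def\<close>)

lemma part_subset_colon_thetas:
  "part W K (thetas \<theta> r) n \<subseteq> colon_part W K (thetas \<theta> r) (\<theta> r) n"
  by (rule part_subset_colon[OF graded_gens_thetas[OF \<theta>] _ K(3)]) (use \<theta> in \<open>simp add: linear_forms_def\<close>)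

lemma hilb_regular:
  assumes "regular_forms W K \<theta> (cdim K)"
  shows "hilb W K (thetas \<theta> (cdim K)) = hpoly K"
proof -
  have z: "hilb_ker W K (thetas \<theta> r) (\<theta> r) = 0" if "r < cdim K" for r
  proof (rule fps_ext)
    fix n
    have "colon_part W K (thetas \<theta> r) (\<theta> r) n = part W K (thetas \<theta> r) n"
      using assms that part_subset_colon_thetas[of r n] by (auto simp: regular_forms_def colon_part_def)
    then show "fps_nth (hilb_ker W K (thetas \<theta> r) (\<theta> r)) n = fps_nth 0 n"
      by (simp add: hilb_ker_def)
  qed
  have "hilb W K (thetas \<theta> r) = (1 - fps_X) ^ r * hilb W K {}" if "r \<le> cdim K" for r
    using that
  proof (induction r)
    case (Suc r)
    then show ?case by (simp add: hilb_thetas_Suc z mult.assoc)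
  qed simp
  then show ?thesis using hilb_face_ring[OF W K(1,2)] by simp
qed

text \<open>Upper bounds on the quotient suffice, by \<open>kernels_vanish\<close>, and only in
  finitely many degrees: the bound in degree \<open>cdim K + 1\<close> is 0, which already settles
  all higher degrees.\<close>

lemma regular_of_dim_bound:
  assumes bound: "\<And>n. n \<le> Suc (cdim K) \<Longrightarrow>
      real (mp.dim (forms W n)) \<le> real (mp.dim (part W K (thetas \<theta> (cdim K)) n)) + fps_nth (hpoly K) n"
  shows "regular_forms W K \<theta> (cdim K)"
proof -
  let ?D = "cdim K"
  have sub: "part W K (thetas \<theta> r) n \<subseteq> forms W n" for r n
    by (rule part_subset_forms[OF graded_gens_thetas[OF \<theta>]])
  \<comment> \<open>The h-polynomial has degree at most \<open>?D\<close>, so in degree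
    \<open>Suc ?D\<close> the bound says that the quotient vanishes.\<close>
  have "mp.dim (forms W (Suc ?D)) \<le> mp.dim (part W K (thetas \<theta> ?D) (Suc ?D))"
    using bound[of "Suc ?D"] hpoly_nth_beyond[OF K(1), of "Suc ?D"] by simp
  then have top: "part W K (thetas \<theta> ?D) (Suc ?D) = forms W (Suc ?D)"
    using eq_of_dim_forms[OF W subset_refl subspace_part sub] by blast
  have bound': "fps_nth (hilb W K (thetas \<theta> ?D)) n \<le> fps_nth (hpoly K) n" for n
  proof (cases "n \<le> Suc ?D")
    case True
    then show ?thesis using bound[of n] by (simp add: hilb_def)
  next
    case False
    then obtain j where j: "n = Suc ?D + j" using le_Suc_ex by (metis nat_le_linear)
    then have "part W K (thetas \<theta> ?D) n = forms W n"
      using part_eq_forms_add[OF graded_gens_thetas[OF \<theta>] K(3) top, of j] by simp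
    then show ?thesis using hpoly_nth_beyond[OF K(1), of n] False by (simp add: hilb_def)
  qed
  have "\<forall>r<?D. hilb_ker W K (thetas \<theta> r) (\<theta> r) = 0"
  proof (rule kernels_vanish)
    show "hilb W K (thetas \<theta> (Suc r)) = (1 - fps_X) * hilb W K (thetas \<theta> r)
        + fps_X * hilb_ker W K (thetas \<theta> r) (\<theta> r)" for r
      by (rule hilb_thetas_Suc)
    show "nonneg_fps (hilb_ker W K (thetas \<theta> r) (\<theta> r))" for r
      unfolding nonneg_fps_def hilb_ker_def
      using dim_mono_forms[OF W _ part_subset_colon_thetas[of r]] by (auto simp: colon_part_def)
    show "nonneg_fps ((1 - fps_X) ^ ?D * hilb W K (thetas \<theta> 0) - hilb W K (thetas \<theta> ?D))"
      using bound' hilb_face_ring[OF W K(1,2)] by (simp add: nonneg_fps_def)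
  qed
  then have dims: "mp.dim (colon_part W K (thetas \<theta> r) (\<theta> r) n) = mp.dim (part W K (thetas \<theta> r) n)"
    if "r < ?D" for r n
    using that by (auto simp: hilb_ker_def fps_eq_iff)
  have colon: "part W K (thetas \<theta> r) n = colon_part W K (thetas \<theta> r) (\<theta> r) n" if "r < ?D" for r n
  proof (rule eq_of_dim_forms[OF W _ subspace_part part_subset_colon_thetas])
    show "colon_part W K (thetas \<theta> r) (\<theta> r) n \<subseteq> forms W n" by (auto simp: colon_part_def)
  qed (simp add: dims that)
  show ?thesis
    unfolding regular_forms_def
  proof (intro allI ballI impI)
    fix r n p assume "r < ?D" "p \<in> forms W n" "\<theta> r * p \<in> part W K (thetas \<theta> r) (Suc n)"
    then have "p \<in> colon_part W K (thetas \<theta> r) (\<theta> r) n" by (simp add: colon_part_def)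
    then show "p \<in> part W K (thetas \<theta> r) n" using colon[OF \<open>r < ?D\<close>] by blast
  qed
qed

text \<open>Symmetry of the h-vector gives source and target the same dimension, and rank-nullity
  turns surjectivity into injectivity.\<close>

lemma surjective_imp_injective:
  assumes h: "hilb W K (thetas \<theta> (cdim K)) = hpoly K" and sym: "symmetric_h K"
    and i: "i \<le> cdim K div 2" and e: "e = cdim K - 2 * i"
    and surj: "part W K (power_gens \<theta> (cdim K) {e}) (cdim K - i) = forms W (cdim K - i)"
    and p: "p \<in> forms W i" "\<theta> (cdim K) ^ e * p \<in> part W K (thetas \<theta> (cdim K)) (cdim K - i)"
  shows "p \<in> part W K (thetas \<theta> (cdim K)) i"
proof -
  let ?D = "cdim K" and ?P = "part W K (thetas \<theta> (cdim K))"
  have ei: "e + i = ?D - i" using i e by simp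
  have w: "\<theta> ?D ^ e \<in> forms W e"
    using forms_power[of "\<theta> ?D" W 1 e] \<theta> by (simp add: linear_forms_def)
  let ?C = "{p \<in> forms W i. \<theta> ?D ^ e * p \<in> ?P (e + i)}"
  have "mp.dim (forms W (?D - i)) + mp.dim ?C = mp.dim (?P (?D - i)) + mp.dim (forms W i)"
    using dim_mult_step[OF W graded_gens_thetas[OF \<theta>] w, of K ?D i] surj
    by (simp add: power_gens_single ei)
  moreover have dims: "real (mp.dim (forms W n)) - real (mp.dim (?P n)) = of_int (h_num K n)" for n
    using arg_cong[OF h, of "\<lambda>f. fps_nth f n"] hpoly_nth[OF K(1), of n] by (simp add: hilb_def)
  have "i \<le> ?D" using i by linarith
  then have "real_of_int (h_num K i) = of_int (h_num K (?D - i))"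
    by (rule arg_cong[OF sym[unfolded symmetric_h_def, rule_format]])
  then have "real (mp.dim (forms W i)) - real (mp.dim (?P i)) = real (mp.dim (forms W (?D - i))) - real (mp.dim (?P (?D - i)))"
    using dims[of i] dims[of "?D - i"] by linarith
  ultimately have "mp.dim ?C = mp.dim (?P i)" by linarith
  moreover have "?P i \<subseteq> ?C"
  proof
    fix p assume p: "p \<in> ?P i"
    have "p * \<theta> ?D ^ e \<in> ?P (i + e)" by (rule part_mult[OF K(3) p w])
    then have "\<theta> ?D ^ e * p \<in> ?P (e + i)" by (simp only: mult.commute add.commute)
    then show "p \<in> ?C" using part_subset_forms[OF graded_gens_thetas[OF \<theta>], of K ?D i] p by blast
  qed
  ultimately have eq: "?P i = ?C"
    by (intro eq_of_dim_forms[OF W _ subspace_part, of ?C i]) simp_all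
  have "p \<in> ?C" using p by (simp add: ei)
  then show ?thesis unfolding eq .
qed

end

section \<open>Homogeneous components\<close>

definition hcomp :: "nat \<Rightarrow> 'v mpoly \<Rightarrow> 'v mpoly" where
  "hcomp n p = (\<Sum>m\<in>{m\<in>keys p. mdeg m = n}. Const (lookup p m) * mon m)"

lemma lookup_hcomp: "lookup (hcomp n p) m = (if mdeg m = n then lookup p m else 0)"
proof -
  have "lookup (hcomp n p) m =
      (\<Sum>k\<in>{m\<in>keys p. mdeg m = n}. if k = m then lookup p k else 0)"
    unfolding hcomp_def lookup_sum by (intro sum.cong) (auto simp: lookup_single when_def)
  also have "\<dots> = (if m \<in> {m\<in>keys p. mdeg m = n} then lookup p m else 0)"
    by (rule sum.delta) simp
  also have "\<dots> = (if mdeg m = n then lookup p m else 0)"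
    by (auto simp: in_keys_iff)
  finally show ?thesis .
qed

lemma keys_hcomp: "keys (hcomp n p) = {m \<in> keys p. mdeg m = n}"
  by (auto simp: in_keys_iff lookup_hcomp split: if_splits)

lemma hcomp_add: "hcomp n (p + q) = hcomp n p + hcomp n q"
  by (rule poly_mapping_eqI) (simp add: lookup_hcomp lookup_add)

lemma hcomp_0 [simp]: "hcomp n 0 = 0"
  by (rule poly_mapping_eqI) (simp add: lookup_hcomp)

lemma hcomp_uminus: "hcomp n (- p) = - hcomp n p"
  by (rule poly_mapping_eqI) (simp add: lookup_hcomp)

lemma hcomp_sum: "hcomp n (sum f A) = (\<Sum>i\<in>A. hcomp n (f i))"
  by (induction A rule: infinite_finite_induct) (simp_all add: hcomp_add)

lemma polys_in_eq_mspan: "polys_in W = mspan {m. keys m \<subseteq> W}"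
  by (auto simp: polys_in_def mspan_def)

lemma subspace_polys_in: "mp.subspace (polys_in W)"
  unfolding polys_in_eq_mspan by (rule subspace_mspan)

lemma polys_in_mult: "p \<in> polys_in W \<Longrightarrow> q \<in> polys_in W \<Longrightarrow> p * q \<in> polys_in W"
  unfolding polys_in_eq_mspan by (erule mspan_mult) (auto simp: keys_plus_nat)

lemma forms_eq: "forms W n = {p \<in> polys_in W. homogeneous n p}"
  by (auto simp: forms_def mspan_def mons_def polys_in_def homogeneous_def mdeg_def)

lemma forms_subset_polys_in: "forms W n \<subseteq> polys_in W"
  by (auto simp: forms_eq)

lemma hcomp_in_forms: "p \<in> polys_in W \<Longrightarrow> hcomp n p \<in> forms W n"
  by (auto simp: polys_in_def forms_def mspan_def mons_def keys_hcomp)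

lemma hcomp_form: "p \<in> forms W d \<Longrightarrow> hcomp n p = (if n = d then p else 0)"
  by (intro poly_mapping_eqI)
    (auto simp: lookup_hcomp forms_def mspan_def mons_def subset_iff in_keys_iff)

lemma sum_hcomp: obtains N where "p = (\<Sum>k\<le>N. hcomp k p)"
proof -
  obtain N where N: "\<forall>m\<in>keys p. mdeg m \<le> N"
    using finite_nat_set_iff_bounded_le[of "mdeg ` keys p"] by auto
  have "p = (\<Sum>k\<le>N. hcomp k p)"
  proof (rule poly_mapping_eqI)
    fix m
    have "lookup (\<Sum>k\<le>N. hcomp k p) m = (\<Sum>k\<le>N. if mdeg m = k then lookup p m else 0)"
      by (simp add: lookup_sum lookup_hcomp)
    also have "\<dots> = lookup p m"
      using N by (auto simp: in_keys_iff)
    finally show "lookup p m = lookup (\<Sum>k\<le>N. hcomp k p) m" ..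
  qed
  then show ?thesis by (rule that)
qed

lemma hcomp_form_mult:
  assumes "g \<in> forms W d" "p \<in> polys_in W"
  shows "hcomp n (g * p) = (if d \<le> n then g * hcomp (n - d) p else 0)"
proof -
  obtain N where N: "p = (\<Sum>k\<le>N. hcomp k p)" by (rule sum_hcomp)
  have c: "hcomp n (g * hcomp k p) = (if n = d + k then g * hcomp k p else 0)" for k
    by (rule hcomp_form[OF forms_mult[OF assms(1) hcomp_in_forms[OF assms(2)]]])
  have "hcomp n (g * p) = hcomp n (\<Sum>k\<le>N. g * hcomp k p)"
    by (subst N) (simp add: sum_distrib_left)
  also have "\<dots> = (\<Sum>k\<le>N. if n = d + k then g * hcomp k p else 0)"
    by (simp add: hcomp_sum c)
  also have "\<dots> = (if d \<le> n then g * hcomp (n - d) p else 0)"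
  proof (cases "d \<le> n")
    case True
    then obtain j where j: "n = d + j" using le_Suc_ex by blast
    have "(\<Sum>k\<le>N. if n = d + k then g * hcomp k p else 0) = (if j \<le> N then g * hcomp j p else 0)"
      using j by simp
    moreover have "hcomp j p = 0" if "\<not> j \<le> N"
    proof -
      have "hcomp j p = (\<Sum>k\<le>N. hcomp j (hcomp k p))" by (subst N) (simp add: hcomp_sum)
      also have "\<dots> = 0"
        using that by (intro sum.neutral) (auto simp: hcomp_form[OF hcomp_in_forms[OF assms(2)]])
      finally show ?thesis .
    qed
    ultimately show ?thesis using j by auto
  qed simp
  finally show ?thesis .
qed

text \<open>The bridge from graded pieces, where dimensions are counted, to the ungraded ideals in
  the definition of HL. Homogeneity of the ideal is built in.\<close>

definition full_ideal :: "'v set \<Rightarrow> 'v set set \<Rightarrow> ('v mpoly \<times> nat) set \<Rightarrow> 'v mpoly set" where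
  "full_ideal W K G = {p \<in> polys_in W. \<forall>n. hcomp n p \<in> part W K G n}"

lemma full_ideal_form_iff: "p \<in> forms W n \<Longrightarrow> p \<in> full_ideal W K G \<longleftrightarrow> p \<in> part W K G n"
  using forms_subset_polys_in[of W n]
  by (auto simp: full_ideal_def hcomp_form[of p W n] part_0 split: if_splits)

lemma full_ideal_mult:
  assumes K: "down_closed K" and p: "p \<in> full_ideal W K G" and q: "q \<in> polys_in W"
  shows "p * q \<in> full_ideal W K G"
  unfolding full_ideal_def
proof (intro CollectI conjI allI)
  have pW: "p \<in> polys_in W" and pp: "hcomp n p \<in> part W K G n" for n
    using p by (auto simp: full_ideal_def)
  show "p * q \<in> polys_in W" by (rule polys_in_mult[OF pW q])
  fix n
  obtain N where N: "p = (\<Sum>k\<le>N. hcomp k p)" by (rule sum_hcomp)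
  have "hcomp n (p * q) = (\<Sum>k\<le>N. hcomp n (hcomp k p * q))"
    by (subst N) (simp add: sum_distrib_right hcomp_sum)
  moreover have "hcomp n (hcomp k p * q) \<in> part W K G n" for k
  proof (cases "k \<le> n")
    case True
    then show ?thesis
      using part_mult[OF K pp[of k] hcomp_in_forms[OF q, of "n - k"]]
      by (simp add: hcomp_form_mult[OF hcomp_in_forms[OF pW] q])
  qed (simp add: hcomp_form_mult[OF hcomp_in_forms[OF pW] q] part_0)
  ultimately show "hcomp n (p * q) \<in> part W K G n" by (simp add: part_sum)
qed

lemma full_ideal_add: "p \<in> full_ideal W K G \<Longrightarrow> q \<in> full_ideal W K G \<Longrightarrow> p + q \<in> full_ideal W K G"
  using mp.subspace_add[OF subspace_polys_in] by (auto simp: full_ideal_def hcomp_add part_add)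

lemma full_ideal_uminus:
  assumes "p \<in> full_ideal W K G" shows "- p \<in> full_ideal W K G"
proof -
  have "- p \<in> polys_in W"
    using assms by (intro mp.subspace_neg[OF subspace_polys_in]) (simp add: full_ideal_def)
  moreover have "- hcomp n p \<in> part W K G n" for n
    using assms by (intro mp.subspace_neg[OF subspace_part]) (simp add: full_ideal_def)
  ultimately show ?thesis by (simp add: full_ideal_def hcomp_uminus)
qed

lemma full_ideal_0: "0 \<in> full_ideal W K G"
  using mp.subspace_0[OF subspace_polys_in] by (simp add: full_ideal_def part_0)

lemma full_ideal_mono: "G \<subseteq> G' \<Longrightarrow> full_ideal W K G \<subseteq> full_ideal W K G'"
  using part_mono[of K K G G' W] by (fastforce simp: full_ideal_def)

section \<open>The polynomial ring and its ideals\<close>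

lemma poly_ring_simps [simp]:
  "carrier (poly_ring W) = polys_in W" "monoid.mult (poly_ring W) = (*)" "monoid.one (poly_ring W) = 1"
  "ring.zero (poly_ring W) = 0" "ring.add (poly_ring W) = (+)"
  by (simp_all add: poly_ring_def)

lemma one_in_polys_in: "1 \<in> polys_in W"
  using one_in_forms forms_subset_polys_in by blast

lemma cring_poly_ring: "cring (poly_ring W)"
proof (rule cringI)
  show "abelian_group (poly_ring W)"
  proof (rule abelian_groupI)
    fix p assume "p \<in> carrier (poly_ring W)"
    then show "\<exists>q\<in>carrier (poly_ring W). q \<oplus>\<^bsub>poly_ring W\<^esub> p = \<zero>\<^bsub>poly_ring W\<^esub>"
      using mp.subspace_neg[OF subspace_polys_in] by (intro bexI[of _ "- p"]) auto
  qed (auto simp: mp.subspace_add[OF subspace_polys_in] mp.subspace_0[OF subspace_polys_in] ac_simps)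
  show "Group.comm_monoid (poly_ring W)"
    by (rule comm_monoidI) (auto simp: polys_in_mult one_in_polys_in ac_simps)
qed (simp add: distrib_right)

lemma a_inv_poly_ring: "p \<in> polys_in W \<Longrightarrow> \<ominus>\<^bsub>poly_ring W\<^esub> p = - p"
  using abelian_group.minus_equality[OF ring.is_abelian_group[OF cring.axioms(1)[OF cring_poly_ring[of W]]], of "- p" p]
    mp.subspace_neg[OF subspace_polys_in, of p W] by simp

lemma a_minus_poly_ring: "p \<in> polys_in W \<Longrightarrow> q \<in> polys_in W \<Longrightarrow> p \<ominus>\<^bsub>poly_ring W\<^esub> q = p - q"
  by (simp add: a_minus_def a_inv_poly_ring)

lemma ideal_full_ideal:
  assumes "down_closed K"
  shows "ideal (full_ideal W K G) (poly_ring W)"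
proof (rule idealI)
  show "ring (poly_ring W)" by (rule cring.axioms(1)[OF cring_poly_ring])
  show "subgroup (full_ideal W K G) (add_monoid (poly_ring W))"
  proof
    show "full_ideal W K G \<subseteq> carrier (add_monoid (poly_ring W))"
      by (auto simp: full_ideal_def)
    show "x \<otimes>\<^bsub>add_monoid (poly_ring W)\<^esub> y \<in> full_ideal W K G"
      if "x \<in> full_ideal W K G" "y \<in> full_ideal W K G" for x y
      using that by (simp add: full_ideal_add)
    show "\<one>\<^bsub>add_monoid (poly_ring W)\<^esub> \<in> full_ideal W K G" by (simp add: full_ideal_0)
    show "inv\<^bsub>add_monoid (poly_ring W)\<^esub> x \<in> full_ideal W K G" if x: "x \<in> full_ideal W K G" for x
    proof -
      have "x \<in> polys_in W" using x by (simp add: full_ideal_def)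
      then have "inv\<^bsub>add_monoid (poly_ring W)\<^esub> x = - x"
        using a_inv_poly_ring[of x W] by (simp add: a_inv_def)
      then show ?thesis using full_ideal_uminus[OF x] by simp
    qed
  qed
next
  fix a x assume "a \<in> full_ideal W K G" "x \<in> carrier (poly_ring W)"
  then show "x \<otimes>\<^bsub>poly_ring W\<^esub> a \<in> full_ideal W K G" "a \<otimes>\<^bsub>poly_ring W\<^esub> x \<in> full_ideal W K G"
    using full_ideal_mult[OF assms, of a W G x] by (simp_all add: mult.commute)
qed

lemma ideal_poly_ringD:
  assumes "ideal I (poly_ring W)"
  shows "0 \<in> I" "p \<in> I \<Longrightarrow> q \<in> I \<Longrightarrow> p + q \<in> I" "p \<in> I \<Longrightarrow> r \<in> polys_in W \<Longrightarrow> p * r \<in> I"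
    "p \<in> I \<Longrightarrow> r \<in> polys_in W \<Longrightarrow> r * p \<in> I" "I \<subseteq> polys_in W"
  using additive_subgroup.zero_closed[OF ideal.axioms(1)[OF assms]]
    additive_subgroup.a_closed[OF ideal.axioms(1)[OF assms], of p q]
    ideal.I_r_closed[OF assms, of p r] ideal.I_l_closed[OF assms, of p r]
    additive_subgroup.a_subset[OF ideal.axioms(1)[OF assms]]
  by simp_all

lemma ideal_poly_ring_sum:
  "ideal I (poly_ring W) \<Longrightarrow> (\<And>i. i \<in> A \<Longrightarrow> f i \<in> I) \<Longrightarrow> sum f A \<in> I"
  by (induction A rule: infinite_finite_induct) (auto simp: ideal_poly_ringD)

lemma Const_in_polys_in: "Const c \<in> polys_in W"
proof -
  have "Const c * 1 \<in> polys_in W" by (intro mp.subspace_scale subspace_polys_in one_in_polys_in)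
  then show ?thesis by simp
qed

text \<open>Every element is a finite sum of components, each spanned by multiples of generators.
  This is the half needed to identify \<open>full_ideal\<close> with ideals given by
  generation.\<close>

lemma full_ideal_least:
  assumes "ideal I (poly_ring W)"
    and mono: "\<And>m. keys m \<subseteq> W \<Longrightarrow> keys m \<notin> K \<Longrightarrow> mon m \<in> I"
    and G: "\<And>g d. (g, d) \<in> G \<Longrightarrow> g \<in> I"
  shows "full_ideal W K G \<subseteq> I"
proof
  fix p assume p: "p \<in> full_ideal W K G"
  obtain N where N: "p = (\<Sum>k\<le>N. hcomp k p)" by (rule sum_hcomp)
  have "q \<in> I" if "q \<in> part W K G n" for q n
    using that
  proof (induction rule: part_induct)
    case (scale c p)
    then show ?case using ideal_poly_ringD(4)[OF assms(1)] Const_in_polys_in by blast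
  next
    case (monomial m)
    then show ?case using mono by (simp add: mons_def)
  next
    case (gen g d m)
    then have "mon m \<in> polys_in W" using forms_subset_polys_in[of W "n - d"] by auto
    then show ?case using ideal_poly_ringD(3)[OF assms(1) G[OF gen(1)]] by blast
  qed (simp_all add: ideal_poly_ringD[OF assms(1)])
  then have "(\<Sum>k\<le>N. hcomp k p) \<in> I"
    using p by (intro ideal_poly_ring_sum[OF assms(1)]) (auto simp: full_ideal_def)
  then show "p \<in> I" using N by simp
qed

lemma mon_squarefree: "finite T \<Longrightarrow> (\<Prod>v\<in>T. Var v) = mon (\<Sum>v\<in>T. single v 1)"
  by (induction T rule: finite_induct) (auto simp: Var_def mult_single)

lemma lookup_squarefree:
  "finite T \<Longrightarrow> lookup (\<Sum>v\<in>T. single v (1::nat)) u = (if u \<in> T then 1 else 0)"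
  by (simp add: lookup_sum lookup_single when_def)

text \<open>The face ideal is generated by squarefree monomials only; this recovers all monomials
  with non-face support.\<close>

lemma mon_support_dvd:
  obtains q where "q \<in> polys_in (keys m)" "mon m = (\<Prod>v\<in>keys m. Var v) * q"
proof -
  let ?T = "keys m"
  let ?s = "\<Sum>v\<in>?T. single v (1::nat)"
  have eq: "m = ?s + (m - ?s)"
  proof (rule poly_mapping_eqI)
    fix k
    have "lookup ?s k \<le> lookup m k"
      unfolding lookup_squarefree[OF finite_keys] by (simp add: in_keys_iff)
    then show "lookup m k = lookup (?s + (m - ?s)) k"
      by (simp only: lookup_add lookup_minus le_add_diff_inverse)
  qed
  have "keys (m - ?s) \<subseteq> ?T"
    using keys_plus_nat[of ?s "m - ?s"] arg_cong[OF eq, of keys] by blast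
  then have "mon (m - ?s) \<in> polys_in ?T" by (simp add: polys_in_def)
  moreover have "mon m = (\<Prod>v\<in>?T. Var v) * mon (m - ?s)"
    by (simp only: mon_squarefree[OF finite_keys] mult_single mult_1 eq[symmetric])
  ultimately show ?thesis by (rule that)
qed

section \<open>Face rings and their quotients\<close>

locale face_complex =
  fixes K :: "'v set set"
  assumes K: "simplicial_complex K"
begin

abbreviation "W \<equiv> vertices K"
abbreviation "D \<equiv> cdim K"
abbreviation "R \<equiv> poly_ring W"
abbreviation "cls \<equiv> face_ring_class K"

lemma finite_K: "finite K" and down_closed_K: "down_closed K"
  using K by (auto simp: simplicial_complex_def down_closed_def)

lemma finite_W: "finite W"
  using K by (auto simp: simplicial_complex_def vertices_def)

lemma face_subset_W: "T \<in> K \<Longrightarrow> T \<subseteq> W"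
  by (auto simp: vertices_def)

sublocale R: cring R
  by (rule cring_poly_ring)

lemma face_ideal_eq: "face_ideal K = full_ideal W K {}"
proof
  let ?S = "{\<Prod>v\<in>T. Var v | T. T \<subseteq> W \<and> T \<notin> K} :: 'v mpoly set"
  have fin: "finite T" if "T \<subseteq> W" for T using that finite_W finite_subset by blast
  have S: "?S \<subseteq> full_ideal W K {}"
  proof safe
    fix T assume T: "T \<subseteq> W" "T \<notin> K"
    let ?m = "\<Sum>v\<in>T. single v (1::nat)"
    have k: "keys ?m = T"
      unfolding Set.set_eq_iff in_keys_iff lookup_squarefree[OF fin[OF T(1)]] by simp
    then have m: "?m \<in> mons W (mdeg ?m)" using T(1) by (simp add: mons_def del: One_nat_def)
    have "keys ?m \<notin> K" unfolding k by (rule T(2))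
    then have "mon ?m \<in> part W K {} (mdeg ?m)" by (rule part_monomial[OF m])
    then have "mon ?m \<in> full_ideal W K {}"
      using m full_ideal_form_iff mon_in_forms by blast
    then show "(\<Prod>v\<in>T. Var v) \<in> full_ideal W K {}"
      by (simp only: mon_squarefree[OF fin[OF T(1)]])
  qed
  then have carr: "?S \<subseteq> carrier R" by (auto simp: full_ideal_def)
  show "face_ideal K \<subseteq> full_ideal W K {}"
    unfolding face_ideal_def by (rule R.genideal_minimal[OF ideal_full_ideal[OF down_closed_K] S])
  have id: "ideal (face_ideal K) R"
    unfolding face_ideal_def by (rule R.genideal_ideal[OF carr])
  show "full_ideal W K {} \<subseteq> face_ideal K"
  proof (rule full_ideal_least[OF id])
    fix m :: "'v \<Rightarrow>\<^sub>0 nat" assume m: "keys m \<subseteq> W" "keys m \<notin> K"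
    then have "(\<Prod>v\<in>keys m. Var v) \<in> ?S" by blast
    then have "(\<Prod>v\<in>keys m. Var v) \<in> face_ideal K"
      unfolding face_ideal_def using R.genideal_self[OF carr] by blast
    moreover obtain q where "q \<in> polys_in (keys m)" "mon m = (\<Prod>v\<in>keys m. Var v) * q"
      by (rule mon_support_dvd)
    moreover have "polys_in (keys m) \<subseteq> polys_in W" using m(1) by (auto simp: polys_in_def)
    ultimately show "mon m \<in> face_ideal K" using ideal_poly_ringD(3)[OF id] by auto
  qed simp
qed

lemma ideal_face_ideal: "ideal (face_ideal K) R"
  unfolding face_ideal_eq by (rule ideal_full_ideal[OF down_closed_K])

sublocale F: cring "face_ring K"
  unfolding face_ring_def by (rule ideal.quotient_is_cring[OF ideal_face_ideal R.is_cring])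

lemma cls_eq_coset: "cls = (+>\<^bsub>R\<^esub>) (face_ideal K)"
  by (simp add: face_ring_class_def fun_eq_iff)

sublocale cls: ring_hom_ring R "face_ring K" cls
  unfolding face_ring_def cls_eq_coset by (rule ideal.rcos_ring_hom_ring[OF ideal_face_ideal])

lemma carrier_face_ring: "carrier (face_ring K) = cls ` polys_in W"
  by (auto simp: face_ring_def FactRing_def A_RCOSETS_def' cls_eq_coset)

lemma cls_eq_iff: "p \<in> polys_in W \<Longrightarrow> q \<in> polys_in W \<Longrightarrow> cls p = cls q \<longleftrightarrow> p - q \<in> face_ideal K"
  using R.quotient_eq_iff_same_a_r_cos[OF ideal_face_ideal, of p q]
  by (simp add: cls_eq_coset a_minus_poly_ring)

lemma face_ring_deg_eq: "face_ring_deg K i = cls ` forms W i"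
  by (simp add: face_ring_deg_def forms_eq)

section \<open>The quotient of the face ring by a sequence of linear forms\<close>

context
  fixes \<theta> :: "nat \<Rightarrow> 'v mpoly"
  assumes \<theta>: "linear_forms W \<theta>"
begin

abbreviation "\<Theta> \<equiv> (\<lambda>i. cls (\<theta> i))"
abbreviation "J r \<equiv> full_ideal W K (thetas \<theta> r)"

lemma \<theta>_in: "\<theta> i \<in> polys_in W"
  using \<theta> forms_subset_polys_in[of W 1] by (auto simp: linear_forms_def)

lemma ideal_J: "ideal (J r) R"
  by (rule ideal_full_ideal[OF down_closed_K])

lemma face_ideal_subset_J: "face_ideal K \<subseteq> J r"
  unfolding face_ideal_eq by (rule full_ideal_mono) simp

lemma \<theta>_in_J: "i < r \<Longrightarrow> \<theta> i \<in> J r"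
proof -
  assume "i < r"
  then have "\<theta> i * 1 \<in> part W K (thetas \<theta> r) (1 + 0)"
    by (intro part_gen_forms one_in_forms) (auto simp: thetas_def)
  then show ?thesis
    using \<theta> full_ideal_form_iff[of "\<theta> i" W 1] by (auto simp: linear_forms_def)
qed

text \<open>One inclusion holds since the image of an ideal is an ideal containing the parameters.
  For the other, the ideal is pulled back along \<open>cls\<close> to the polynomial ring, where
  \<open>full_ideal_least\<close> applies.\<close>

lemma theta_ideal_eq: "theta_ideal K \<Theta> r = cls ` J r"
proof
  have carr: "\<Theta> ` {..<r} \<subseteq> carrier (face_ring K)"
    using \<theta>_in by (auto simp: carrier_face_ring)
  have "ideal (cls ` J r) (face_ring K)"
    unfolding face_ring_def cls_eq_coset
    by (rule R.ring_ideal_imp_quot_ideal[OF ideal_face_ideal ideal_J])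
  then show "theta_ideal K \<Theta> r \<subseteq> cls ` J r"
    unfolding theta_ideal_def by (rule F.genideal_minimal) (auto intro: \<theta>_in_J)
  have id: "ideal (theta_ideal K \<Theta> r) (face_ring K)"
    unfolding theta_ideal_def by (rule F.genideal_ideal[OF carr])
  let ?I = "{p \<in> carrier R. cls p \<in> theta_ideal K \<Theta> r}"
  have idI: "ideal ?I R" by (rule cls.ideal_vimage[OF id])
  have "J r \<subseteq> ?I"
  proof (rule full_ideal_least[OF idI])
    fix m :: "'v \<Rightarrow>\<^sub>0 nat" assume m: "keys m \<subseteq> W" "keys m \<notin> K"
    have p: "mon m \<in> polys_in W" using m(1) by (simp add: polys_in_def)
    have "mon m \<in> face_ideal K"
      unfolding face_ideal_eq
      using full_ideal_form_iff[of "mon m" W "mdeg m" K "{}"] part_monomial[of m W "mdeg m" K] m by (simp add: mons_def)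
    then have "cls (mon m) = cls 0"
      using p by (subst cls_eq_iff) (auto simp: mp.subspace_0[OF subspace_polys_in])
    also have "\<dots> = \<zero>\<^bsub>face_ring K\<^esub>" using cls.hom_zero by simp
    finally show "mon m \<in> ?I"
      using p additive_subgroup.zero_closed[OF ideal.axioms(1)[OF id]] by simp
  next
    fix g d assume "(g, d) \<in> thetas \<theta> r"
    then obtain i where "i < r" "g = \<theta> i" by (auto simp: thetas_def)
    then show "g \<in> ?I"
      using \<theta>_in F.genideal_self[OF carr] unfolding theta_ideal_def by auto
  qed
  then show "cls ` J r \<subseteq> theta_ideal K \<Theta> r" by auto
qed

lemma cls_in_theta_ideal_iff: "p \<in> polys_in W \<Longrightarrow> cls p \<in> theta_ideal K \<Theta> r \<longleftrightarrow> p \<in> J r"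
proof
  assume p: "p \<in> polys_in W" and "cls p \<in> theta_ideal K \<Theta> r"
  then obtain q where q: "q \<in> J r" "cls p = cls q" unfolding theta_ideal_eq by auto
  have "q \<in> polys_in W" using q(1) by (simp add: full_ideal_def)
  then have "p - q \<in> J r" using q(2) p cls_eq_iff face_ideal_subset_J by blast
  then have "(p - q) + q \<in> J r" using q(1) by (rule full_ideal_add)
  then show "p \<in> J r" by simp
qed (simp add: theta_ideal_eq)

lemma ideal_theta_ideal: "ideal (theta_ideal K \<Theta> r) (face_ring K)"
  unfolding theta_ideal_def using \<theta>_in by (intro F.genideal_ideal) (auto simp: carrier_face_ring)

lemma cring_H: "cring (H K \<Theta>)"
  unfolding H_def by (rule ideal.quotient_is_cring[OF ideal_theta_ideal F.is_cring])

definition hcls :: "'v mpoly \<Rightarrow> 'v mpoly set set" where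
  "hcls p = H_class K \<Theta> (cls p)"

lemma H_class_eq: "H_class K \<Theta> = (+>\<^bsub>face_ring K\<^esub>) (theta_ideal K \<Theta> D)"
  by (simp add: H_class_def fun_eq_iff)

lemma hcls_ring_hom: "hcls \<in> Ring.ring_hom R (H K \<Theta>)"
proof -
  have "H_class K \<Theta> \<in> Ring.ring_hom (face_ring K) (H K \<Theta>)"
    unfolding H_class_eq H_def by (rule ideal.rcos_ring_hom[OF ideal_theta_ideal])
  then have "H_class K \<Theta> \<circ> cls \<in> Ring.ring_hom R (H K \<Theta>)"
    by (rule ring_hom_trans[OF cls.homh])
  moreover have "H_class K \<Theta> \<circ> cls = hcls" by (simp add: hcls_def[abs_def] comp_def)
  ultimately show ?thesis by simp
qed

lemma hcls_add: "p \<in> polys_in W \<Longrightarrow> q \<in> polys_in W \<Longrightarrow> hcls (p + q) = hcls p \<oplus>\<^bsub>H K \<Theta>\<^esub> hcls q"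
  using ring_hom_add[OF hcls_ring_hom, of p q] by simp

lemma hcls_mult: "p \<in> polys_in W \<Longrightarrow> q \<in> polys_in W \<Longrightarrow> hcls (p * q) = hcls p \<otimes>\<^bsub>H K \<Theta>\<^esub> hcls q"
  using ring_hom_mult[OF hcls_ring_hom, of p q] by simp

lemma hcls_one: "hcls 1 = \<one>\<^bsub>H K \<Theta>\<^esub>"
  using ring_hom_one[OF hcls_ring_hom] by simp

lemma hcls_closed: "p \<in> polys_in W \<Longrightarrow> hcls p \<in> carrier (H K \<Theta>)"
  using ring_hom_closed[OF hcls_ring_hom, of p] by simp

lemma carrier_H: "carrier (H K \<Theta>) = hcls ` polys_in W"
proof -
  have "carrier (H K \<Theta>) = H_class K \<Theta> ` carrier (face_ring K)"
    by (auto simp: H_def FactRing_def A_RCOSETS_def' H_class_eq)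
  then show ?thesis by (auto simp: carrier_face_ring hcls_def)
qed

lemma power_in_polys_in: "p \<in> polys_in W \<Longrightarrow> p ^ n \<in> polys_in W"
  by (induction n) (auto simp: one_in_polys_in polys_in_mult)

lemma hcls_power: "p \<in> polys_in W \<Longrightarrow> hcls (p ^ n) = hcls p [^]\<^bsub>H K \<Theta>\<^esub> n"
proof (induction n)
  case (Suc n)
  interpret H: cring "H K \<Theta>" by (rule cring_H)
  have "hcls (p ^ Suc n) = hcls (p ^ n * p)" by (simp add: mult.commute)
  then show ?case using Suc by (simp add: hcls_mult power_in_polys_in)
next
  case 0
  interpret H: cring "H K \<Theta>" by (rule cring_H)
  show ?case by (simp add: hcls_one)
qed

lemma hcls_eq_iff:
  assumes "p \<in> polys_in W" "q \<in> polys_in W"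
  shows "hcls p = hcls q \<longleftrightarrow> p - q \<in> J D"
proof -
  have m: "cls p \<ominus>\<^bsub>face_ring K\<^esub> cls q = cls (p - q)"
    using cls.hom_add[of p "\<ominus>\<^bsub>R\<^esub> q"] cls.hom_a_inv[of q] assms a_inv_poly_ring[of q W]
      mp.subspace_neg[OF subspace_polys_in assms(2)] by (simp add: a_minus_def)
  have "hcls p = hcls q \<longleftrightarrow> cls p \<ominus>\<^bsub>face_ring K\<^esub> cls q \<in> theta_ideal K \<Theta> D"
    unfolding hcls_def H_class_eq
    using assms by (intro F.quotient_eq_iff_same_a_r_cos[OF ideal_theta_ideal, symmetric])
      (auto simp: carrier_face_ring)
  also have "\<dots> \<longleftrightarrow> p - q \<in> J D"
    unfolding m using mp.subspace_diff[OF subspace_polys_in assms] by (rule cls_in_theta_ideal_iff)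
  finally show ?thesis .
qed

lemma H_deg_eq: "H_deg K \<Theta> i = hcls ` forms W i"
  unfolding H_deg_def face_ring_deg_eq image_image hcls_def ..

lemma H_reals_eq: "H_reals K \<Theta> = hcls ` range Const"
  unfolding H_reals_def hcls_def by auto

text \<open>Multiplication by a linear form shifts homogeneous components by one and the ideals are
  homogeneous, so regularity can be tested component by component.\<close>

lemma regular_seq_iff: "regular_seq K \<Theta> \<longleftrightarrow> regular_forms W K \<theta> D"
proof
  assume reg: "regular_seq K \<Theta>"
  show "regular_forms W K \<theta> D"
    unfolding regular_forms_def
  proof (intro allI ballI impI)
    fix r n p assume r: "r < D" and p: "p \<in> forms W n" "\<theta> r * p \<in> part W K (thetas \<theta> r) (Suc n)"
    have pW: "p \<in> polys_in W" using p(1) forms_subset_polys_in by blast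
    have "\<theta> r * p \<in> forms W (Suc n)"
      using forms_mult[of "\<theta> r" W 1 p n] \<theta> p(1) by (simp add: linear_forms_def)
    then have "\<theta> r * p \<in> J r" using p(2) full_ideal_form_iff by blast
    then have "cls (\<theta> r * p) \<in> theta_ideal K \<Theta> r"
      using cls_in_theta_ideal_iff[OF polys_in_mult[OF \<theta>_in pW]] by simp
    then have "\<Theta> r \<otimes>\<^bsub>face_ring K\<^esub> cls p \<in> theta_ideal K \<Theta> r"
      using cls.hom_mult[of "\<theta> r" p] \<theta>_in pW by simp
    then have "cls p \<in> theta_ideal K \<Theta> r"
      using reg r pW unfolding regular_seq_def carrier_face_ring by blast
    then show "p \<in> part W K (thetas \<theta> r) n"
      using cls_in_theta_ideal_iff[OF pW] full_ideal_form_iff[OF p(1)] by blast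
  qed
next
  assume reg: "regular_forms W K \<theta> D"
  show "regular_seq K \<Theta>"
    unfolding regular_seq_def
  proof (intro allI ballI impI)
    fix r a assume r: "r < D" and "a \<in> carrier (face_ring K)"
      and a: "\<Theta> r \<otimes>\<^bsub>face_ring K\<^esub> a \<in> theta_ideal K \<Theta> r"
    then obtain p where p: "p \<in> polys_in W" "a = cls p" by (auto simp: carrier_face_ring)
    have "cls (\<theta> r * p) \<in> theta_ideal K \<Theta> r"
      using a p cls.hom_mult[of "\<theta> r" p] \<theta>_in by simp
    then have J: "\<theta> r * p \<in> J r"
      using cls_in_theta_ideal_iff[OF polys_in_mult[OF \<theta>_in p(1)]] by simp
    have "hcomp n p \<in> part W K (thetas \<theta> r) n" for n
    proof -
      have "hcomp (Suc n) (\<theta> r * p) = \<theta> r * hcomp n p"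
        using hcomp_form_mult[of "\<theta> r" W 1 p "Suc n"] \<theta> p(1) by (simp add: linear_forms_def)
      then have "\<theta> r * hcomp n p \<in> part W K (thetas \<theta> r) (Suc n)"
        using J by (metis (mono_tags, lifting) full_ideal_def mem_Collect_eq)
      then show ?thesis
        using reg r hcomp_in_forms[OF p(1), of n] unfolding regular_forms_def by blast
    qed
    then have "p \<in> J r" using p(1) by (simp add: full_ideal_def)
    then show "a \<in> theta_ideal K \<Theta> r" using p cls_in_theta_ideal_iff by blast
  qed
qed

text \<open>Adding one generator is a line extension over the copy of the reals.
  \<open>Suc_dim\<close> asks for a vector outside the previous span; otherwise the image does not
  grow, hence the case distinction.\<close>

lemma finite_dimension_span:
  assumes "finite B" "B \<subseteq> polys_in W"
  shows "ring.finite_dimension (H K \<Theta>) (H_reals K \<Theta>) (hcls ` mp.span B)"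
  using assms
proof (induction B rule: finite_induct)
  case empty
  interpret H: cring "H K \<Theta>" by (rule cring_H)
  have "hcls 0 = \<zero>\<^bsub>H K \<Theta>\<^esub>"
    using hcls_add[of 0 0] hcls_closed[of 0] mp.subspace_0[OF subspace_polys_in, of W]
    by (metis H.add.l_cancel_one' add.right_neutral)
  then show ?case
    using H.zero_dim[of "H_reals K \<Theta>"] by (intro H.finite_dimensionI[of 0]) simp
next
  case (insert b B)
  interpret H: cring "H K \<Theta>" by (rule cring_H)
  have sB: "mp.span B \<subseteq> polys_in W"
    using insert.prems by (intro mp.span_minimal subspace_polys_in) auto
  have b: "b \<in> polys_in W" using insert.prems by simp
  have ext: "hcls ` mp.span (insert b B) = H.line_extension (H_reals K \<Theta>) (hcls b) (hcls ` mp.span B)"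
  proof -
    have "H.line_extension (H_reals K \<Theta>) (hcls b) (hcls ` mp.span B)
      = {hcls (Const c) \<otimes>\<^bsub>H K \<Theta>\<^esub> hcls b \<oplus>\<^bsub>H K \<Theta>\<^esub> hcls p | c p. p \<in> mp.span B}"
      unfolding H.line_extension_def set_add_def' r_coset_def H_reals_eq by blast
    also have "\<dots> = {hcls (Const c * b + p) | c p. p \<in> mp.span B}"
    proof -
      have "hcls (Const c) \<otimes>\<^bsub>H K \<Theta>\<^esub> hcls b \<oplus>\<^bsub>H K \<Theta>\<^esub> hcls p = hcls (Const c * b + p)" if "p \<in> mp.span B" for c p
        using that sB b Const_in_polys_in[of c W] polys_in_mult[of "Const c" W b]
        by (subst hcls_add) (auto simp: hcls_mult)
      then show ?thesis by (metis (no_types, lifting))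
    qed
    also have "\<dots> = hcls ` mp.span (insert b B)"
    proof
      show "{hcls (Const c * b + p) | c p. p \<in> mp.span B} \<subseteq> hcls ` mp.span (insert b B)"
      proof safe
        fix c p assume "p \<in> mp.span B"
        then have "(Const c * b + p) - Const c * b \<in> mp.span B" by simp
        then have "Const c * b + p \<in> mp.span (insert b B)" unfolding mp.span_breakdown_eq by blast
        then show "hcls (Const c * b + p) \<in> hcls ` mp.span (insert b B)" by (rule imageI)
      qed
      show "hcls ` mp.span (insert b B) \<subseteq> {hcls (Const c * b + p) | c p. p \<in> mp.span B}"
      proof
        fix y assume "y \<in> hcls ` mp.span (insert b B)"
        then obtain x c where "y = hcls x" "x - Const c * b \<in> mp.span B"
          by (auto simp: mp.span_breakdown_eq)
        then show "y \<in> {hcls (Const c * b + p) | c p. p \<in> mp.span B}"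
          by (intro CollectI exI[of _ c] exI[of _ "x - Const c * b"]) simp
      qed
    qed
    finally show ?thesis ..
  qed
  show ?case
  proof (cases "hcls b \<in> hcls ` mp.span B")
    case True
    then obtain b' where b': "b' \<in> mp.span B" "hcls b = hcls b'" by auto
    have "hcls ` mp.span (insert b B) = hcls ` mp.span B"
    proof
      show "hcls ` mp.span B \<subseteq> hcls ` mp.span (insert b B)"
        by (intro image_mono mp.span_mono) auto
      show "hcls ` mp.span (insert b B) \<subseteq> hcls ` mp.span B"
      proof
        fix y assume "y \<in> hcls ` mp.span (insert b B)"
        then obtain x c where x: "y = hcls x" "x - Const c * b \<in> mp.span B"
          by (auto simp: mp.span_breakdown_eq)
        define z where "z = x - Const c * b"
        have z: "z \<in> mp.span B" "x = Const c * b + z" using x(2) by (auto simp: z_def)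
        have "b' \<in> polys_in W" "z \<in> polys_in W" using sB b'(1) z(1) by auto
        then have "hcls x = hcls (Const c * b' + z)"
          using b b'(2) z Const_in_polys_in[of c W] polys_in_mult[of "Const c" W] by (simp add: hcls_add hcls_mult)
        then show "y \<in> hcls ` mp.span B"
          using x(1) b'(1) z(1) mp.span_add mp.span_scale by blast
      qed
    qed
    then show ?thesis using insert by simp
  next
    case False
    obtain n where "H.dimension n (H_reals K \<Theta>) (hcls ` mp.span B)"
      using insert unfolding H.finite_dimension_def by auto
    then show ?thesis
      unfolding ext using False hcls_closed[OF b] by (intro H.finite_dimensionI[of "Suc n"] H.Suc_dim)
  qed
qed

text \<open>If the quotient vanishes in degree \<open>N\<close>, it vanishes above, so every class
  is represented by the truncation of a polynomial to degrees below \<open>N\<close>.\<close>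

lemma lsop_if_part_eq_forms:
  assumes "part W K (thetas \<theta> D) N = forms W N"
  shows "lsop K \<Theta>"
  unfolding lsop_def
proof (intro conjI allI impI)
  show "\<Theta> i \<in> face_ring_deg K 1" for i
    using \<theta> by (auto simp: face_ring_deg_eq linear_forms_def)
  let ?B = "mon ` (\<Union>n<N. mons W n)"
  have B: "finite ?B" "?B \<subseteq> polys_in W"
    using finite_W finite_mons by (auto simp: mons_def polys_in_def)
  have "carrier (H K \<Theta>) = hcls ` mp.span ?B"
  proof
    show "hcls ` mp.span ?B \<subseteq> carrier (H K \<Theta>)"
      unfolding carrier_H by (intro image_mono mp.span_minimal B(2) subspace_polys_in)
    show "carrier (H K \<Theta>) \<subseteq> hcls ` mp.span ?B"
      unfolding carrier_H
    proof safe
      fix p assume p: "p \<in> polys_in W"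
      define q where "q = (\<Sum>k<N. hcomp k p)"
      have "hcomp k p \<in> mp.span ?B" if "k < N" for k
      proof -
        have "hcomp k p \<in> mp.span (mon ` mons W k)"
          using hcomp_in_forms[OF p] by (simp add: forms_eq_span)
        then show ?thesis using mp.span_mono[of "mon ` mons W k" ?B] that by blast
      qed
      then have q: "q \<in> mp.span ?B" unfolding q_def by (intro mp.span_sum) auto
      then have qW: "q \<in> polys_in W" using mp.span_minimal[OF B(2) subspace_polys_in] by blast
      have "p - q \<in> J D"
        unfolding full_ideal_def
      proof (intro CollectI conjI allI)
        show pq: "p - q \<in> polys_in W" by (rule mp.subspace_diff[OF subspace_polys_in p qW])
        fix n
        show "hcomp n (p - q) \<in> part W K (thetas \<theta> D) n"
        proof (cases "n < N")
          case True
          have "hcomp n q = (\<Sum>k<N. if n = k then hcomp n p else 0)"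
            unfolding q_def hcomp_sum
            by (intro sum.cong) (auto simp: hcomp_form[OF hcomp_in_forms[OF p]])
          then have "hcomp n (p - q) = 0"
            using True hcomp_add[of n p "- q"] by (simp add: hcomp_uminus)
          then show ?thesis by (simp add: part_0)
        next
          case False
          then obtain j where "n = N + j" using le_Suc_ex by (metis not_less)
          then have "part W K (thetas \<theta> D) n = forms W n"
            using part_eq_forms_add[OF graded_gens_thetas[OF \<theta>] down_closed_K assms] by simp
          then show ?thesis using hcomp_in_forms[OF pq] by simp
        qed
      qed
      then show "hcls p \<in> hcls ` mp.span ?B" using q qW p hcls_eq_iff by blast
    qed
  qed
  then show "ring.finite_dimension (H K \<Theta>) (H_reals K \<Theta>) (carrier (H K \<Theta>))"
    using finite_dimension_span[OF B] by simp
qed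

lemma surjective_of_bij:
  assumes w: "w \<in> forms W 1"
    and bij: "bij_betw (\<lambda>a. (hcls w [^]\<^bsub>H K \<Theta>\<^esub> e) \<otimes>\<^bsub>H K \<Theta>\<^esub> a) (H_deg K \<Theta> i) (H_deg K \<Theta> (e + i))"
  shows "part W K (insert (w ^ e, e) (thetas \<theta> D)) (e + i) = forms W (e + i)"
proof
  have we: "w ^ e \<in> forms W e" using forms_power[OF w, of e] by simp
  then show "part W K (insert (w ^ e, e) (thetas \<theta> D)) (e + i) \<subseteq> forms W (e + i)"
    using graded_gens_thetas[OF \<theta>, of D] by (intro part_subset_forms) (auto simp: graded_gens_def)
  show "forms W (e + i) \<subseteq> part W K (insert (w ^ e, e) (thetas \<theta> D)) (e + i)"
  proof
    fix q assume q: "q \<in> forms W (e + i)"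
    have wW: "w \<in> polys_in W" using w forms_subset_polys_in by blast
    have "hcls q \<in> H_deg K \<Theta> (e + i)" using q by (simp add: H_deg_eq)
    then obtain a where "a \<in> H_deg K \<Theta> i" "hcls q = (hcls w [^]\<^bsub>H K \<Theta>\<^esub> e) \<otimes>\<^bsub>H K \<Theta>\<^esub> a"
      using bij unfolding bij_betw_def by auto
    then obtain p where p: "p \<in> forms W i" "hcls q = (hcls w [^]\<^bsub>H K \<Theta>\<^esub> e) \<otimes>\<^bsub>H K \<Theta>\<^esub> hcls p"
      by (auto simp: H_deg_eq)
    have in_polys: "p \<in> polys_in W" "w ^ e \<in> polys_in W" "q \<in> polys_in W"
      using p(1) we q forms_subset_polys_in by blast+
    have wp: "w ^ e * p \<in> forms W (e + i)" by (rule forms_mult[OF we p(1)])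
    have "hcls q = hcls (w ^ e * p)"
      using p(2) in_polys wW by (simp add: hcls_mult hcls_power)
    then have "q - w ^ e * p \<in> J D"
      using in_polys polys_in_mult hcls_eq_iff by blast
    moreover have "q - w ^ e * p \<in> forms W (e + i)" by (rule mp.subspace_diff[OF subspace_forms q wp])
    ultimately have "q - w ^ e * p \<in> part W K (thetas \<theta> D) (e + i)"
      using full_ideal_form_iff by blast
    then have "q - w ^ e * p \<in> part W K (insert (w ^ e, e) (thetas \<theta> D)) (e + i)"
      using part_mono[of K K "thetas \<theta> D" "insert (w ^ e, e) (thetas \<theta> D)"] by blast
    moreover have "w ^ e * p \<in> part W K (insert (w ^ e, e) (thetas \<theta> D)) (e + i)"
      using p(1) by (intro part_gen_forms) auto
    ultimately have "(q - w ^ e * p) + w ^ e * p \<in> part W K (insert (w ^ e, e) (thetas \<theta> D)) (e + i)"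
      by (rule part_add)
    then show "q \<in> part W K (insert (w ^ e, e) (thetas \<theta> D)) (e + i)" by simp
  qed
qed

lemma bij_of_surjective:
  assumes w: "w \<in> forms W 1"
    and surj: "part W K (insert (w ^ e, e) (thetas \<theta> D)) (e + i) = forms W (e + i)"
    and inj: "\<And>p. p \<in> forms W i \<Longrightarrow> w ^ e * p \<in> part W K (thetas \<theta> D) (e + i) \<Longrightarrow> p \<in> part W K (thetas \<theta> D) i"
  shows "bij_betw (\<lambda>a. (hcls w [^]\<^bsub>H K \<Theta>\<^esub> e) \<otimes>\<^bsub>H K \<Theta>\<^esub> a) (H_deg K \<Theta> i) (H_deg K \<Theta> (e + i))"
proof -
  have we: "w ^ e \<in> forms W e" using forms_power[OF w, of e] by simp
  have wW: "w \<in> polys_in W" and weW: "w ^ e \<in> polys_in W" using w we forms_subset_polys_in by blast+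
  have fW: "p \<in> polys_in W" if "p \<in> forms W n" for p n using that forms_subset_polys_in by blast
  have mult: "(hcls w [^]\<^bsub>H K \<Theta>\<^esub> e) \<otimes>\<^bsub>H K \<Theta>\<^esub> hcls p = hcls (w ^ e * p)" if "p \<in> forms W i" for p
    using fW[OF that] wW weW by (simp add: hcls_mult hcls_power)
  have "inj_on (\<lambda>a. (hcls w [^]\<^bsub>H K \<Theta>\<^esub> e) \<otimes>\<^bsub>H K \<Theta>\<^esub> a) (hcls ` forms W i)"
  proof (rule inj_onI)
    fix x y assume "x \<in> hcls ` forms W i" "y \<in> hcls ` forms W i"
      and eq: "(hcls w [^]\<^bsub>H K \<Theta>\<^esub> e) \<otimes>\<^bsub>H K \<Theta>\<^esub> x = (hcls w [^]\<^bsub>H K \<Theta>\<^esub> e) \<otimes>\<^bsub>H K \<Theta>\<^esub> y"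
    then obtain p q where pq: "p \<in> forms W i" "q \<in> forms W i" and xy: "x = hcls p" "y = hcls q" by blast
    from eq xy pq have "hcls (w ^ e * p) = hcls (w ^ e * q)" by (simp add: mult)
    then have "w ^ e * p - w ^ e * q \<in> J D"
      using hcls_eq_iff polys_in_mult[OF weW] fW pq by blast
    then have "w ^ e * (p - q) \<in> J D" by (simp add: right_diff_distrib)
    moreover have d: "p - q \<in> forms W i" by (rule mp.subspace_diff[OF subspace_forms pq])
    ultimately have "w ^ e * (p - q) \<in> part W K (thetas \<theta> D) (e + i)"
      using full_ideal_form_iff[OF forms_mult[OF we d]] by blast
    then have "p - q \<in> part W K (thetas \<theta> D) i" by (rule inj[OF d])
    then have "p - q \<in> J D" using full_ideal_form_iff[OF d] by blast
    then show "x = y" using hcls_eq_iff fW pq xy by blast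
  qed
  moreover have "(\<lambda>a. (hcls w [^]\<^bsub>H K \<Theta>\<^esub> e) \<otimes>\<^bsub>H K \<Theta>\<^esub> a) ` hcls ` forms W i = hcls ` forms W (e + i)"
  proof
    show "(\<lambda>a. (hcls w [^]\<^bsub>H K \<Theta>\<^esub> e) \<otimes>\<^bsub>H K \<Theta>\<^esub> a) ` hcls ` forms W i \<subseteq> hcls ` forms W (e + i)"
      using forms_mult[OF we] by (auto simp: mult)
    show "hcls ` forms W (e + i) \<subseteq> (\<lambda>a. (hcls w [^]\<^bsub>H K \<Theta>\<^esub> e) \<otimes>\<^bsub>H K \<Theta>\<^esub> a) ` hcls ` forms W i"
    proof safe
      fix q assume q: "q \<in> forms W (e + i)"
      then have "q \<in> part W K (insert (w ^ e, e) (thetas \<theta> D)) (e + i)" by (simp add: surj)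
      then obtain a b where ab: "a \<in> part W K (thetas \<theta> D) (e + i)" "b \<in> forms W i" "q = a + w ^ e * b"
        by (rule part_insert_decomp)
      then have "a \<in> forms W (e + i)" using part_subset_forms[OF graded_gens_thetas[OF \<theta>]] by blast
      then have "a \<in> J D" using ab(1) full_ideal_form_iff by blast
      then have "q - w ^ e * b \<in> J D" using ab(3) by simp
      then have "hcls q = hcls (w ^ e * b)"
        using hcls_eq_iff polys_in_mult[OF weW] fW q ab(2) by blast
      then show "hcls q \<in> (\<lambda>a. (hcls w [^]\<^bsub>H K \<Theta>\<^esub> e) \<otimes>\<^bsub>H K \<Theta>\<^esub> a) ` hcls ` forms W i"
        using ab(2) mult by (intro image_eqI[of _ _ "hcls b"]) auto
    qed
  qed
  ultimately show ?thesis by (simp add: bij_betw_def H_deg_eq)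
qed

end

end

section \<open>The HL property in terms of linear forms\<close>

context face_complex
begin

lemma theta_ideal_cong:
  "(\<And>i. i < n \<Longrightarrow> \<Psi> i = \<Psi>' i) \<Longrightarrow> theta_ideal K \<Psi> n = theta_ideal K \<Psi>' n"
  unfolding theta_ideal_def by (auto intro!: arg_cong[where f = "genideal (face_ring K)"])

text \<open>Representatives of the \<open>D\<close> parameters are chosen as polynomials, and
  \<open>w\<close> fills the remaining positions, in particular position \<open>D\<close> reserved
  for the Lefschetz element.\<close>

lemma linear_forms_lift:
  assumes "\<And>i. i < D \<Longrightarrow> \<Psi> i \<in> face_ring_deg K 1" and "w \<in> forms W 1"
  obtains \<theta> where "linear_forms W \<theta>" "\<And>i. i < D \<Longrightarrow> cls (\<theta> i) = \<Psi> i" "\<theta> D = w"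
proof -
  have "\<forall>i. \<exists>p. i < D \<longrightarrow> p \<in> forms W 1 \<and> cls p = \<Psi> i"
    using assms(1) unfolding face_ring_deg_eq by (metis (no_types, lifting) imageE)
  then obtain p where p: "\<And>i. i < D \<Longrightarrow> p i \<in> forms W 1 \<and> cls (p i) = \<Psi> i" by metis
  show ?thesis
  proof (rule that)
    show "linear_forms W (\<lambda>i. if i < D then p i else w)"
      using p assms(2) by (auto simp: linear_forms_def)
  qed (use p in auto)
qed

text \<open>Taken from the Cohen-Macaulay witness, whose regularity determines the Hilbert
  series.\<close>

lemma HL_imp_hilb:
  assumes "HL K"
  obtains \<theta> where "linear_forms W \<theta>" "hilb W K (thetas \<theta> D) = hpoly K"
proof -
  obtain \<Psi> where \<Psi>: "lsop K \<Psi>" "regular_seq K \<Psi>"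
    using assms by (auto simp: HL_def cohen_macaulay_def)
  obtain \<theta> where \<theta>: "linear_forms W \<theta>" "\<And>i. i < D \<Longrightarrow> cls (\<theta> i) = \<Psi> i"
    using linear_forms_lift[of \<Psi> 0] \<Psi>(1) mp.subspace_0[OF subspace_forms, of W 1]
    unfolding lsop_def by metis
  have "theta_ideal K (\<lambda>i. cls (\<theta> i)) r = theta_ideal K \<Psi> r" if "r < D" for r
    using that \<theta>(2) by (intro theta_ideal_cong) auto
  then have "regular_seq K (\<lambda>i. cls (\<theta> i))"
    using \<Psi>(2) \<theta>(2) unfolding regular_seq_def by simp
  then have reg: "regular_forms W K \<theta> D" using regular_seq_iff[OF \<theta>(1)] by simp
  have "hilb W K (thetas \<theta> D) = hpoly K"
    by (rule hilb_regular[OF finite_W finite_K face_subset_W down_closed_K \<theta>(1) reg])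
  then show ?thesis using that \<theta>(1) by blast
qed

text \<open>Taken from the Lefschetz witness, which may differ from the Cohen-Macaulay one. Of the
  bijections only surjectivity is kept, as this is a condition on ranks.\<close>

lemma HL_imp_surjective:
  assumes "HL K"
  obtains \<theta> where "linear_forms W \<theta>"
    "\<And>i. i \<le> D div 2 \<Longrightarrow> part W K (power_gens \<theta> D {D - 2 * i}) (D - i) = forms W (D - i)"
proof -
  obtain \<Psi> \<omega> where \<Psi>: "lsop K \<Psi>" "\<omega> \<in> H_deg K \<Psi> 1"
    and bij: "\<And>i. i \<le> D div 2 \<Longrightarrow> bij_betw (\<lambda>a. (\<omega> [^]\<^bsub>H K \<Psi>\<^esub> (D - 2 * i)) \<otimes>\<^bsub>H K \<Psi>\<^esub> a)
             (H_deg K \<Psi> i) (H_deg K \<Psi> (D - i))"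
    using assms unfolding HL_def by blast
  obtain w where w: "w \<in> forms W 1" "\<omega> = H_class K \<Psi> (cls w)"
    using \<Psi>(2) by (auto simp: H_deg_def face_ring_deg_eq)
  obtain \<theta> where \<theta>: "linear_forms W \<theta>" "\<And>i. i < D \<Longrightarrow> cls (\<theta> i) = \<Psi> i" "\<theta> D = w"
    using linear_forms_lift[of \<Psi> w] \<Psi>(1) w(1) unfolding lsop_def by metis
  have t: "theta_ideal K \<Psi> D = theta_ideal K (\<lambda>i. cls (\<theta> i)) D"
    using \<theta>(2) by (intro theta_ideal_cong) auto
  have HH: "H K \<Psi> = H K (\<lambda>i. cls (\<theta> i))" "H_class K \<Psi> = H_class K (\<lambda>i. cls (\<theta> i))"
    "H_deg K \<Psi> = H_deg K (\<lambda>i. cls (\<theta> i))"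
    by (simp_all add: H_def H_class_def[abs_def] H_deg_def[abs_def] t)
  have \<omega>: "\<omega> = hcls \<theta> w" using w(2) HH(2) by (simp add: hcls_def[OF \<theta>(1)])
  have "part W K (power_gens \<theta> D {D - 2 * i}) (D - i) = forms W (D - i)" if "i \<le> D div 2" for i
  proof -
    have e: "D - 2 * i + i = D - i" using that by linarith
    have "part W K (insert (w ^ (D - 2 * i), D - 2 * i) (thetas \<theta> D)) (D - 2 * i + i) = forms W (D - 2 * i + i)"
      by (rule surjective_of_bij[OF \<theta>(1) w(1)]) (use bij[OF that] e in \<open>simp add: HH \<omega>\<close>)
    then show ?thesis by (simp add: power_gens_single e \<theta>(3))
  qed
  then show ?thesis using that \<theta>(1) by blast
qed

text \<open>Everything demanded of the parameter is a lower bound on the dimension of an ideal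
  piece. Regularity and injectivity are recovered from \<open>regular_of_dim_bound\<close> and
  \<open>surjective_imp_injective\<close>.\<close>

lemma HL_intro:
  assumes \<theta>: "linear_forms W \<theta>"
    and bound: "\<And>n. n \<le> Suc D \<Longrightarrow>
      real (mp.dim (forms W n)) \<le> real (mp.dim (part W K (thetas \<theta> D) n)) + fps_nth (hpoly K) n"
    and surj: "\<And>i. i \<le> D div 2 \<Longrightarrow> part W K (power_gens \<theta> D {D - 2 * i}) (D - i) = forms W (D - i)"
    and sym: "symmetric_h K"
  shows "HL K"
proof -
  let ?\<Psi> = "\<lambda>i. cls (\<theta> i)"
  have reg: "regular_forms W K \<theta> D"
    by (rule regular_of_dim_bound[OF finite_W finite_K face_subset_W down_closed_K \<theta> bound])
  have hilb: "hilb W K (thetas \<theta> D) = hpoly K"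
    by (rule hilb_regular[OF finite_W finite_K face_subset_W down_closed_K \<theta> reg])
  have "mp.dim (forms W (Suc D)) \<le> mp.dim (part W K (thetas \<theta> D) (Suc D))"
    using bound[of "Suc D"] hpoly_nth_beyond[OF finite_K, of "Suc D"] by simp
  then have "part W K (thetas \<theta> D) (Suc D) = forms W (Suc D)"
    using eq_of_dim_forms[OF finite_W subset_refl subspace_part part_subset_forms[OF graded_gens_thetas[OF \<theta>]]]
    by blast
  then have lsop: "lsop K ?\<Psi>" by (rule lsop_if_part_eq_forms[OF \<theta>])
  have "regular_seq K ?\<Psi>" using reg regular_seq_iff[OF \<theta>] by simp
  then have cm: "cohen_macaulay K" using lsop by (auto simp: cohen_macaulay_def)
  have w: "\<theta> D \<in> forms W 1" using \<theta> by (simp add: linear_forms_def)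
  then have \<omega>: "hcls \<theta> (\<theta> D) \<in> H_deg K ?\<Psi> 1" by (simp add: H_deg_eq[OF \<theta>])
  have "bij_betw (\<lambda>a. (hcls \<theta> (\<theta> D) [^]\<^bsub>H K ?\<Psi>\<^esub> (D - 2 * i)) \<otimes>\<^bsub>H K ?\<Psi>\<^esub> a)
             (H_deg K ?\<Psi> i) (H_deg K ?\<Psi> (D - i))" if i: "i \<le> D div 2" for i
  proof -
    have e: "D - 2 * i + i = D - i" using i by linarith
    have "bij_betw (\<lambda>a. (hcls \<theta> (\<theta> D) [^]\<^bsub>H K ?\<Psi>\<^esub> (D - 2 * i)) \<otimes>\<^bsub>H K ?\<Psi>\<^esub> a)
             (H_deg K ?\<Psi> i) (H_deg K ?\<Psi> (D - 2 * i + i))"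
    proof (rule bij_of_surjective[OF \<theta> w])
      show "part W K (insert (\<theta> D ^ (D - 2 * i), D - 2 * i) (thetas \<theta> D)) (D - 2 * i + i) = forms W (D - 2 * i + i)"
        using surj[OF i] by (simp add: power_gens_single e)
      show "p \<in> part W K (thetas \<theta> D) i"
        if "p \<in> forms W i" "\<theta> D ^ (D - 2 * i) * p \<in> part W K (thetas \<theta> D) (D - 2 * i + i)" for p
        using that unfolding e
        by (intro surjective_imp_injective[OF finite_W finite_K face_subset_W down_closed_K \<theta> hilb sym i refl surj[OF i]])
    qed
    then show ?thesis unfolding e .
  qed
  then show ?thesis using cm sym lsop \<omega> unfolding HL_def by blast
qed

end

declare mp.scale_scale [simp del]

section \<open>Substitution of linear forms\<close>

definition subst_mon :: "('v \<Rightarrow> 'v mpoly) \<Rightarrow> ('v \<Rightarrow>\<^sub>0 nat) \<Rightarrow> 'v mpoly" where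
  "subst_mon \<sigma> m = (\<Prod>v\<in>keys m. \<sigma> v ^ lookup m v)"

definition subst :: "('v \<Rightarrow> 'v mpoly) \<Rightarrow> 'v mpoly \<Rightarrow> 'v mpoly" where
  "subst \<sigma> p = (\<Sum>m\<in>keys p. Const (lookup p m) * subst_mon \<sigma> m)"

lemma subst_mon_superset:
  "finite A \<Longrightarrow> keys m \<subseteq> A \<Longrightarrow> subst_mon \<sigma> m = (\<Prod>v\<in>A. \<sigma> v ^ lookup m v)"
  unfolding subst_mon_def by (intro prod.mono_neutral_left) (auto simp: in_keys_iff)

lemma subst_mon_plus: "subst_mon \<sigma> (a + b) = subst_mon \<sigma> a * subst_mon \<sigma> b"
proof -
  let ?A = "keys a \<union> keys b"
  have "subst_mon \<sigma> (a + b) = (\<Prod>v\<in>?A. \<sigma> v ^ lookup (a + b) v)"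
    by (rule subst_mon_superset) (simp_all add: keys_plus_nat)
  also have "\<dots> = (\<Prod>v\<in>?A. \<sigma> v ^ lookup a v) * (\<Prod>v\<in>?A. \<sigma> v ^ lookup b v)"
    by (simp add: lookup_add power_add prod.distrib)
  also have "\<dots> = subst_mon \<sigma> a * subst_mon \<sigma> b"
    using subst_mon_superset[of ?A a \<sigma>] subst_mon_superset[of ?A b \<sigma>] by simp
  finally show ?thesis .
qed

lemma subst_superset:
  "finite A \<Longrightarrow> keys p \<subseteq> A \<Longrightarrow>
    subst \<sigma> p = (\<Sum>m\<in>A. Const (lookup p m) * subst_mon \<sigma> m)"
  unfolding subst_def by (intro sum.mono_neutral_left) (auto simp: in_keys_iff)

lemma subst_add: "subst \<sigma> (p + q) = subst \<sigma> p + subst \<sigma> q"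
proof -
  let ?A = "keys p \<union> keys q"
  have "subst \<sigma> (p + q) = (\<Sum>m\<in>?A. Const (lookup (p + q) m) * subst_mon \<sigma> m)"
    by (rule subst_superset) (use keys_add[of p q] in auto)
  also have "\<dots> = (\<Sum>m\<in>?A. Const (lookup p m) * subst_mon \<sigma> m)
      + (\<Sum>m\<in>?A. Const (lookup q m) * subst_mon \<sigma> m)"
    by (simp add: lookup_add distrib_right sum.distrib)
  also have "\<dots> = subst \<sigma> p + subst \<sigma> q"
    using subst_superset[of ?A p \<sigma>] subst_superset[of ?A q \<sigma>] by simp
  finally show ?thesis .
qed

lemma subst_scale: "subst \<sigma> (Const c * p) = Const c * subst \<sigma> p"
proof -
  have "subst \<sigma> (Const c * p) = (\<Sum>m\<in>keys p. Const (lookup (Const c * p) m) * subst_mon \<sigma> m)"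
  proof (rule subst_superset)
    show "keys (Const c * p) \<subseteq> keys p"
      unfolding in_keys_iff subset_iff by simp
  qed simp
  also have "\<dots> = Const c * subst \<sigma> p"
    unfolding subst_def sum_distrib_left by (intro sum.cong) (simp_all add: mult.assoc)
  finally show ?thesis .
qed

lemma subst_mon [simp]: "subst \<sigma> (mon m) = subst_mon \<sigma> m"
  by (simp add: subst_def)

lemma subst_0 [simp]: "subst \<sigma> 0 = 0"
  by (simp add: subst_def)

lemma mpoly_induct [case_names zero add scale mon]:
  assumes "Q 0" "\<And>p q. Q p \<Longrightarrow> Q q \<Longrightarrow> Q (p + q)" "\<And>c p. Q p \<Longrightarrow> Q (Const c * p)" "\<And>m. Q (mon m)"
  shows "Q p"
proof -
  have "p \<in> mspan UNIV" by (simp add: mspan_def)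
  then show ?thesis unfolding mspan_eq_span
    by (rule mp.span_induct) (auto simp: mp.subspace_def assms)
qed

lemma subst_mult: "subst \<sigma> (p * q) = subst \<sigma> p * subst \<sigma> q"
proof (induction p rule: mpoly_induct)
  case (mon m)
  show ?case
  proof (induction q rule: mpoly_induct)
    case (scale c p)
    then show ?case using subst_scale[of \<sigma> c "mon m * p"] by (simp add: subst_scale mult.left_commute)
  qed (simp_all add: distrib_left subst_add mult_single subst_mon_plus)
qed (simp_all add: distrib_right subst_add subst_scale mult.assoc)

lemma linear_subst: "mlinear (subst \<sigma>)"
  by unfold_locales (simp_all add: subst_add subst_scale distrib_left distrib_right mult.assoc)

lemma subst_diff: "subst \<sigma> (p - q) = subst \<sigma> p - subst \<sigma> q"
  by (rule module_hom.diff[OF linear_subst])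

lemma subst_one [simp]: "subst \<sigma> 1 = 1"
  using subst_mon[of \<sigma> 0] by (simp add: subst_mon_def)

lemma subst_power: "subst \<sigma> (p ^ n) = subst \<sigma> p ^ n"
  by (induction n) (auto simp: subst_mult)

lemma subst_prod: "subst \<sigma> (prod f A) = (\<Prod>i\<in>A. subst \<sigma> (f i))"
  by (induction A rule: infinite_finite_induct) (auto simp: subst_mult)

lemma subst_Const [simp]: "subst \<sigma> (Const c) = Const c"
  using subst_scale[of \<sigma> c 1] by simp

lemma subst_Var [simp]: "subst \<sigma> (Var v) = \<sigma> v"
  by (simp add: Var_def subst_mon_def)

lemma subst_mon_in_forms:
  assumes "\<And>v. v \<in> V \<Longrightarrow> \<sigma> v \<in> forms W 1" "keys m \<subseteq> V"
  shows "subst_mon \<sigma> m \<in> forms W (mdeg m)"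
proof -
  have "(\<Prod>v\<in>A. \<sigma> v ^ lookup m v) \<in> forms W (\<Sum>v\<in>A. lookup m v)"
    if "finite A" "A \<subseteq> V" for A
    using that
  proof (induction A rule: finite_induct)
    case (insert x A)
    have "\<sigma> x ^ lookup m x \<in> forms W (lookup m x)"
      using forms_power[OF assms(1), of x "lookup m x"] insert.prems by simp
    then show ?case using insert by (simp add: forms_mult)
  qed (simp add: one_in_forms)
  then show ?thesis using assms(2) by (simp add: subst_mon_def mdeg_def)
qed

lemma subst_in_forms:
  assumes "\<And>v. v \<in> V \<Longrightarrow> \<sigma> v \<in> forms W 1" "p \<in> forms V n"
  shows "subst \<sigma> p \<in> forms W n"
  using assms(2)
proof (induction rule: forms_induct)
  case (mon m)
  then show ?case using subst_mon_in_forms[of V \<sigma> W m] assms(1) by (auto simp: mons_def)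
qed (simp_all add: subst_add subst_scale mp.subspace_add[OF subspace_forms]
      mp.subspace_scale[OF subspace_forms] mp.subspace_0[OF subspace_forms])

lemma subst_mon_Var: "subst_mon Var m = mon m"
proof -
  have "subst_mon Var m = (\<Prod>v\<in>keys m. mon (single v (lookup m v)))"
  proof -
    have "Var v ^ n = mon (single v n)" for v :: 'a and n
      by (induction n) (auto simp: Var_def mult_single single_add[symmetric])
    then show ?thesis by (simp add: subst_mon_def)
  qed
  also have "\<dots> = mon (\<Sum>v\<in>keys m. single v (lookup m v))"
  proof -
    have "(\<Prod>v\<in>A. mon (f v)) = mon (\<Sum>v\<in>A. f v)" if "finite A" for f :: "'a \<Rightarrow> 'a \<Rightarrow>\<^sub>0 nat" and A
      using that by (induction A rule: finite_induct) (auto simp: mult_single)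
    then show ?thesis by simp
  qed
  also have "(\<Sum>v\<in>keys m. single v (lookup m v)) = m"
    by (rule poly_mapping_eqI) (auto simp: lookup_sum lookup_single when_def in_keys_iff)
  finally show ?thesis .
qed

lemma subst_subst_eq:
  assumes "\<And>v. v \<in> W \<Longrightarrow> subst \<sigma> (\<tau> v) = Var v" "p \<in> polys_in W"
  shows "subst \<sigma> (subst \<tau> p) = p"
proof -
  have "subst \<sigma> (subst_mon \<tau> m) = mon m" if "m \<in> keys p" for m
  proof -
    have "keys m \<subseteq> W" using that assms(2) by (auto simp: polys_in_def)
    then have "subst \<sigma> (subst_mon \<tau> m) = subst_mon Var m"
      unfolding subst_mon_def subst_prod subst_power
      by (intro prod.cong) (auto simp: assms(1))
    then show ?thesis by (simp add: subst_mon_Var)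
  qed
  then have "subst \<sigma> (subst \<tau> p) = (\<Sum>m\<in>keys p. Const (lookup p m) * mon m)"
    unfolding subst_def[of \<tau>] module_hom.sum[OF linear_subst] subst_scale by simp
  then show ?thesis using mpoly_sum_monomials[of p] by simp
qed

lemma surj_subst_forms:
  assumes "\<And>v. v \<in> W \<Longrightarrow> \<tau> v \<in> forms V 1" "\<And>v. v \<in> W \<Longrightarrow> subst \<sigma> (\<tau> v) = Var v"
  shows "forms W n \<subseteq> subst \<sigma> ` forms V n"
proof
  fix p assume p: "p \<in> forms W n"
  then have "p \<in> polys_in W" using forms_subset_polys_in by blast
  then have "subst \<sigma> (subst \<tau> p) = p" by (intro subst_subst_eq assms(2))
  moreover have "subst \<tau> p \<in> forms V n" by (rule subst_in_forms[OF assms(1) p])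
  ultimately show "p \<in> subst \<sigma> ` forms V n" by (metis imageI)
qed

section \<open>Transfer of codimension bounds\<close>

text \<open>An upper bound on a graded piece of the quotient, free of subtraction. With
  \<open>c = 0\<close> it says that the piece vanishes (\<open>codim_le_0_iff\<close>).\<close>

definition codim_le :: "'v set \<Rightarrow> 'v set set \<Rightarrow> ('v mpoly \<times> nat) set \<Rightarrow> nat \<Rightarrow> nat \<Rightarrow> bool" where
  "codim_le W K G n c \<longleftrightarrow> mp.dim (forms W n) \<le> mp.dim (part W K G n) + c"

lemma codim_le_0_iff:
  "finite W \<Longrightarrow> graded_gens W G \<Longrightarrow> codim_le W K G n 0 \<longleftrightarrow> part W K G n = forms W n"
  unfolding codim_le_def
  using eq_of_dim_forms[OF _ subset_refl subspace_part part_subset_forms, of W G] by auto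

lemma codim_leE:
  assumes "finite W" "graded_gens W G" "codim_le W K G n c"
  obtains E where "finite E" "E \<subseteq> forms W n" "card E \<le> c" "forms W n \<subseteq> mp.span (part W K G n \<union> E)"
proof -
  obtain E where "finite E" "E \<subseteq> forms W n" "card E + mp.dim (part W K G n) = mp.dim (forms W n)"
    "forms W n \<subseteq> mp.span (part W K G n \<union> E)"
    using mp.codim_complement[of "mon ` mons W n" "forms W n" "part W K G n"]
      finite_spanning_forms[OF assms(1), of n] subspace_part part_subset_forms[OF assms(2)] by metis
  then show ?thesis using that assms(3) unfolding codim_le_def by (metis add.commute nat_add_left_cancel_le)
qed

lemma codim_leI:
  assumes "finite W" "graded_gens W G" "finite E" "card E \<le> c" "forms W n \<subseteq> mp.span (part W K G n \<union> E)"
  shows "codim_le W K G n c"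
proof -
  have "part W K G n \<subseteq> mp.span (mon ` mons W n)"
    using part_subset_forms[OF assms(2)] by (simp add: forms_eq_span)
  then have "mp.dim (forms W n) \<le> mp.dim (part W K G n) + card E"
    using mp.dim_le_dim_add_card[of "mon ` mons W n"] finite_mons[OF assms(1)] assms(3,5) by blast
  then show ?thesis using assms(4) by (simp add: codim_le_def)
qed

text \<open>The map induces a surjection between the quotients in degree \<open>n\<close>, so a set
  spanning the first quotient is carried to one spanning the second.\<close>

lemma codim_transfer:
  assumes V: "finite V" "graded_gens V G" and W: "finite W" "graded_gens W G'"
    and f: "mlinear f"
    and sub: "f ` part V K G n \<subseteq> part W K' G' n"
    and gen: "forms W n \<subseteq> mp.span (part W K' G' n \<union> f ` forms V n)"
    and c: "codim_le V K G n c"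
  shows "codim_le W K' G' n c"
proof -
  obtain E where E: "finite E" "card E \<le> c" "forms V n \<subseteq> mp.span (part V K G n \<union> E)"
    using codim_leE[OF V c] by metis
  let ?S = "mp.span (part W K' G' n \<union> f ` E)"
  have "f ` forms V n \<subseteq> f ` mp.span (part V K G n \<union> E)" using E(3) by blast
  also have "\<dots> = mp.span (f ` part V K G n \<union> f ` E)"
    by (simp add: module_hom.span_image[OF f, symmetric] image_Un)
  also have "\<dots> \<subseteq> ?S" using sub by (intro mp.span_mono) auto
  finally have "f ` forms V n \<subseteq> ?S" .
  moreover have "part W K' G' n \<subseteq> ?S" by (auto intro: mp.span_base)
  ultimately have "mp.span (part W K' G' n \<union> f ` forms V n) \<subseteq> ?S"
    by (intro mp.span_minimal) auto
  then have "forms W n \<subseteq> ?S" using gen by blast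
  moreover have "card (f ` E) \<le> c" using card_image_le[OF E(1), of f] E(2) by simp
  ultimately show ?thesis using E(1) by (intro codim_leI[OF W, of "f ` E"]) auto
qed

lemma image_part_subset:
  assumes f: "mlinear f"
    and "\<And>m. m \<in> mons V n \<Longrightarrow> keys m \<notin> K \<Longrightarrow> f (mon m) \<in> part W K' G' n"
    and "\<And>g d m. (g, d) \<in> G \<Longrightarrow> d \<le> n \<Longrightarrow> m \<in> mons V (n - d) \<Longrightarrow> f (g * mon m) \<in> part W K' G' n"
  shows "f ` part V K G n \<subseteq> part W K' G' n"
proof safe
  fix p assume "p \<in> part V K G n"
  then show "f p \<in> part W K' G' n"
  proof (induction rule: part_induct)
    case (gen g d m)
    then show ?case by (rule assms(3))
  next
    case (monomial m)
    then show ?case by (rule assms(2))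
  qed (simp_all only: module_hom.add[OF f] module_hom.scale[OF f] module_hom.zero[OF f]
        part_0 part_add part_scale)
qed

section \<open>From the link to the star\<close>

definition star :: "'v set \<Rightarrow> 'v set set \<Rightarrow> 'v set set" where
  "star F S = {T \<in> S. T \<union> F \<in> S}"

lemma linear_forms_mono: "W \<subseteq> V \<Longrightarrow> linear_forms W \<theta> \<Longrightarrow> linear_forms V \<theta>"
  using forms_mono[of W V 1] by (auto simp: linear_forms_def)

context
  fixes S :: "'v set set" and F :: "'v set" and \<theta> :: "nat \<Rightarrow> 'v mpoly" and f :: "nat \<Rightarrow> 'v" and d k :: nat
  assumes S: "simplicial_complex S" and F: "F \<in> S"
    and f: "bij_betw f {..<k} F" and \<theta>: "linear_forms (vertices (link F S)) \<theta>"
begin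

text \<open>The star is the join of the simplex \<open>F\<close> with the link, so dividing its face
  ring by the \<open>k\<close> variables of \<open>F\<close> leaves that of the link. These
  variables are inserted after the \<open>d\<close> parameters of the link, and the Lefschetz
  element moves from position \<open>d\<close> to \<open>d + k\<close>.\<close>

definition star_parameter :: "nat \<Rightarrow> 'v mpoly" where
  "star_parameter i = (if i < d then \<theta> i else if i < d + k then Var (f (i - d)) else \<theta> d)"

lemma vertices_link_subset: "vertices (link F S) \<subseteq> vertices S"
  by (auto simp: vertices_def link_def)

lemma linear_forms_star_parameter: "linear_forms (vertices S) star_parameter"
  unfolding linear_forms_def
proof
  fix i
  have \<theta>': "\<theta> j \<in> forms (vertices S) 1" for j
    using linear_forms_mono[OF vertices_link_subset \<theta>] by (simp add: linear_forms_def)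
  show "star_parameter i \<in> forms (vertices S) 1"
  proof (cases "d \<le> i \<and> i < d + k")
    case True
    then have "f (i - d) \<in> F" using f by (intro bij_betwE[OF f, rule_format]) auto
    then have "f (i - d) \<in> vertices S" using F by (auto simp: vertices_def)
    then show ?thesis using True Var_in_forms by (simp add: star_parameter_def)
  qed (use \<theta>' in \<open>auto simp: star_parameter_def\<close>)
qed

lemma power_gens_star_parameter: "power_gens \<theta> d E \<subseteq> power_gens star_parameter (d + k) E"
proof
  fix x assume "x \<in> power_gens \<theta> d E"
  then consider i where "i < d" "x = (\<theta> i, 1)" | e where "e \<in> E" "x = (\<theta> d ^ e, e)"
    by (auto simp: power_gens_def thetas_def)
  then show "x \<in> power_gens star_parameter (d + k) E"
  proof cases
    case 1
    then have "x = (star_parameter i, 1)" "i < d + k" by (auto simp: star_parameter_def)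
    then show ?thesis by (auto simp: power_gens_def thetas_def)
  next
    case 2
    then have "x = (star_parameter (d + k) ^ e, e)" by (auto simp: star_parameter_def)
    then show ?thesis using 2(1) by (auto simp: power_gens_def)
  qed
qed

lemma Var_in_power_gens_star_parameter:
  assumes "u \<in> F" shows "(Var u, 1) \<in> power_gens star_parameter (d + k) E"
proof -
  obtain j where j: "j < k" "f j = u" using f assms by (auto simp: bij_betw_def)
  then have "(Var u, 1) = (star_parameter (d + j), 1)" by (simp add: star_parameter_def)
  then show ?thesis using j(1) by (auto simp: power_gens_def thetas_def)
qed

text \<open>The transfer map is the inclusion of polynomials. A monomial with a variable outside the
  link either involves \<open>F\<close>, and is a multiple of a parameter, or is not supported on a
  face of the star.\<close>

lemma codim_star_of_link:
  assumes "codim_le (vertices (link F S)) (link F S) (power_gens \<theta> d E) n c"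
  shows "codim_le (vertices S) (star F S) (power_gens star_parameter (d + k) E) n c"
proof -
  let ?W = "vertices S" and ?L = "link F S" and ?G = "power_gens star_parameter (d + k) E"
  let ?P = "part ?W (star F S) ?G"
  have W: "finite ?W" using S by (auto simp: simplicial_complex_def vertices_def)
  note fin = W finite_subset[OF vertices_link_subset W]
  have id_hom: "mlinear (\<lambda>p :: 'v mpoly. p)"
    by unfold_locales (simp_all add: distrib_left distrib_right mult.assoc)
  have m: "mons (vertices ?L) n \<subseteq> mons ?W n" for n by (rule mons_mono[OF vertices_link_subset])
  show ?thesis
  proof (rule codim_transfer[OF fin(2) graded_gens_power_gens[OF \<theta>] fin(1)
        graded_gens_power_gens[OF linear_forms_star_parameter] _ _ _ assms])
    show "mlinear (\<lambda>p :: 'v mpoly. p)"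
      by (rule id_hom)
    show "(\<lambda>p. p) ` part (vertices ?L) ?L (power_gens \<theta> d E) n \<subseteq> ?P n"
    proof (rule image_part_subset[OF id_hom])
      fix m' assume m': "m' \<in> mons (vertices ?L) n" "keys m' \<notin> ?L"
      have "keys m' \<inter> F = {}"
        using m'(1) by (auto simp: mons_def vertices_def link_def)
      then have "keys m' \<notin> star F S" using m'(2) by (auto simp: star_def link_def)
      then show "mon m' \<in> ?P n" using m m'(1) by (intro part_monomial) auto
    next
      fix g e m' assume g: "(g, e) \<in> power_gens \<theta> d E" "e \<le> n" "m' \<in> mons (vertices ?L) (n - e)"
      then have "g * mon m' \<in> ?P (e + (n - e))"
        using power_gens_star_parameter m by (intro part_gen_mon) auto
      then show "g * mon m' \<in> ?P n" using g(2) by simp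
    qed
    show "forms ?W n \<subseteq> mp.span (?P n \<union> (\<lambda>p. p) ` forms (vertices ?L) n)"
      unfolding forms_eq_span[of ?W]
    proof (rule mp.span_minimal, safe)
      fix m' assume m': "m' \<in> mons ?W n"
      show "mon m' \<in> mp.span (?P n \<union> (\<lambda>p. p) ` forms (vertices ?L) n)"
      proof (cases "keys m' \<subseteq> vertices ?L")
        case True
        then have "mon m' \<in> forms (vertices ?L) n" using m' by (simp add: mons_def)
        then show ?thesis by (intro mp.span_base) auto
      next
        case False
        have "mon m' \<in> ?P n"
        proof (cases "keys m' \<inter> F = {}")
          case True
          have "keys m' \<notin> star F S"
          proof
            assume "keys m' \<in> star F S"
            then have "keys m' \<in> ?L" using True by (auto simp: star_def link_def)
            then show False using \<open>\<not> keys m' \<subseteq> vertices ?L\<close> by (auto simp: vertices_def)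
          qed
          then show ?thesis using m' by (intro part_monomial)
        next
          case False
          then obtain u where u: "u \<in> keys m'" "u \<in> F" by blast
          define m'' where "m'' = m' - single u 1"
          have "lookup m' u \<ge> 1" using u(1) by (simp add: in_keys_iff)
          then have eq: "m' = single u 1 + m''"
            by (intro poly_mapping_eqI) (auto simp: m''_def lookup_add lookup_minus lookup_single when_def)
          have deg: "mdeg m' = Suc (mdeg m'')" using arg_cong[OF eq, of mdeg] by simp
          have "keys m'' \<subseteq> ?W"
            using arg_cong[OF eq, of keys] m' by (auto simp: keys_plus_nat mons_def)
          then have "m'' \<in> mons ?W (mdeg m'')" by (simp add: mons_def)
          then have "Var u * mon m'' \<in> ?P (1 + mdeg m'')"
            by (rule part_gen_mon[OF Var_in_power_gens_star_parameter[OF u(2)]])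
          moreover have "Var u * mon m'' = mon m'" using eq by (simp add: Var_def mult_single)
          moreover have "1 + mdeg m'' = n" using deg m' by (simp add: mons_def)
          ultimately show ?thesis by simp
        qed
        then show ?thesis by (intro mp.span_base) auto
      qed
    qed
  qed
qed

end

section \<open>Interpolation\<close>

text \<open>\<open>l choose i\<close> is polynomial of degree \<open>i\<close> in \<open>l\<close>,
  and the value at \<open>l\<close> of any polynomial of degree below \<open>card Z\<close> is a
  fixed combination of its values on \<open>Z\<close>. The coefficients do not depend on
  \<open>i\<close>, which is what makes them usable on Newton forms.\<close>

lemma lagrange_coefficients:
  fixes Z :: "nat set"
  assumes Z: "finite Z"
  obtains c :: "nat \<Rightarrow> real" where
    "\<And>i. i < card Z \<Longrightarrow> real (l choose i) = (\<Sum>p\<in>Z. c p * real (p choose i))"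
proof -
  define b where "b i = smult (1 / fact i) (\<Prod>j<i. [:- real j, 1:])" for i :: nat
  have b: "poly (b i) (real n) = real (n choose i)" for i n
    by (simp add: b_def poly_prod binomial_gbinomial gbinomial_prod_rev atLeast0LessThan)
  have deg_prod: "degree (\<Prod>q\<in>A. [:- real q, 1:]) = card A" if "finite A" for A :: "nat set"
    using that by (subst degree_prod_eq_sum_degree) auto
  have deg_b: "degree (b i) = i" for i by (simp add: b_def deg_prod)
  define lag where "lag p = smult (1 / (\<Prod>q\<in>Z - {p}. real p - real q)) (\<Prod>q\<in>Z - {p}. [:- real q, 1:])" for p
  have lag: "poly (lag p) (real p') = (if p' = p then 1 else 0)" if "p \<in> Z" "p' \<in> Z" for p p'
    using that Z by (auto simp: lag_def poly_prod)
  have deg_lag: "degree (lag p) < card Z" if "p \<in> Z" for p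
  proof -
    have "degree (lag p) \<le> card (Z - {p})" using Z by (simp add: lag_def deg_prod)
    also have "\<dots> < card Z" using Z that by (intro psubset_card_mono) auto
    finally show ?thesis .
  qed
  show ?thesis
  proof (rule that)
    fix i assume i: "i < card Z"
    \<comment> \<open>The interpolation error: degree below \<open>card Z\<close>, yet zero at every
      point of \<open>Z\<close>.\<close>
    define P where "P = b i - (\<Sum>p\<in>Z. smult (poly (b i) (real p)) (lag p))"
    have "P = 0"
    proof (rule ccontr)
      assume P: "P \<noteq> 0"
      have "degree (\<Sum>p\<in>Z. smult (poly (b i) (real p)) (lag p)) \<le> card Z - 1"
      proof (intro degree_sum_le Z)
        fix p assume "p \<in> Z"
        then show "degree (smult (poly (b i) (real p)) (lag p)) \<le> card Z - 1"
          using degree_smult_le[of "poly (b i) (real p)" "lag p"] deg_lag[of p] by linarith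
      qed
      then have "degree P \<le> card Z - 1"
        unfolding P_def using i by (intro degree_diff_le) (auto simp: deg_b)
      moreover have "real ` Z \<subseteq> {x. poly P x = 0}"
      proof safe
        fix p assume p: "p \<in> Z"
        have "(\<Sum>q\<in>Z. poly (b i) (real q) * poly (lag q) (real p)) = (\<Sum>q\<in>Z. if q = p then poly (b i) (real p) else 0)"
          using p by (intro sum.cong) (auto simp: lag)
        then show "poly P (real p) = 0" using p Z by (simp add: P_def poly_sum)
      qed
      then have "card (real ` Z) \<le> card {x. poly P x = 0}"
        by (intro card_mono poly_roots_finite[OF P])
      then have "card Z \<le> degree P"
        using card_poly_roots_bound[OF P] card_image[of real Z] by (simp add: inj_on_def)
      ultimately show False using i by linarith
    qed
    then have "b i = (\<Sum>p\<in>Z. smult (poly (b i) (real p)) (lag p))" by (simp add: P_def)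
    from arg_cong[OF this, of "\<lambda>q. poly q (real l)"]
    have "poly (b i) (real l) = (\<Sum>p\<in>Z. poly (b i) (real p) * poly (lag p) (real l))"
      by (simp only: poly_sum poly_smult)
    then show "real (l choose i) = (\<Sum>p\<in>Z. poly (lag p) (real l) * real (p choose i))"
      by (simp add: b mult.commute)
  qed
qed

text \<open>Modulo \<open>T\<close>, the sequence \<open>z\<close> is a polynomial of degree less than \<open>e\<close> in the index, in
  Newton form; it vanishes once it has \<open>e\<close> zeros.\<close>

lemma newton_sequence_vanishes:
  fixes z w :: "nat \<Rightarrow> 'v mpoly"
  assumes T: "mp.subspace T"
    and newton: "\<And>l. l \<le> N \<Longrightarrow> z l - (\<Sum>i<e. Const (real (l choose i)) * w i) \<in> T"
    and Z: "Z \<subseteq> {..N}" "\<And>l. l \<in> Z \<Longrightarrow> z l \<in> T" "min e (Suc N) \<le> card Z"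
    and l: "l \<le> N"
  shows "z l \<in> T"
proof -
  define y where "y l = (\<Sum>i<e. Const (real (l choose i)) * w i)" for l
  \<comment> \<open>For \<open>l \<le> N\<close> the binomials with \<open>i > N\<close> vanish, so
    \<open>min e (Suc N)\<close> coefficients remain and as many zeros suffice.\<close>
  have y: "y l = (\<Sum>i<min e (Suc N). Const (real (l choose i)) * w i)" if "l \<le> N" for l
    unfolding y_def using that by (intro sum.mono_neutral_right) auto
  have fZ: "finite Z" using Z(1) finite_subset by blast
  obtain c where c: "\<And>i. i < card Z \<Longrightarrow> real (l choose i) = (\<Sum>p\<in>Z. c p * real (p choose i))"
    using lagrange_coefficients[OF fZ, of l] by metis
  have "y l = (\<Sum>i<min e (Suc N). (\<Sum>p\<in>Z. Const (c p * real (p choose i)) * w i))"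
  proof -
    have "Const (real (l choose i)) * w i = (\<Sum>p\<in>Z. Const (c p * real (p choose i)) * w i)"
      if "i < min e (Suc N)" for i
    proof -
      have "real (l choose i) = (\<Sum>p\<in>Z. c p * real (p choose i))" using that Z(3) by (intro c) linarith
      then show ?thesis by (simp only: mp.scale_sum_left)
    qed
    then show ?thesis unfolding y[OF l] by (intro sum.cong) auto
  qed
  also have "\<dots> = (\<Sum>p\<in>Z. Const (c p) * y p)"
  proof -
    have "(\<Sum>i<min e (Suc N). Const (c p * real (p choose i)) * w i) = Const (c p) * y p" if "p \<in> Z" for p
    proof -
      have "p \<le> N" using that Z(1) by auto
      then show ?thesis unfolding y[OF \<open>p \<le> N\<close>] sum_distrib_left by (simp add: mult.assoc)
    qed
    then show ?thesis by (subst sum.swap) (intro sum.cong, auto)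
  qed
  also have "\<dots> \<in> T"
  proof (intro mp.subspace_sum[OF T] mp.subspace_scale[OF T])
    fix p assume p: "p \<in> Z"
    then have "z p - y p \<in> T" using newton[of p] Z(1) by (auto simp: y_def)
    from mp.subspace_diff[OF T Z(2)[OF p] this] show "y p \<in> T" by simp
  qed
  finally have "y l \<in> T" .
  moreover have "z l - y l \<in> T" using newton[OF l] by (simp add: y_def)
  ultimately have "(z l - y l) + y l \<in> T" using mp.subspace_add[OF T] by blast
  then show ?thesis by simp
qed

section \<open>The degenerate complex\<close>

text \<open>The complex \<open>S \<union> v * star F S\<close>: its face ring modulo \<open>x\<^sub>v ^ card F\<close> is the limit of the
  face rings of the stellar subdivision when the new variable is scaled to zero.\<close>

definition attach_cone :: "'v \<Rightarrow> 'v set set \<Rightarrow> 'v set set \<Rightarrow> 'v set set" where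
  "attach_cone v S Q = {T. T - {v} \<in> S \<and> (v \<in> T \<longrightarrow> T - {v} \<in> Q)}"

locale degeneration =
  fixes W :: "'v set" and v :: 'v and S Q :: "'v set set" and \<theta> :: "nat \<Rightarrow> 'v mpoly" and D d k :: nat
  assumes W: "finite W" "v \<notin> W" and S: "down_closed S" and Q: "down_closed Q" "Q \<subseteq> S"
    and \<theta>: "linear_forms W \<theta>" and D: "D = d + k" and k: "k \<ge> 1"
begin

abbreviation "V \<equiv> insert v W"
abbreviation "C \<equiv> attach_cone v S Q"
abbreviation "xv \<equiv> Var v :: 'v mpoly"
abbreviation "I \<equiv> part W S (thetas \<theta> D)"
abbreviation "J \<equiv> part W Q (thetas \<theta> D)"

lemma finite_V: "finite V"
  using W by simp

lemma linear_forms_V: "linear_forms V \<theta>"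
  using linear_forms_mono[of W V] \<theta> by auto

lemma xv_form: "xv \<in> forms V 1"
  by (rule Var_in_forms) simp

lemma xv_power_form: "xv ^ r \<in> forms V r"
  using forms_power[OF xv_form, of r] by simp

lemma xv_power: "xv ^ r = mon (single v r)"
  by (induction r) (auto simp: Var_def mult_single single_add[symmetric])

lemma mons_V_split:
  assumes "m \<in> mons V n"
  obtains r m' where "r \<le> n" "m' \<in> mons W (n - r)" "mon m = xv ^ r * mon m'"
proof -
  define r where "r = lookup m v"
  define m' where "m' = m - single v r"
  have eq: "m = single v r + m'"
    by (rule poly_mapping_eqI) (auto simp: m'_def r_def lookup_add lookup_minus lookup_single when_def)
  have "v \<notin> keys m'"
    by (simp add: m'_def r_def in_keys_iff lookup_minus)
  then have keys: "keys m' \<subseteq> W"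
    using assms arg_cong[OF eq, of keys] by (auto simp: mons_def keys_plus_nat)
  have deg: "n = r + mdeg m'" using assms arg_cong[OF eq, of mdeg] by (simp add: mons_def)
  show ?thesis
  proof (rule that)
    show "r \<le> n" "m' \<in> mons W (n - r)" using deg keys by (auto simp: mons_def)
    show "mon m = xv ^ r * mon m'" using eq by (simp add: xv_power mult_single)
  qed
qed

context
  fixes G :: "('v mpoly \<times> nat) set"
  assumes G: "thetas \<theta> D \<subseteq> G" "((- xv) ^ k, k) \<in> G"
begin

abbreviation "T \<equiv> part V C G"

text \<open>\<open>G\<close> may contain further generators, so that the same inclusions serve both
  the dimension bound and the surjectivity argument.\<close>

lemma I_subset_T: "I n \<subseteq> T n"
proof
  fix p assume "p \<in> I n"
  then show "p \<in> T n"
  proof (induction rule: part_induct)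
    case (monomial m)
    then have "v \<notin> keys m" using W(2) by (auto simp: mons_def)
    then have "keys m \<notin> C" using monomial(2) by (simp add: attach_cone_def)
    then show ?case using monomial(1) mons_mono[of W V n] by (intro part_monomial) auto
  next
    case (gen g e m)
    then have "(g, e) \<in> G" "m \<in> mons V (n - e)" using G(1) mons_mono[of W V "n - e"] by auto
    then show ?case using part_gen_mon[of g e G m V "n - e" C] gen(2) by simp
  qed (simp_all only: part_0 part_add part_scale)
qed

text \<open>Faces of \<open>C\<close> through \<open>v\<close> are cones over faces of
  \<open>Q\<close>, so after multiplication by \<open>x_v\<close> the relations of \<open>Q\<close>
  hold, not just those of \<open>S\<close>. This needs \<open>r \<ge> 1\<close>.\<close>

lemma J_subset_T:
  assumes r: "r \<ge> 1" and p: "p \<in> J n"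
  shows "xv ^ r * p \<in> T (r + n)"
  using p
proof (induction rule: part_induct)
  case zero
  show ?case by (simp add: part_0)
next
  case (add p q)
  then show ?case by (simp only: distrib_left part_add)
next
  case (scale c p)
  have "xv ^ r * (Const c * p) = Const c * (xv ^ r * p)" by (rule mult.left_commute)
  then show ?case using scale by (simp only: part_scale)
next
  case (monomial m)
  have "v \<notin> keys m" using monomial(1) W(2) by (auto simp: mons_def)
  moreover have "keys (single v r + m) = insert v (keys m)"
    using r by (simp add: keys_plus_nat)
  ultimately have "keys (single v r + m) \<notin> C"
    using monomial(2) by (simp add: attach_cone_def)
  moreover have "single v r + m \<in> mons V (r + n)"
    using monomial(1) by (auto simp: mons_def keys_plus_nat split: if_splits)
  ultimately have "mon (single v r + m) \<in> T (r + n)" by (intro part_monomial)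
  then show ?case by (simp add: xv_power mult_single)
next
  case (gen g e m)
  have "mon m \<in> forms V (n - e)" using gen(3) mons_mono[of W V "n - e"] by auto
  then have "xv ^ r * mon m \<in> forms V (r + (n - e))" by (rule forms_mult[OF xv_power_form])
  then have "g * (xv ^ r * mon m) \<in> T (e + (r + (n - e)))"
    using gen(1) G(1) by (intro part_gen_forms) auto
  then show ?case using gen(2) by (simp add: mult.left_commute)
qed

lemma xv_power_in_T:
  assumes "r \<ge> k" "p \<in> forms V n"
  shows "xv ^ r * p \<in> T (r + n)"
proof -
  obtain j where j: "r = k + j" using assms(1) le_Suc_ex by blast
  have "Const ((- 1) ^ k) * (xv ^ j * p) \<in> forms V (j + n)"
    by (intro mp.subspace_scale subspace_forms forms_mult xv_power_form assms(2))
  then have "(- xv) ^ k * (Const ((- 1) ^ k) * (xv ^ j * p)) \<in> T (k + (j + n))"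
    by (rule part_gen_forms[OF G(2)])
  moreover have "(- xv) ^ k * Const ((- 1) ^ k) = xv ^ k"
  proof -
    have "(- xv) ^ k * Const ((- 1) ^ k) = ((- xv) * Const (- 1)) ^ k"
      by (simp only: power_mult_distrib Const_power)
    then show ?thesis by simp
  qed
  ultimately show ?thesis using j by (simp add: power_add mult.assoc[symmetric] add.assoc)
qed

text \<open>Sort monomials by their power \<open>j\<close> of \<open>x_v\<close>:
  \<open>j = 0\<close> is controlled by \<open>S\<close> in degree \<open>n\<close>,
  \<open>1 \<le> j < k\<close> by \<open>Q\<close> in degree \<open>n - j\<close>, and
  \<open>j \<ge> k\<close> lies in the ideal. This mirrors the formula for the h-polynomial of the
  subdivision.\<close>

lemma codim_degeneration:
  assumes gG: "graded_gens V G" and cS: "codim_le W S (thetas \<theta> D) n cS"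
    and cQ: "\<And>j. codim_le W Q (thetas \<theta> D) j (cQ j)"
  shows "codim_le V C G n (cS + (\<Sum>j\<in>{j\<in>{1..<k}. j \<le> n}. cQ (n - j)))"
proof -
  let ?A = "{j\<in>{1..<k}. j \<le> n}"
  obtain ES where ES: "finite ES" "card ES \<le> cS" "forms W n \<subseteq> mp.span (I n \<union> ES)"
    using codim_leE[OF W(1) graded_gens_thetas[OF \<theta>] cS] by metis
  have "\<forall>j. \<exists>E. finite E \<and> card E \<le> cQ j \<and> forms W j \<subseteq> mp.span (J j \<union> E)"
    using codim_leE[OF W(1) graded_gens_thetas[OF \<theta>] cQ] by metis
  then obtain EQ where EQ: "\<And>j. finite (EQ j)" "\<And>j. card (EQ j) \<le> cQ j"
    "\<And>j. forms W j \<subseteq> mp.span (J j \<union> EQ j)" by metis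
  let ?E = "ES \<union> (\<Union>j\<in>?A. (\<lambda>p. xv ^ j * p) ` EQ (n - j))"
  have fin: "finite ?E" using ES(1) EQ(1) by auto
  have "card ?E \<le> card ES + (\<Sum>j\<in>?A. card ((\<lambda>p. xv ^ j * p) ` EQ (n - j)))"
    by (rule order_trans[OF card_Un_le add_left_mono[OF card_UN_le]]) simp
  also have "\<dots> \<le> cS + (\<Sum>j\<in>?A. cQ (n - j))"
    by (intro add_mono ES(2) sum_mono order_trans[OF card_image_le[OF EQ(1)] EQ(2)])
  finally have card: "card ?E \<le> cS + (\<Sum>j\<in>?A. cQ (n - j))" .
  let ?P = "mp.span (T n \<union> ?E)"
  have "forms V n \<subseteq> ?P"
    unfolding forms_eq_span[of V]
  proof (rule mp.span_minimal, safe)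
    fix m assume "m \<in> mons V n"
    then obtain r m' where m: "r \<le> n" "m' \<in> mons W (n - r)" "mon m = xv ^ r * mon m'"
      by (rule mons_V_split)
    have m'W: "mon m' \<in> forms W (n - r)" using m(2) by simp
    consider "r = 0" | "r \<in> ?A" | "r \<ge> k" using m(1) by fastforce
    then show "mon m \<in> ?P"
    proof cases
      case 1
      then have "mon m \<in> mp.span (I n \<union> ES)" using ES(3) m'W m(3) by auto
      moreover have "mp.span (I n \<union> ES) \<subseteq> ?P" using I_subset_T by (intro mp.span_mono) auto
      ultimately show ?thesis by blast
    next
      case 2
      have "mon m' \<in> mp.span (J (n - r) \<union> EQ (n - r))" using EQ(3) m'W by blast
      then have "mon m \<in> (\<lambda>p. xv ^ r * p) ` mp.span (J (n - r) \<union> EQ (n - r))" using m(3) by simp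
      also have "\<dots> = mp.span ((\<lambda>p. xv ^ r * p) ` (J (n - r) \<union> EQ (n - r)))"
        by (rule module_hom.span_image[OF linear_mult[folded module_hom_iff_linear], symmetric])
      also have "\<dots> \<subseteq> ?P"
      proof (rule mp.span_mono)
        have JT: "xv ^ r * p \<in> T n" if "p \<in> J (n - r)" for p
          using J_subset_T[of r p "n - r"] that 2 m(1) by simp
        show "(\<lambda>p. xv ^ r * p) ` (J (n - r) \<union> EQ (n - r)) \<subseteq> T n \<union> ?E"
          unfolding image_Un
        proof (intro Un_mono)
          show "(\<lambda>p. xv ^ r * p) ` J (n - r) \<subseteq> T n" using JT by (intro image_subsetI)
          have "(\<lambda>p. xv ^ r * p) ` EQ (n - r) \<subseteq> (\<Union>j\<in>?A. (\<lambda>p. xv ^ j * p) ` EQ (n - j))"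
            by (rule UN_upper[OF 2])
          then show "(\<lambda>p. xv ^ r * p) ` EQ (n - r) \<subseteq> ?E" by (rule le_supI2)
        qed
      qed
      finally show ?thesis .
    next
      case 3
      have "mon m' \<in> forms V (n - r)" by (rule subsetD[OF forms_mono[OF subset_insertI] m'W])
      then have "mon m \<in> T (r + (n - r))" using xv_power_in_T[OF 3] m(3) by simp
      then show ?thesis using m(1) by (intro mp.span_base) simp
    qed
  qed
  then show ?thesis by (rule codim_leI[OF finite_V gG fin card])
qed

text \<open>Surjectivity of the power \<open>e = D - 2 i\<close> of \<open>y = \<omega> - x\<^sub>v\<close> in degree \<open>D - i = Suc n\<close>. On the
  multiples of \<open>x\<^sub>v\<close> one decomposes the star into strings of primitive elements \<open>q\<close> of
  degree \<open>j\<close>, with \<open>\<omega> ^ (d - 2 j + 1) q = 0\<close>. Since \<open>\<omega> = x\<^sub>v + y\<close>, the sequence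
  \<open>x\<^sub>v ^ (N - l) \<omega> ^ l q\<close> is in Newton form modulo \<open>y ^ e\<close>, and it has enough zeros.\<close>

context
  fixes i e n :: nat and \<omega> y :: "'v mpoly"
  assumes \<omega>: "\<omega> \<in> forms W 1" and y: "y = \<omega> - xv" and Gy: "(y ^ e, e) \<in> G"
    and e: "D = e + 2 * i" and n: "Suc n = D - i"
    and top: "\<And>j. d < j \<Longrightarrow> J j = forms W j"
    and surj: "\<And>j. j \<le> d div 2 \<Longrightarrow> part W Q (insert (\<omega> ^ (d - 2 * j), d - 2 * j) (thetas \<theta> D)) (d - j) = forms W (d - j)"
begin

lemma y_form: "y \<in> forms V 1"
  unfolding y using \<omega> forms_mono[of W V 1] by (intro mp.subspace_diff subspace_forms xv_form) auto

lemma y_power_form: "y ^ l \<in> forms V l"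
  using forms_power[OF y_form, of l] by simp

lemma \<omega>_power_form: "\<omega> ^ l \<in> forms W l"
  using forms_power[OF \<omega>, of l] by simp

lemma in_forms_V: "p \<in> forms W j \<Longrightarrow> p \<in> forms V j"
  by (rule subsetD[OF forms_mono[OF subset_insertI]])

lemma J_mult: "p \<in> J a \<Longrightarrow> q \<in> forms W j \<Longrightarrow> p * q \<in> J (a + j)"
  by (rule part_mult[OF Q(1)])

lemma primitive_string:
  assumes q: "q \<in> forms W j" and j: "2 * j \<le> d" and prim: "\<omega> ^ (d - 2 * j + 1) * q \<in> J (d - j + 1)"
    and rl: "r + l + j = n"
  shows "xv ^ Suc r * (\<omega> ^ l * q) \<in> T (Suc n)"
proof -
  define N where "N = n - j"
  \<comment> \<open>Two reasons for \<open>z l\<close> to vanish: from index \<open>a\<close> on,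
    \<open>\<omega> ^ l * q\<close> is zero modulo \<open>J\<close> because \<open>q\<close> is
    primitive, and as long as \<open>l + c \<le> N\<close> the power of \<open>x_v\<close> is at
    least \<open>k\<close>.\<close>
  define a where "a = d - 2 * j + 1"
  define c where "c = k - 1"
  have Nn: "N + j = n" using rl by (simp add: N_def)
  \<comment> \<open>The exponents balance:
    \<open>(D - 2 i) + (d - 2 j + 1) + (k - 1) = 2 (D - i - j)\<close> since
    \<open>D = d + k\<close>, and \<open>D - i - j = N + 1\<close>.\<close>
  have sum: "e + a + c = 2 * N + 2"
    using Nn e n j D k by (simp add: a_def c_def)
  define z where "z l = xv ^ Suc (N - l) * (\<omega> ^ l * q)" for l
  define w where "w i = xv * (y ^ i * xv ^ (N - i) * q)" for i
  have "z l \<in> T (Suc n)" if "l \<le> N" for l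
  proof (rule newton_sequence_vanishes[OF subspace_part])
    show "l \<le> N" by (rule that)
    let ?Z = "{l. l \<le> N \<and> (a \<le> l \<or> l + c \<le> N)}"
    show "?Z \<subseteq> {..N}" by auto
    \<comment> \<open>Indices up to \<open>N\<close> missing from \<open>?Z\<close> satisfy
      \<open>N + 1 - c \<le> l < a\<close>. If such a gap exists, at least
      \<open>2 (N + 1) - a - c = e\<close> zeros remain; otherwise all \<open>N + 1\<close> indices
      are zeros.\<close>
    show "min e (Suc N) \<le> card ?Z"
    proof -
      have "{..N} \<subseteq> ?Z \<union> {Suc N - c..<min a (Suc N)}" by auto
      then have "card {..N} \<le> card (?Z \<union> {Suc N - c..<min a (Suc N)})" by (intro card_mono) auto
      also have "\<dots> \<le> card ?Z + card {Suc N - c..<min a (Suc N)}" by (rule card_Un_le)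
      finally have "Suc N \<le> card ?Z + (min a (Suc N) - (Suc N - c))" by simp
      then show ?thesis using sum by linarith
    qed
    show "z l \<in> T (Suc n)" if "l \<in> ?Z" for l
    proof -
      from that have l: "l \<le> N" and "a \<le> l \<or> l + c \<le> N" by auto
      then show ?thesis
      proof (elim disjE)
        assume "a \<le> l"
        then obtain b where b: "l = a + b" using le_Suc_ex by blast
        have "(\<omega> ^ a * q) * \<omega> ^ b \<in> J (d - j + 1 + b)"
          using prim unfolding a_def by (rule J_mult[OF _ \<omega>_power_form])
        moreover have "(\<omega> ^ a * q) * \<omega> ^ b = \<omega> ^ l * q" by (simp add: b power_add ac_simps)
        moreover have "d - j + 1 + b = l + j" using b j by (simp add: a_def)
        ultimately have "\<omega> ^ l * q \<in> J (l + j)" by simp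
        then have "z l \<in> T (Suc (N - l) + (l + j))" unfolding z_def by (intro J_subset_T) auto
        then show ?thesis using l Nn by simp
      next
        assume "l + c \<le> N"
        then have "k \<le> Suc (N - l)" using k by (simp add: c_def)
        moreover have "\<omega> ^ l * q \<in> forms V (l + j)" by (intro in_forms_V forms_mult \<omega>_power_form q)
        ultimately have "z l \<in> T (Suc (N - l) + (l + j))" unfolding z_def by (rule xv_power_in_T)
        then show ?thesis using l Nn by simp
      qed
    qed
    show "z l - (\<Sum>i<e. Const (real (l choose i)) * w i) \<in> T (Suc n)" if l: "l \<le> N" for l
    proof -
      have of_nat: "(of_nat c :: 'v mpoly) = Const (real c)" for c
        by (induction c) auto
      have term_eq: "of_nat (l choose i) * y ^ i * xv ^ (l - i) * (xv ^ Suc (N - l) * q)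
          = Const (real (l choose i)) * w i" if "i \<le> l" for i
      proof -
        have "N - i = (l - i) + (N - l)" using that l by simp
        then have "xv ^ (l - i) * xv ^ Suc (N - l) = xv * xv ^ (N - i)"
          by (simp add: power_add mult.left_commute)
        then have "of_nat (l choose i) * y ^ i * xv ^ (l - i) * (xv ^ Suc (N - l) * q)
          = Const (real (l choose i)) * (y ^ i * (xv * xv ^ (N - i)) * q)"
          by (simp only: of_nat mult.assoc) (simp only: mult.assoc[symmetric])
        then show ?thesis by (simp add: w_def ac_simps)
      qed
      have "\<omega> = y + xv" by (simp add: y)
      then have "z l = (\<Sum>i\<le>l. of_nat (l choose i) * y ^ i * xv ^ (l - i)) * (xv ^ Suc (N - l) * q)"
        unfolding z_def binomial_ring[symmetric] by (simp add: ac_simps)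
      also have "\<dots> = (\<Sum>i\<le>l. Const (real (l choose i)) * w i)"
        unfolding sum_distrib_right by (intro sum.cong refl term_eq) simp
      also have "\<dots> = (\<Sum>i\<in>{..l} \<inter> {..<e}. Const (real (l choose i)) * w i)
          + (\<Sum>i\<in>{..l} - {..<e}. Const (real (l choose i)) * w i)"
        by (rule sum.Int_Diff) simp
      also have "(\<Sum>i\<in>{..l} \<inter> {..<e}. Const (real (l choose i)) * w i) = (\<Sum>i<e. Const (real (l choose i)) * w i)"
        by (intro sum.mono_neutral_left) (auto simp: not_le)
      finally have "z l - (\<Sum>i<e. Const (real (l choose i)) * w i)
          = (\<Sum>i\<in>{..l} - {..<e}. Const (real (l choose i)) * w i)" by simp
      \<comment> \<open>The terms left from the binomial expansion of \<open>(y + x_v) ^ l\<close>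
        contain \<open>y ^ e\<close>, a generator of the ideal.\<close>
      also have "\<dots> \<in> T (Suc n)"
      proof (intro part_sum part_scale)
        fix i assume "i \<in> {..l} - {..<e}"
        then have i: "e \<le> i" "i \<le> N" using l by auto
        have "y ^ (i - e) * (xv ^ Suc (N - i) * q) \<in> forms V ((i - e) + (Suc (N - i) + j))"
          by (rule forms_mult[OF y_power_form forms_mult[OF xv_power_form in_forms_V[OF q]]])
        then have "y ^ e * (y ^ (i - e) * (xv ^ Suc (N - i) * q)) \<in> T (e + ((i - e) + (Suc (N - i) + j)))"
          by (rule part_gen_forms[OF Gy])
        moreover have "y ^ e * (y ^ (i - e) * (xv ^ Suc (N - i) * q)) = w i"
        proof -
          have "y ^ e * y ^ (i - e) = y ^ i" using i(1) by (simp add: power_add[symmetric])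
          then show ?thesis by (simp add: w_def mult.assoc[symmetric])
        qed
        moreover have "e + ((i - e) + (Suc (N - i) + j)) = Suc n" using i Nn by simp
        ultimately show "w i \<in> T (Suc n)" by simp
      qed
      finally show ?thesis .
    qed
  qed
  moreover have "l \<le> N" "N - l = r" using rl by (auto simp: N_def)
  ultimately show ?thesis unfolding z_def by metis
qed

text \<open>A Lefschetz decomposition that uses surjectivity only: by induction on the degree
  \<open>j\<close>, every form is, modulo \<open>J\<close>, a combination of powers of
  \<open>\<omega>\<close> applied to primitive forms of degree at most \<open>d / 2\<close>, and
  these are handled by \<open>primitive_string\<close>.\<close>

lemma multiple_of_xv_in_T:
  "p \<in> forms W j \<Longrightarrow> r + l + j = n \<Longrightarrow> xv ^ Suc r * (\<omega> ^ l * p) \<in> T (Suc n)"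
proof (induction j arbitrary: p r l rule: less_induct)
  case (less j)
  have J_case: "xv ^ Suc r * (\<omega> ^ l' * p') \<in> T (Suc n)" if "p' \<in> J j'" "r + l' + j' = n" for p' j' l'
  proof -
    have "\<omega> ^ l' * p' \<in> J (j' + l')"
      using J_mult[OF that(1) \<omega>_power_form[of l']] by (simp only: mult.commute)
    then have "xv ^ Suc r * (\<omega> ^ l' * p') \<in> T (Suc r + (j' + l'))" by (intro J_subset_T) auto
    moreover have "Suc r + (j' + l') = Suc n" using that(2) by simp
    ultimately show ?thesis by simp
  qed
  consider "d < j" | "2 * j \<le> d" | "d < 2 * j" "j \<le> d" by linarith
  then show ?case
  proof cases
    case 1
    then show ?thesis using J_case[of p j l] top less.prems by simp
  next
    case 2
    show ?thesis
    proof (cases j)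
      \<comment> \<open>In degree 0 every form is primitive, since the product has degree
        \<open>d + 1\<close>, where the quotient vanishes.\<close>
      case 0
      have "\<omega> ^ (d - 2 * j + 1) * p \<in> forms W (d - 2 * j + 1 + j)"
        by (intro forms_mult \<omega>_power_form less.prems(1))
      then have "\<omega> ^ (d - 2 * j + 1) * p \<in> J (d - j + 1)" using top[of "d - j + 1"] 0 by simp
      then show ?thesis by (rule primitive_string[OF less.prems(1) 2 _ less.prems(2)])
    next
      case (Suc j')
      \<comment> \<open>The surjection starting in degree \<open>j - 1\<close> ends in degree
        \<open>d - j + 1\<close>, exactly where \<open>\<omega> ^ (d - 2 * j + 1) * p\<close> lies.
        A preimage \<open>b\<close> makes \<open>p - \<omega> * b\<close> primitive, and
        \<open>\<omega> * b\<close> is covered by induction.\<close>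
      have ex: "d - 2 * j' = d - 2 * j + 2" "d - j' = d - j + 1" "j' \<le> d div 2" using 2 Suc by auto
      have "\<omega> ^ (d - 2 * j + 1) * p \<in> forms W (d - 2 * j + 1 + j)"
        by (intro forms_mult \<omega>_power_form less.prems(1))
      moreover have "d - 2 * j + 1 + j = d - j + 1" using 2 by simp
      ultimately have "\<omega> ^ (d - 2 * j + 1) * p \<in> part W Q (insert (\<omega> ^ (d - 2 * j'), d - 2 * j') (thetas \<theta> D)) (d - j')"
        using surj[OF ex(3)] ex(2) by simp
      moreover have "d - j' = (d - 2 * j') + j'" using ex by simp
      ultimately obtain a b where ab: "a \<in> J (d - j')" "b \<in> forms W j'"
        "\<omega> ^ (d - 2 * j + 1) * p = a + \<omega> ^ (d - 2 * j') * b"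
        using part_insert_decomp[of "\<omega> ^ (d - 2 * j + 1) * p" W Q "\<omega> ^ (d - 2 * j')" "d - 2 * j'" "thetas \<theta> D" j']
        by metis
      have "\<omega> * b \<in> forms W (1 + j')" by (rule forms_mult[OF \<omega> ab(2)])
      then have q: "p - \<omega> * b \<in> forms W j"
        using less.prems(1) Suc by (intro mp.subspace_diff[OF subspace_forms]) auto
      have "\<omega> ^ (d - 2 * j + 1) * (\<omega> * b) = \<omega> ^ (d - 2 * j') * b"
        unfolding ex(1) by (simp add: mult.assoc mult.left_commute)
      then have "\<omega> ^ (d - 2 * j + 1) * (p - \<omega> * b) = a"
        using ab(3) by (simp only: right_diff_distrib add_diff_cancel_right')
      then have "\<omega> ^ (d - 2 * j + 1) * (p - \<omega> * b) \<in> J (d - j + 1)" using ab(1) ex(2) by simp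
      then have 1: "xv ^ Suc r * (\<omega> ^ l * (p - \<omega> * b)) \<in> T (Suc n)"
        by (rule primitive_string[OF q 2 _ less.prems(2)])
      have "xv ^ Suc r * (\<omega> ^ Suc l * b) \<in> T (Suc n)"
        using less.prems(2) Suc by (intro less.IH[OF _ ab(2)]) auto
      from part_add[OF 1 this] show ?thesis by (simp add: algebra_simps)
    qed
  next
    case 3
    \<comment> \<open>The mirror degree: \<open>\<omega> ^ (d - 2 * j')\<close> maps degree
      \<open>j'\<close> onto degree \<open>j\<close> modulo \<open>J\<close>, which moves
      \<open>p\<close> below the middle.\<close>
    define j' where "j' = d - j"
    have j': "j' < j" "j' \<le> d div 2" "d - j' = j" "j = (d - 2 * j') + j'"
      using 3 unfolding j'_def by linarith+
    have "p \<in> part W Q (insert (\<omega> ^ (d - 2 * j'), d - 2 * j') (thetas \<theta> D)) ((d - 2 * j') + j')"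
      unfolding j'(4)[symmetric] using surj[OF j'(2)] less.prems(1) unfolding j'(3) by blast
    then obtain a b where ab: "a \<in> J ((d - 2 * j') + j')" "b \<in> forms W j'" "p = a + \<omega> ^ (d - 2 * j') * b"
      by (rule part_insert_decomp)
    have 1: "xv ^ Suc r * (\<omega> ^ l * a) \<in> T (Suc n)"
      using ab(1) j'(4) less.prems(2) by (intro J_case[of a j]) auto
    have "xv ^ Suc r * (\<omega> ^ (l + (d - 2 * j')) * b) \<in> T (Suc n)"
      using less.prems(2) j'(4) by (intro less.IH[OF j'(1) ab(2)]) auto
    from part_add[OF 1 this] show ?thesis using ab(3) by (simp add: algebra_simps power_add)
  qed
qed

lemma xv_mult_in_T:
  assumes "p \<in> forms V n" shows "xv * p \<in> T (Suc n)"
  using assms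
proof (induction rule: forms_induct)
  case (mon m)
  then obtain r m' where m: "r \<le> n" "m' \<in> mons W (n - r)" "mon m = xv ^ r * mon m'"
    by (rule mons_V_split)
  have "xv ^ Suc r * (\<omega> ^ 0 * mon m') \<in> T (Suc n)"
    using m by (intro multiple_of_xv_in_T[of "mon m'" "n - r"]) auto
  then show ?case using m(3) by (simp add: mult.assoc)
next
  case (scale c p)
  then show ?case using part_scale[of "xv * p"] by (simp only: mult.left_commute)
qed (simp_all add: part_0 distrib_left part_add)

text \<open>Multiples of \<open>x_v\<close> are settled by \<open>xv_mult_in_T\<close>. Modulo
  these, \<open>y\<close> equals \<open>\<omega>\<close>, and surjectivity is that of
  \<open>S\<close>.\<close>

lemma surjective_degeneration:
  assumes surjS: "part W S (insert (\<omega> ^ e, e) (thetas \<theta> D)) (D - i) = forms W (D - i)"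
  shows "forms V (D - i) \<subseteq> T (D - i)"
proof
  have Dn: "D - i = Suc n" using n by simp
  fix p assume "p \<in> forms V (D - i)"
  then show "p \<in> T (D - i)"
  proof (induction rule: forms_induct)
    case (mon m)
    then obtain r m' where m: "r \<le> D - i" "m' \<in> mons W (D - i - r)" "mon m = xv ^ r * mon m'"
      by (rule mons_V_split)
    show ?case
    proof (cases r)
      case 0
      have ei: "D - i = e + i" using e by simp
      have "mon m' \<in> part W S (insert (\<omega> ^ e, e) (thetas \<theta> D)) (e + i)"
        using surjS m(2) 0 ei by simp
      then obtain a b where ab: "a \<in> I (e + i)" "b \<in> forms W i" "mon m' = a + \<omega> ^ e * b"
        by (rule part_insert_decomp)
      have a: "a \<in> T (D - i)" using ab(1) I_subset_T ei by auto
      have b: "b \<in> forms V i" by (rule in_forms_V[OF ab(2)])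
      then have yb: "y ^ e * b \<in> T (D - i)" using part_gen_forms[OF Gy] ei by simp
      \<comment> \<open>Replacing \<open>\<omega> ^ e\<close> by the generator \<open>y ^ e\<close>
        costs a multiple of \<open>\<omega> - y = x_v\<close>.\<close>
      have "\<omega> ^ e - y ^ e = xv * (\<Sum>l<e. y ^ (e - Suc l) * \<omega> ^ l)"
        using power_diff_sumr2[of \<omega> e y] by (simp add: y)
      then have "(\<omega> ^ e - y ^ e) * b = (\<Sum>l<e. xv * (y ^ (e - Suc l) * \<omega> ^ l * b))"
        by (simp add: sum_distrib_left sum_distrib_right mult.assoc)
      also have "\<dots> \<in> T (D - i)"
        unfolding Dn
      proof (intro part_sum xv_mult_in_T)
        fix l assume "l \<in> {..<e}"
        then have "e - Suc l + l + i = n" using ei Dn by simp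
        moreover have "y ^ (e - Suc l) * \<omega> ^ l * b \<in> forms V (e - Suc l + l + i)"
          by (rule forms_mult[OF forms_mult[OF y_power_form in_forms_V[OF \<omega>_power_form]] b])
        ultimately show "y ^ (e - Suc l) * \<omega> ^ l * b \<in> forms V n" by simp
      qed
      finally have "a + (y ^ e * b + (\<omega> ^ e - y ^ e) * b) \<in> T (D - i)"
        using a yb by (intro part_add)
      then have "a + \<omega> ^ e * b \<in> T (D - i)" by (simp add: left_diff_distrib)
      then show ?thesis using ab(3) m(3) 0 by simp
    next
      case (Suc r')
      have "xv ^ r' * mon m' \<in> forms V (r' + (D - i - r))"
        using m(2) in_forms_V[of "mon m'" "D - i - r"] by (intro forms_mult xv_power_form) simp
      moreover have "r' + (D - i - r) = n" using Suc m(1) Dn by simp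
      ultimately have "xv * (xv ^ r' * mon m') \<in> T (Suc n)" by (intro xv_mult_in_T) simp
      then show ?thesis using m(3) Suc Dn by (simp add: mult.assoc)
    qed
  qed (simp_all only: part_0 part_add part_scale)
qed

end

end

end

section \<open>Stellar subdivisions\<close>

lemma cdim_eqI:
  assumes "finite K" "\<And>T. T \<in> K \<Longrightarrow> card T \<le> n" "T0 \<in> K" "card T0 = n"
  shows "cdim K = n"
  unfolding cdim_def using assms by (intro cSup_eq_maximum) auto

lemma pure_complex_facet:
  assumes "simplicial_complex S" "pure_complex S" "F \<in> S"
  obtains M where "M \<in> S" "F \<subseteq> M" "card M = cdim S"
proof -
  have "finite {T \<in> S. F \<subseteq> T}" "F \<in> {T \<in> S. F \<subseteq> T}"
    using assms by (auto simp: simplicial_complex_def)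
  from finite_has_maximal2[OF this] obtain M where M: "M \<in> {T \<in> S. F \<subseteq> T}"
    and max: "\<forall>U\<in>{T \<in> S. F \<subseteq> T}. M \<subseteq> U \<longrightarrow> M = U" by (elim bexE conjE)
  have "U = M" if "U \<in> S" "M \<subseteq> U" for U
  proof -
    have "U \<in> {T \<in> S. F \<subseteq> T}" using that M by auto
    from max[rule_format, OF this that(2)] show ?thesis ..
  qed
  then have "card M = cdim S" using assms(2) M unfolding pure_complex_def by simp
  then show ?thesis using M by (intro that[of M]) simp_all
qed

locale stellar_setup =
  fixes S :: "'v set set" and F :: "'v set" and v :: 'v
  assumes S: "simplicial_complex S" and pure: "pure_complex S" and F: "F \<in> S" "F \<noteq> {}"
    and v: "v \<notin> vertices S"
begin

abbreviation "L \<equiv> link F S"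
abbreviation "\<Delta> \<equiv> stellar v F S"
abbreviation "k \<equiv> card F"

lemma S_down: "T \<in> S \<Longrightarrow> U \<subseteq> T \<Longrightarrow> U \<in> S"
  using S by (auto simp: simplicial_complex_def)

lemma finite_S: "finite S" and finite_face: "T \<in> S \<Longrightarrow> finite T"
  using S by (auto simp: simplicial_complex_def)

lemma v_notin: "T \<in> S \<Longrightarrow> v \<notin> T"
  using v by (auto simp: vertices_def)

lemma finite_F: "finite F" and k_pos: "k \<ge> 1"
  using F finite_face[of F] by (auto simp: Suc_le_eq card_gt_0_iff)

text \<open>Removes the joins: a face through \<open>v\<close> splits uniquely into
  \<open>v\<close>, its part in \<open>F\<close> and its part in the link, and that the part in
  \<open>F\<close> is proper is the common condition \<open>\<not> F \<subseteq> T\<close>.\<close>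

lemma stellar_iff:
  "T \<in> \<Delta> \<longleftrightarrow> \<not> F \<subseteq> T \<and> (v \<notin> T \<and> T \<in> S \<or> v \<in> T \<and> (T - {v}) \<union> F \<in> S)"
proof
  assume "T \<in> \<Delta>"
  then consider "T \<in> S" "\<not> F \<subseteq> T"
    | A B G where "T = A \<union> B \<union> G" "A = {} \<or> A = {v}" "B \<subset> F" "G \<in> L"
    unfolding stellar_def complex_join_def by blast
  then show "\<not> F \<subseteq> T \<and> (v \<notin> T \<and> T \<in> S \<or> v \<in> T \<and> (T - {v}) \<union> F \<in> S)"
  proof cases
    case 1
    then show ?thesis using v_notin by blast
  next
    case 2
    have G: "G \<union> F \<in> S" "G \<inter> F = {}" using 2(4) by (auto simp: link_def)
    have vGF: "v \<notin> G \<union> F" by (rule v_notin[OF G(1)])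
    have nF: "\<not> F \<subseteq> T" using 2 G(2) vGF by blast
    from 2(2) show ?thesis
    proof
      assume "A = {}"
      then have "T \<in> S" using 2(1,3) by (intro S_down[OF G(1)]) blast
      then show ?thesis using nF v_notin by blast
    next
      assume "A = {v}"
      then have "v \<in> T" "(T - {v}) \<union> F = G \<union> F" using 2(1,3) vGF by blast+
      then show ?thesis using nF G(1) by simp
    qed
  qed
next
  assume R: "\<not> F \<subseteq> T \<and> (v \<notin> T \<and> T \<in> S \<or> v \<in> T \<and> (T - {v}) \<union> F \<in> S)"
  show "T \<in> \<Delta>"
  proof (cases "v \<in> T")
    case False
    then show ?thesis using R by (simp add: stellar_def)
  next
    case True
    then have T: "(T - {v}) \<union> F \<in> S" "\<not> F \<subseteq> T" using R by auto
    let ?G = "T - {v} - F"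
    have "?G \<in> S" by (rule S_down[OF T(1)]) blast
    moreover have "?G \<union> F \<in> S" using T(1) by (simp add: Un_Diff_cancel2 Un_commute)
    ultimately have G: "?G \<in> L" by (auto simp: link_def)
    have T_eq: "T = ({v} \<union> (T \<inter> F)) \<union> ?G" using True by blast
    have "T \<inter> F \<subset> F" using T(2) by blast
    then have "{v} \<union> (T \<inter> F) \<in> complex_join {{}, {v}} {B. B \<subset> F}"
      unfolding complex_join_def by (intro CollectI exI[of _ "{v}"] exI[of _ "T \<inter> F"]) simp
    then have "T \<in> complex_join (complex_join {{}, {v}} {B. B \<subset> F}) L"
      using G T_eq unfolding complex_join_def[of _ L]
      by (intro CollectI exI[of _ "{v} \<union> (T \<inter> F)"] exI[of _ ?G] conjI)
    then show ?thesis by (simp add: stellar_def)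
  qed
qed

lemma simplicial_stellar: "simplicial_complex \<Delta>"
  unfolding simplicial_complex_def
proof (intro conjI ballI allI impI)
  have fV: "finite (insert v (vertices S))"
    using S by (auto simp: simplicial_complex_def vertices_def)
  have sub: "T \<subseteq> insert v (vertices S)" if "T \<in> \<Delta>" for T
    using that unfolding stellar_iff vertices_def by blast
  then show "finite \<Delta>" using fV by (intro finite_subset[of \<Delta> "Pow (insert v (vertices S))"]) auto
  show "finite T" if "T \<in> \<Delta>" for T using sub[OF that] fV by (rule finite_subset)
  fix T U assume T: "T \<in> \<Delta>" "U \<subseteq> T"
  have "\<not> F \<subseteq> U" using T unfolding stellar_iff by blast
  moreover have "U \<in> S" if "v \<notin> U"
  proof -
    have "U \<subseteq> T \<and> T \<in> S \<or> U \<subseteq> (T - {v}) \<union> F \<and> (T - {v}) \<union> F \<in> S"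
      using T that unfolding stellar_iff by blast
    then show ?thesis using S_down by blast
  qed
  moreover have "(U - {v}) \<union> F \<in> S" if "v \<in> U"
  proof (rule S_down)
    show "(T - {v}) \<union> F \<in> S" using T that unfolding stellar_iff by blast
    show "(U - {v}) \<union> F \<subseteq> (T - {v}) \<union> F" using T(2) by blast
  qed
  ultimately show "U \<in> \<Delta>" unfolding stellar_iff by blast
qed

lemma vertices_stellar_subset: "vertices \<Delta> \<subseteq> insert v (vertices S)"
  unfolding vertices_def
proof
  fix w assume "w \<in> \<Union> \<Delta>"
  then obtain T where "T \<in> \<Delta>" "w \<in> T" by blast
  then show "w \<in> insert v (\<Union> S)" unfolding stellar_iff by blast
qed

lemma v_in_vertices_stellar: "v \<in> vertices \<Delta>"
proof -
  have "{v} \<in> \<Delta>" unfolding stellar_iff using F v_notin[OF F(1)] by auto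
  then show ?thesis by (auto simp: vertices_def)
qed

lemma vertex_in_stellar: "w \<in> vertices S \<Longrightarrow> w \<notin> F \<Longrightarrow> w \<in> vertices \<Delta>"
proof -
  assume w: "w \<in> vertices S" "w \<notin> F"
  then have "{w} \<in> S" using S_down by (auto simp: vertices_def)
  moreover have "\<not> F \<subseteq> {w}" using w(2) F(2) by (metis subset_singletonD singletonI)
  moreover have "v \<notin> {w}" using w(1) v by auto
  ultimately have "{w} \<in> \<Delta>" unfolding stellar_iff by simp
  then show ?thesis by (auto simp: vertices_def)
qed

lemma cdim_stellar: "cdim \<Delta> = cdim S"
proof -
  obtain M where M: "M \<in> S" "F \<subseteq> M" "card M = cdim S"
    by (rule pure_complex_facet[OF S pure F(1)])
  obtain u where u: "u \<in> F" using F(2) by blast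
  \<comment> \<open>A facet of full size: exchange a vertex \<open>u\<close> of \<open>F\<close> for
    \<open>v\<close> in a facet containing \<open>F\<close>.\<close>
  have "insert v (M - {u}) - {v} \<union> F = M" using M(2) u v_notin[OF M(1)] by blast
  moreover have "\<not> F \<subseteq> insert v (M - {u})" using u v_notin[OF F(1)] by blast
  ultimately have T0: "insert v (M - {u}) \<in> \<Delta>" unfolding stellar_iff using M(1) by simp
  have "card (insert v (M - {u})) = card M"
    using u M(2) v_notin[OF M(1)] finite_face[OF M(1)]
    by (metis Diff_iff card_Suc_Diff1 card_insert_disjoint finite_Diff subsetD)
  then have "card (insert v (M - {u})) = cdim S" using M(3) by simp
  moreover have "card T \<le> cdim S" if T: "T \<in> \<Delta>" for T
  proof (cases "v \<in> T")
    case False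
    then show ?thesis using T card_le_cdim[OF finite_S] unfolding stellar_iff by blast
  next
    case True
    then have U: "(T - {v}) \<union> F \<in> S" "\<not> F \<subseteq> T" using T unfolding stellar_iff by blast+
    have fU: "finite ((T - {v}) \<union> F)" by (rule finite_face[OF U(1)])
    \<comment> \<open>Some vertex of \<open>F\<close> is missing from \<open>T\<close>, which makes
      room for \<open>v\<close> in the count.\<close>
    have "T - {v} \<subset> (T - {v}) \<union> F" using U(2) by blast
    then have "card (T - {v}) < card ((T - {v}) \<union> F)" by (rule psubset_card_mono[OF fU])
    also have "\<dots> \<le> cdim S" by (rule card_le_cdim[OF finite_S U(1)])
    finally have "card (T - {v}) < cdim S" .
    moreover have "finite T" using simplicial_stellar T by (simp add: simplicial_complex_def)
    ultimately show ?thesis using card.remove[of T v] True by linarith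
  qed
  moreover have "finite \<Delta>" using simplicial_stellar by (simp add: simplicial_complex_def)
  ultimately show ?thesis using T0 by (intro cdim_eqI)
qed

lemma simplicial_link: "simplicial_complex L"
  unfolding simplicial_complex_def
proof (intro conjI ballI allI impI)
  show "finite L" using finite_S by (simp add: link_def)
  show "finite T" if "T \<in> L" for T using that finite_face by (simp add: link_def)
  fix T U assume T: "T \<in> L" "U \<subseteq> T"
  then have "T \<in> S" "T \<inter> F = {}" "T \<union> F \<in> S" by (auto simp: link_def)
  moreover have "U \<union> F \<subseteq> T \<union> F" using T(2) by blast
  ultimately show "U \<in> L" using T(2) S_down[of T U] S_down[of "T \<union> F" "U \<union> F"] by (auto simp: link_def)
qed

lemma cdim_link: "cdim S = cdim L + k"
proof -
  obtain M where M: "M \<in> S" "F \<subseteq> M" "card M = cdim S"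
    by (rule pure_complex_facet[OF S pure F(1)])
  have "(M - F) \<union> F = M" using M(2) by blast
  then have "M - F \<in> L" using M(1) S_down[of M "M - F"] by (auto simp: link_def)
  moreover have "card (M - F) = cdim S - k" using M(2,3) finite_F by (simp add: card_Diff_subset)
  moreover have "card G \<le> cdim S - k" if "G \<in> L" for G
  proof -
    have G: "G \<union> F \<in> S" "G \<inter> F = {}" using that by (auto simp: link_def)
    then have "card G + k = card (G \<union> F)" using finite_face[OF G(1)] by (simp add: card_Un_disjoint)
    also have "\<dots> \<le> cdim S" by (rule card_le_cdim[OF finite_S G(1)])
    finally show ?thesis by simp
  qed
  moreover have "finite L" using finite_S by (simp add: link_def)
  ultimately have "cdim L = cdim S - k" by (intro cdim_eqI)
  then show ?thesis using card_le_cdim[OF finite_S F(1)] by simp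
qed

section \<open>The h-polynomial of a stellar subdivision\<close>

lemma sum_faces_above_F: "(\<Sum>T\<in>{T\<in>S. F \<subseteq> T}. f T) = (\<Sum>G\<in>L. f (G \<union> F))"
proof (rule sum.reindex_bij_witness[of _ "\<lambda>G. G \<union> F" "\<lambda>T. T - F"])
  fix T assume "T \<in> {T \<in> S. F \<subseteq> T}"
  then have T: "T \<in> S" "F \<subseteq> T" by auto
  then show "(T - F) \<union> F = T" by blast
  then show "T - F \<in> L" using T S_down[of T "T - F"] by (auto simp: link_def)
  show "f (T - F \<union> F) = f T" using \<open>(T - F) \<union> F = T\<close> by simp
qed (auto simp: link_def)

lemma sum_faces_at_v:
  "(\<Sum>T\<in>{T\<in>\<Delta>. v \<in> T}. f T) = (\<Sum>(B, G)\<in>{B. B \<subset> F} \<times> L. f (insert v (B \<union> G)))"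
proof (rule sum.reindex_bij_witness[of _ "\<lambda>(B, G). insert v (B \<union> G)" "\<lambda>T. (T \<inter> F, T - {v} - F)"])
  fix T assume "T \<in> {T \<in> \<Delta>. v \<in> T}"
  then have T: "v \<in> T" "(T - {v}) \<union> F \<in> S" "\<not> F \<subseteq> T" unfolding stellar_iff by blast+
  have eq: "insert v ((T \<inter> F) \<union> (T - {v} - F)) = T" using T(1) by blast
  then show "(case (T \<inter> F, T - {v} - F) of (B, G) \<Rightarrow> insert v (B \<union> G)) = T" by simp
  show "(case (T \<inter> F, T - {v} - F) of (B, G) \<Rightarrow> f (insert v (B \<union> G))) = f T" using eq by simp
  have "(T - {v} - F) \<union> F = (T - {v}) \<union> F" by blast
  then have "T - {v} - F \<in> L"
    using T(2) S_down[of "(T - {v}) \<union> F" "T - {v} - F"] by (auto simp: link_def)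
  then show "(T \<inter> F, T - {v} - F) \<in> {B. B \<subset> F} \<times> L" using T(3) by blast
next
  fix x assume "x \<in> {B. B \<subset> F} \<times> L"
  then obtain B G where x: "x = (B, G)" "B \<subset> F" and G: "G \<inter> F = {}" "G \<union> F \<in> S"
    by (auto simp: link_def)
  have vn: "v \<notin> G \<union> F" by (rule v_notin[OF G(2)])
  have "insert v (B \<union> G) \<inter> F = B" "insert v (B \<union> G) - {v} - F = G" using x(2) G(1) vn by blast+
  then show "((case x of (B, G) \<Rightarrow> insert v (B \<union> G)) \<inter> F, (case x of (B, G) \<Rightarrow> insert v (B \<union> G)) - {v} - F) = x"
    using x(1) by simp
  have "insert v (B \<union> G) - {v} \<union> F = G \<union> F" "\<not> F \<subseteq> insert v (B \<union> G)" using x(2) G(1) vn by blast+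
  then show "(case x of (B, G) \<Rightarrow> insert v (B \<union> G)) \<in> {T \<in> \<Delta>. v \<in> T}"
    using x(1) G(2) by (simp add: stellar_iff)
qed

text \<open>The h-polynomial of the boundary of a simplex. Expanding
  \<open>1 = (X + (1 - X)) ^ k\<close> over subsets of \<open>F\<close> and splitting off
  \<open>F\<close> itself leaves \<open>1 - X ^ k\<close>, from which \<open>1 - X\<close> is
  cancelled.\<close>

lemma sum_proper_subfaces:
  "(\<Sum>B\<in>{B. B \<subset> F}. fps_X ^ card B * (1 - fps_X) ^ (k - 1 - card B)) = (\<Sum>j<k. fps_X ^ j :: real fps)"
proof -
  let ?X = "fps_X :: real fps"
  let ?c = "\<Sum>B\<in>{B. B \<subset> F}. ?X ^ card B * (1 - ?X) ^ (k - 1 - card B)"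
  have "1 = (\<Prod>u\<in>F. ?X + (1 - ?X))" by simp
  also have "\<dots> = (\<Sum>B\<in>Pow F. (\<Prod>u\<in>B. ?X) * (\<Prod>u\<in>F - B. 1 - ?X))"
    by (rule prod_add[OF finite_F])
  also have "\<dots> = (\<Sum>B\<in>Pow F. ?X ^ card B * (1 - ?X) ^ (k - card B))"
    using finite_F by (intro sum.cong) (auto simp: card_Diff_subset finite_subset)
  also have "Pow F = insert F {B. B \<subset> F}" by blast
  also have "(\<Sum>B\<in>insert F {B. B \<subset> F}. ?X ^ card B * (1 - ?X) ^ (k - card B))
      = ?X ^ k + (\<Sum>B\<in>{B. B \<subset> F}. ?X ^ card B * (1 - ?X) ^ (k - card B))"
    using finite_F by (subst sum.insert) (auto intro: finite_subset[of _ "Pow F"])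
  also have "(\<Sum>B\<in>{B. B \<subset> F}. ?X ^ card B * (1 - ?X) ^ (k - card B)) = (1 - ?X) * ?c"
    unfolding sum_distrib_left
  proof (rule sum.cong)
    fix B assume "B \<in> {B. B \<subset> F}"
    then have "card B < k" using finite_F by (auto intro: psubset_card_mono)
    then have "k - card B = Suc (k - 1 - card B)" by simp
    then have "(1 - ?X) ^ (k - card B) = (1 - ?X) * (1 - ?X) ^ (k - 1 - card B)" by (simp only: power_Suc)
    then show "?X ^ card B * (1 - ?X) ^ (k - card B) = (1 - ?X) * (?X ^ card B * (1 - ?X) ^ (k - 1 - card B))"
      by (simp only: mult.left_commute)
  qed simp
  finally have "(1 - ?X) * ?c = 1 - ?X ^ k" by (simp add: algebra_simps)
  also have "\<dots> = (1 - ?X) * (\<Sum>j<k. ?X ^ j)" by (rule one_diff_power_eq)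
  finally have eq: "(1 - ?X) * ?c = (1 - ?X) * (\<Sum>j<k. ?X ^ j)" .
  have nz: "1 - ?X \<noteq> 0"
  proof
    assume "1 - ?X = 0"
    then have "fps_nth (1 - ?X) 0 = 0" by simp
    then show False by simp
  qed
  show ?thesis by (rule mult_left_cancel[OF nz, THEN iffD1, OF eq])
qed

text \<open>Removing the faces above \<open>F\<close> costs \<open>hpoly L * X ^ k\<close>; the new
  faces through \<open>v\<close> add \<open>hpoly L * (X + ... + X ^ k)\<close>. The top terms
  cancel.\<close>

lemma hpoly_stellar: "hpoly \<Delta> = hpoly S + hpoly L * (\<Sum>j\<in>{1..<k}. fps_X ^ j)"
proof -
  let ?X = "fps_X :: real fps"
  let ?D = "cdim S"
  let ?t = "\<lambda>T. ?X ^ card T * (1 - ?X) ^ (?D - card T)"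
  have fin: "finite \<Delta>" "finite L" using simplicial_stellar simplicial_link by (auto simp: simplicial_complex_def)
  have "hpoly \<Delta> = (\<Sum>T\<in>{T\<in>S. \<not> F \<subseteq> T} \<union> {T\<in>\<Delta>. v \<in> T}. ?t T)"
    unfolding hpoly_def cdim_stellar by (intro sum.cong) (use stellar_iff v_notin in blast)+
  also have "\<dots> = (\<Sum>T\<in>{T\<in>S. \<not> F \<subseteq> T}. ?t T) + (\<Sum>T\<in>{T\<in>\<Delta>. v \<in> T}. ?t T)"
    using fin(1) finite_S v_notin by (intro sum.union_disjoint) auto
  also have "(\<Sum>T\<in>{T\<in>\<Delta>. v \<in> T}. ?t T)
      = (\<Sum>G\<in>L. \<Sum>B\<in>{B. B \<subset> F}. ?X * (?X ^ card B * (1 - ?X) ^ (k - 1 - card B)) * (?X ^ card G * (1 - ?X) ^ (cdim L - card G)))"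
    unfolding sum_faces_at_v sum.cartesian_product[symmetric] sum.swap[of _ L]
  proof (intro sum.cong refl)
    fix B G assume "B \<in> {B. B \<subset> F}" and GL: "G \<in> L"
    then have B: "B \<subset> F" "card B < k" using finite_F by (auto intro: psubset_card_mono)
    have G: "G \<inter> F = {}" "G \<union> F \<in> S" using GL by (auto simp: link_def)
    have fin': "finite B" "finite G" using B(1) finite_F finite_face[OF G(2)] by (auto intro: finite_subset)
    have "v \<notin> B \<union> G" using v_notin[OF G(2)] B(1) by blast
    moreover have "B \<inter> G = {}" using B(1) G(1) by blast
    ultimately have c: "card (insert v (B \<union> G)) = Suc (card B + card G)"
      using fin' by (simp add: card_Un_disjoint)
    have "card G \<le> cdim L" by (rule card_le_cdim[OF fin(2) GL])
    then have "?D - card (insert v (B \<union> G)) = (k - 1 - card B) + (cdim L - card G)"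
      using B(2) unfolding c cdim_link by simp
    then show "?t (insert v (B \<union> G)) = ?X * (?X ^ card B * (1 - ?X) ^ (k - 1 - card B)) * (?X ^ card G * (1 - ?X) ^ (cdim L - card G))"
      unfolding c by (simp only: power_Suc power_add ac_simps)
  qed
  also have "\<dots> = hpoly L * (?X * (\<Sum>j<k. ?X ^ j))"
    unfolding sum_distrib_right[symmetric] sum_distrib_left[symmetric] sum_proper_subfaces
    by (simp add: hpoly_def mult.commute)
  also have "(\<Sum>T\<in>{T\<in>S. \<not> F \<subseteq> T}. ?t T) = hpoly S - hpoly L * ?X ^ k"
  proof -
    have "hpoly S = (\<Sum>T\<in>{T\<in>S. F \<subseteq> T} \<union> {T\<in>S. \<not> F \<subseteq> T}. ?t T)"
      unfolding hpoly_def by (intro sum.cong) auto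
    also have "\<dots> = (\<Sum>T\<in>{T\<in>S. F \<subseteq> T}. ?t T) + (\<Sum>T\<in>{T\<in>S. \<not> F \<subseteq> T}. ?t T)"
      using finite_S by (intro sum.union_disjoint) auto
    also have "(\<Sum>T\<in>{T\<in>S. F \<subseteq> T}. ?t T) = hpoly L * ?X ^ k"
      unfolding sum_faces_above_F hpoly_def sum_distrib_right
    proof (rule sum.cong)
      fix G assume GL: "G \<in> L"
      then have G: "G \<inter> F = {}" "G \<union> F \<in> S" by (auto simp: link_def)
      then have "card (G \<union> F) = card G + k" using finite_face[OF G(2)] by (simp add: card_Un_disjoint)
      then show "?t (G \<union> F) = ?X ^ card G * (1 - ?X) ^ (cdim L - card G) * ?X ^ k"
        by (simp add: cdim_link power_add ac_simps)
    qed simp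
    finally show ?thesis by simp
  qed
  finally have "hpoly \<Delta> = hpoly S - hpoly L * ?X ^ k + hpoly L * (?X * (\<Sum>j<k. ?X ^ j))" .
  also have "?X * (\<Sum>j<k. ?X ^ j) = (\<Sum>j\<in>{1..<k}. ?X ^ j) + ?X ^ k"
  proof -
    have "?X * (\<Sum>j<k. ?X ^ j) = (\<Sum>j\<in>{0..<k}. ?X ^ Suc j)"
      by (simp add: sum_distrib_left atLeast0LessThan)
    also have "\<dots> = (\<Sum>j\<in>{1..<Suc k}. ?X ^ j)"
      using sum.shift_bounds_Suc_ivl[of "\<lambda>j. ?X ^ j" 0 k] by simp
    finally show ?thesis using k_pos by simp
  qed
  finally show ?thesis by (simp add: distrib_left)
qed

lemma hpoly_stellar_nth:
  "fps_nth (hpoly \<Delta>) n = fps_nth (hpoly S) n + (\<Sum>j\<in>{j\<in>{1..<k}. j \<le> n}. fps_nth (hpoly L) (n - j))"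
proof -
  have "fps_nth (hpoly L * fps_X ^ j) n = (if j \<le> n then fps_nth (hpoly L) (n - j) else 0)" for j
    by (simp add: fps_X_power_mult_right_nth)
  then have "fps_nth (hpoly L * (\<Sum>j\<in>{1..<k}. fps_X ^ j)) n
      = (\<Sum>j\<in>{1..<k}. if j \<le> n then fps_nth (hpoly L) (n - j) else 0)"
    by (simp add: sum_distrib_left fps_sum_nth)
  also have "\<dots> = (\<Sum>j\<in>{j\<in>{1..<k}. j \<le> n}. fps_nth (hpoly L) (n - j))"
    by (intro sum.mono_neutral_cong_right) auto
  finally show ?thesis by (simp add: hpoly_stellar)
qed

text \<open>Under \<open>i \<mapsto> D - i\<close> and \<open>j \<mapsto> k - j\<close> the index
  \<open>i - j\<close> becomes \<open>d - (i - j)\<close>, because \<open>D = d + k\<close>. The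
  cases in which one of the indices leaves \<open>0..d\<close> match as zeros of the h-polynomial of
  the link.\<close>

lemma symmetric_stellar:
  assumes "symmetric_h S" "symmetric_h L"
  shows "symmetric_h \<Delta>"
proof -
  let ?D = "cdim S" and ?d = "cdim L"
  let ?h = "\<lambda>n. fps_nth (hpoly L) n"
  have finL: "finite L" and fin\<Delta>: "finite \<Delta>"
    using simplicial_link simplicial_stellar by (auto simp: simplicial_complex_def)
  have symL: "?h n = ?h (?d - n)" if "n \<le> ?d" for n
    using assms(2) that unfolding symmetric_h_def hpoly_nth[OF finL] of_int_eq_iff by blast
  have "fps_nth (hpoly \<Delta>) i = fps_nth (hpoly \<Delta>) (?D - i)" if i: "i \<le> ?D" for i
  proof -
    have "fps_nth (hpoly S) i = fps_nth (hpoly S) (?D - i)"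
      using assms(1) i unfolding symmetric_h_def hpoly_nth[OF finite_S] of_int_eq_iff by blast
    moreover have "(\<Sum>j\<in>{j\<in>{1..<k}. j \<le> i}. ?h (i - j)) = (\<Sum>j\<in>{j\<in>{1..<k}. j \<le> ?D - i}. ?h (?D - i - j))"
    proof -
      have eq: "(if j \<le> i then ?h (i - j) else 0) = (if k - j \<le> ?D - i then ?h (?D - i - (k - j)) else 0)"
        if j: "j \<in> {1..<k}" for j
      proof -
        consider "j \<le> i" "i - j \<le> ?d" | "j \<le> i" "?d < i - j" | "i < j" by linarith
        then show ?thesis
        proof cases
          case 1
          then have "?D - i - (k - j) = ?d - (i - j)" "k - j \<le> ?D - i" using j i cdim_link by auto
          then show ?thesis using 1 symL[OF 1(2)] by simp
        next
          case 2
          then have "\<not> k - j \<le> ?D - i" using j i cdim_link by auto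
          then show ?thesis using 2 hpoly_nth_beyond[OF finL] by simp
        next
          case 3
          then have "?d < ?D - i - (k - j)" using j i cdim_link by auto
          then show ?thesis using 3 hpoly_nth_beyond[OF finL] by simp
        qed
      qed
      have "(\<Sum>j\<in>{j\<in>{1..<k}. j \<le> i}. ?h (i - j)) = (\<Sum>j\<in>{1..<k}. if j \<le> i then ?h (i - j) else 0)"
        by (intro sum.mono_neutral_cong_left) auto
      also have "\<dots> = (\<Sum>j\<in>{1..<k}. if k - j \<le> ?D - i then ?h (?D - i - (k - j)) else 0)"
        by (intro sum.cong refl eq)
      also have "\<dots> = (\<Sum>j\<in>{1..<k}. if j \<le> ?D - i then ?h (?D - i - j) else 0)"
        by (rule sum.reindex_bij_witness[of _ "\<lambda>j. k - j" "\<lambda>j. k - j"]) auto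
      also have "\<dots> = (\<Sum>j\<in>{j\<in>{1..<k}. j \<le> ?D - i}. ?h (?D - i - j))"
        by (intro sum.mono_neutral_cong_right) auto
      finally show ?thesis .
    qed
    ultimately show ?thesis unfolding hpoly_stellar_nth by simp
  qed
  then show ?thesis
    unfolding symmetric_h_def cdim_stellar hpoly_nth[OF fin\<Delta>] of_int_eq_iff by blast
qed

end

lemma codim_le_of_hilb:
  assumes W: "finite W" and K: "finite K" and G: "graded_gens W G" and h: "hilb W K G = hpoly K"
  shows "codim_le W K G n (nat (h_num K n))" "0 \<le> h_num K n"
proof -
  have "real (mp.dim (forms W n)) - real (mp.dim (part W K G n)) = of_int (h_num K n)"
    using arg_cong[OF h, of "\<lambda>f. fps_nth f n"] hpoly_nth[OF K, of n] by (simp add: hilb_def)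
  then have eq: "int (mp.dim (forms W n)) - int (mp.dim (part W K G n)) = h_num K n" by linarith
  have "mp.dim (part W K G n) \<le> mp.dim (forms W n)"
    by (rule dim_mono_forms[OF W subset_refl part_subset_forms[OF G]])
  then show "0 \<le> h_num K n" using eq by linarith
  then show "codim_le W K G n (nat (h_num K n))" using eq unfolding codim_le_def by linarith
qed

lemma line_open_codim:
  assumes "finite W" "finite E"
  shows "line_open (\<lambda>\<theta>. codim_le W K (power_gens \<theta> D E) n c)"
proof -
  have "codim_le W K G n c \<longleftrightarrow> mp.dim (forms W n) - c \<le> mp.dim (part W K G n)" for G
    unfolding codim_le_def by linarith
  then show ?thesis using line_open_dim_part[OF assms] by simp
qed

section \<open>Rescaling the new variable and conclusion for the subdivision\<close>

context stellar_setup
begin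

abbreviation "W \<equiv> vertices S"
abbreviation "V \<equiv> insert v (vertices S)"
abbreviation "D \<equiv> cdim S"
abbreviation "d \<equiv> cdim L"
abbreviation "Q \<equiv> star F S"
abbreviation "C \<equiv> attach_cone v S Q"

lemma finite_W: "finite W"
  using S by (auto simp: simplicial_complex_def vertices_def)

lemma finite_vertices_stellar: "finite (vertices \<Delta>)"
  using vertices_stellar_subset finite_W by (auto intro: finite_subset)

lemma F_subset_W: "F \<subseteq> W"
  using F by (auto simp: vertices_def)

lemma v_notin_F: "v \<notin> F"
  by (rule v_notin[OF F(1)])

text \<open>The relation \<open>\<Prod>u\<in>F. y\<^sub>u - x\<^sub>v = 0\<close> that holds for \<open>y\<^sub>u = x\<^sub>u + x\<^sub>v\<close> in the face ring of the
  subdivision, rewritten for the rescaled variable \<open>s x\<^sub>v\<close>.\<close>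

definition relation :: "real \<Rightarrow> 'v mpoly" where
  "relation s = (\<Prod>u\<in>F. Const s * Var u - Var v)"

text \<open>If \<open>F\<close> is a single vertex, then it is no longer a vertex of the subdivision.\<close>

definition blowup :: "real \<Rightarrow> 'v \<Rightarrow> 'v mpoly" where
  "blowup s w = (if w = v then Const s * Var v
     else if w \<in> F then (if w \<in> vertices \<Delta> then Var w else 0) + Var v else Var w)"

definition rescaled_gens :: "real \<Rightarrow> (nat \<Rightarrow> 'v mpoly) \<Rightarrow> nat set \<Rightarrow> ('v mpoly \<times> nat) set" where
  "rescaled_gens s \<theta> E = insert (relation s, k) (power_gens \<theta> D E)"

lemma relation_form: "relation s \<in> forms V k"
  unfolding relation_def using F_subset_W
  by (intro forms_prod finite_F mp.subspace_diff[OF subspace_forms] mp.subspace_scale[OF subspace_forms] Var_in_forms) auto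

lemma graded_rescaled_gens: "linear_forms V \<theta> \<Longrightarrow> graded_gens V (rescaled_gens s \<theta> E)"
  using graded_gens_power_gens[of V \<theta> D E] relation_form
  by (auto simp: graded_gens_def rescaled_gens_def)

lemma blowup_form: "w \<in> V \<Longrightarrow> blowup s w \<in> forms (vertices \<Delta>) 1"
proof -
  assume w: "w \<in> V"
  have vf: "Var v \<in> forms (vertices \<Delta>) 1" by (rule Var_in_forms[OF v_in_vertices_stellar])
  consider "w = v" | "w \<noteq> v" "w \<in> F" "w \<in> vertices \<Delta>" | "w \<noteq> v" "w \<in> F" "w \<notin> vertices \<Delta>"
    | "w \<noteq> v" "w \<notin> F" by blast
  then show ?thesis
  proof cases
    case 1
    then show ?thesis using mp.subspace_scale[OF subspace_forms vf] by (simp add: blowup_def)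
  next
    case 2
    then show ?thesis using mp.subspace_add[OF subspace_forms Var_in_forms vf] by (simp add: blowup_def)
  next
    case 3
    then show ?thesis using vf by (simp add: blowup_def)
  next
    case 4
    then have "w \<in> vertices \<Delta>" using w vertex_in_stellar by simp
    then show ?thesis using 4 Var_in_forms by (simp add: blowup_def)
  qed
qed

lemma subst_blowup_form: "p \<in> forms V n \<Longrightarrow> subst (blowup s) p \<in> forms (vertices \<Delta>) n"
  by (rule subst_in_forms[OF blowup_form])

lemma linear_forms_blowup:
  "linear_forms V \<theta> \<Longrightarrow> linear_forms (vertices \<Delta>) (\<lambda>i. subst (blowup s) (\<theta> i))"
  unfolding linear_forms_def by (intro allI subst_blowup_form) (erule allE)

text \<open>For \<open>s \<noteq> 0\<close> the substitution has the right inverse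
  \<open>x_v \<mapsto> x_v / s\<close>, \<open>x_u \<mapsto> x_u - x_v / s\<close> on the variables
  of the subdivision. It is not injective when \<open>F\<close> is a single vertex, but surjectivity
  is all that \<open>codim_transfer\<close> asks.\<close>

lemma forms_subset_blowup:
  assumes s: "s \<noteq> 0"
  shows "forms (vertices \<Delta>) n \<subseteq> subst (blowup s) ` forms V n"
proof (rule surj_subst_forms)
  let ?\<tau> = "\<lambda>w. if w = v then Const (1 / s) * Var v
    else if w \<in> F then Var w - Const (1 / s) * Var v else Var w"
  fix w assume w: "w \<in> vertices \<Delta>"
  then have wV: "w \<in> V" using vertices_stellar_subset by blast
  have vV: "Var v \<in> forms V 1" by (rule Var_in_forms) simp
  have wV: "Var w \<in> forms V 1" by (rule Var_in_forms[OF wV])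
  have sv: "Const (1 / s) * Var v \<in> forms V 1" by (rule mp.subspace_scale[OF subspace_forms vV])
  show "?\<tau> w \<in> forms V 1"
    using sv wV mp.subspace_diff[OF subspace_forms wV sv] by (simp split: if_split)
  have "Const (1 / s) * Const s = (Const (1 / s * s) :: 'v mpoly)" by (simp only: Const_simps(4))
  also have "\<dots> = 1" using s by (simp del: Const_simps(4))
  finally have "Const (1 / s) * Const s = (1 :: 'v mpoly)" .
  then have inv: "Const (1 / s) * (Const s * Var v) = (Var v :: 'v mpoly)"
    by (simp only: mult.assoc[symmetric] mult_1)
  show "subst (blowup s) (?\<tau> w) = Var w"
    using w inv by (simp add: subst_diff subst_mult blowup_def)
qed

text \<open>A monomial \<open>m'\<close> in the expansion of \<open>m\<close> keeps each variable or
  trades one from \<open>F\<close> for \<open>x_v\<close>. In contrapositive form this shows that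
  non-faces of \<open>C\<close> expand into non-faces of the subdivision.\<close>

lemma blowup_support:
  assumes "keys m' \<in> \<Delta>"
    and "\<And>w. w \<in> keys m \<Longrightarrow> w \<in> keys m' \<or> w \<in> F \<and> v \<in> keys m'"
  shows "keys m \<in> C"
proof (cases "v \<in> keys m'")
  case False
  then have U: "keys m' \<in> S" using assms(1) unfolding stellar_iff by simp
  have "keys m \<subseteq> keys m'" using assms(2) False by blast
  then have "keys m \<in> S" by (rule S_down[OF U])
  then show ?thesis using v_notin by (auto simp: attach_cone_def)
next
  case True
  then have U: "(keys m' - {v}) \<union> F \<in> S" using assms(1) unfolding stellar_iff by simp
  have sub: "keys m - {v} \<subseteq> (keys m' - {v}) \<union> F"
    using assms(2) by blast
  have "keys m - {v} \<in> S" by (rule S_down[OF U sub])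
  moreover have "(keys m - {v}) \<union> F \<in> S"
    using sub by (intro S_down[OF U]) simp
  ultimately show ?thesis by (simp add: attach_cone_def star_def)
qed

lemma subst_blowup_support:
  assumes "finite A" "\<And>w. w \<in> A \<Longrightarrow> 0 < e w"
  shows "(\<Prod>w\<in>A. blowup s w ^ e w) \<in>
    mspan {m'. \<forall>w\<in>A. w \<in> keys m' \<or> w \<in> F \<and> v \<in> keys m'}"
  using assms
proof (induction A rule: finite_induct)
  case empty
  show ?case by (simp add: mspan_def)
next
  case (insert x A)
  let ?R = "\<lambda>w m'. w \<in> keys m' \<or> w \<in> F \<and> v \<in> keys m'"
  have Var: "Var w = mon (single w 1)" for w :: 'v by (simp add: Var_def)
  have "blowup s x \<in> mspan {m'. ?R x m'}"
  proof -
    have "Var x \<in> mspan {m'. ?R x m'}" by (simp add: Var)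
    moreover have "Var v \<in> mspan {m'. ?R x m'}" if "x \<in> F" using that by (simp add: Var)
    ultimately show ?thesis
      unfolding blowup_def
      by (auto intro!: mp.subspace_add[OF subspace_mspan] mp.subspace_scale[OF subspace_mspan]
          mp.subspace_0[OF subspace_mspan])
  qed
  moreover have "blowup s x ^ (e x - 1) \<in> mspan UNIV" by (simp add: mspan_def)
  ultimately have "blowup s x * blowup s x ^ (e x - 1) \<in> mspan {m'. ?R x m'}"
    by (rule mspan_mult) (auto simp: keys_plus_nat)
  then have x: "blowup s x ^ e x \<in> mspan {m'. ?R x m'}"
    using insert.prems[of x] by (simp add: power_eq_if)
  have A: "(\<Prod>w\<in>A. blowup s w ^ e w) \<in> mspan {m'. \<forall>w\<in>A. ?R w m'}"
    using insert.IH insert.prems by simp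
  have "blowup s x ^ e x * (\<Prod>w\<in>A. blowup s w ^ e w) \<in> mspan {m'. \<forall>w\<in>insert x A. ?R w m'}"
    by (rule mspan_mult[OF x A]) (auto simp: keys_plus_nat)
  then show ?case using insert.hyps by simp
qed

lemma subst_blowup_nonface:
  assumes m: "m \<in> mons V n" "keys m \<notin> C"
  shows "subst_mon (blowup s) m \<in> part (vertices \<Delta>) \<Delta> G n"
proof -
  let ?R = "\<lambda>w m'. w \<in> keys m' \<or> w \<in> F \<and> v \<in> keys m'"
  have "subst_mon (blowup s) m \<in> forms (vertices \<Delta>) (mdeg m)"
    using m(1) by (intro subst_mon_in_forms[of V] blowup_form) (auto simp: mons_def)
  then have 1: "subst_mon (blowup s) m \<in> mspan (mons (vertices \<Delta>) n)"
    using m(1) by (simp add: forms_def mons_def)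
  have 2: "subst_mon (blowup s) m \<in> mspan {m'. \<forall>w\<in>keys m. ?R w m'}"
    unfolding subst_mon_def by (rule subst_blowup_support) (auto simp: in_keys_iff)
  have "subst_mon (blowup s) m \<in> mspan (nonface_mons (vertices \<Delta>) \<Delta> n)"
    unfolding mspan_def
  proof safe
    fix m' assume "m' \<in> keys (subst_mon (blowup s) m)"
    then have m': "m' \<in> mons (vertices \<Delta>) n" "\<forall>w\<in>keys m. ?R w m'"
      using 1 2 by (auto simp: mspan_def)
    then have "keys m' \<notin> \<Delta>" using blowup_support[of m' m] m(2) by blast
    then show "m' \<in> nonface_mons (vertices \<Delta>) \<Delta> n" using m'(1) by (simp add: nonface_mons_def)
  qed
  then have "subst_mon (blowup s) m \<in> part (vertices \<Delta>) \<Delta> {} n" by (simp add: part_no_gens)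
  then show ?thesis using part_mono[of \<Delta> \<Delta> "{}" G] by blast
qed

text \<open>Each factor becomes \<open>s (x_u + x_v) - s x_v = s x_u\<close>, so the product is a
  multiple of the monomial of the missing face \<open>F\<close>. If \<open>F\<close> is a single
  vertex, it is zero outright.\<close>

lemma subst_blowup_relation: "subst (blowup s) (relation s) \<in> part (vertices \<Delta>) \<Delta> G k"
proof -
  have "subst (blowup s) (relation s) = (\<Prod>u\<in>F. Const s * (if u \<in> vertices \<Delta> then Var u else 0))"
    unfolding relation_def subst_prod
  proof (rule prod.cong)
    fix u assume u: "u \<in> F"
    then have "u \<noteq> v" using v_notin_F by blast
    then show "subst (blowup s) (Const s * Var u - Var v) = Const s * (if u \<in> vertices \<Delta> then Var u else 0)"
      using u by (simp add: subst_diff subst_mult blowup_def distrib_left)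
  qed simp
  also have "\<dots> \<in> part (vertices \<Delta>) \<Delta> G k"
  proof (cases "F \<subseteq> vertices \<Delta>")
    case False
    then have "(\<Prod>u\<in>F. Const s * (if u \<in> vertices \<Delta> then Var u else 0)) = (0 :: 'v mpoly)"
      using finite_F by (intro prod_zero) auto
    then show ?thesis by (simp add: part_0)
  next
    case True
    let ?m = "\<Sum>u\<in>F. single u (1::nat)"
    have keys: "keys ?m = F"
      unfolding Set.set_eq_iff in_keys_iff lookup_squarefree[OF finite_F] by simp
    have "mdeg ?m = (\<Sum>u\<in>F. lookup ?m u)"
      by (rule mdeg_superset[OF finite_F]) (simp only: keys subset_refl)
    also have "\<dots> = (\<Sum>u\<in>F. 1)"
      by (intro sum.cong refl) (simp only: lookup_squarefree[OF finite_F] if_True)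
    also have "\<dots> = k" by simp
    finally have deg: "mdeg ?m = k" .
    have "keys ?m \<subseteq> vertices \<Delta>" unfolding keys by (rule True)
    then have m: "?m \<in> mons (vertices \<Delta>) k" unfolding mons_def using deg by (intro CollectI conjI)
    have "F \<notin> \<Delta>" unfolding stellar_iff by simp
    then have "keys ?m \<notin> \<Delta>" unfolding keys .
    then have "mon ?m \<in> part (vertices \<Delta>) \<Delta> G k" by (rule part_monomial[OF m])
    then have "Const (s ^ k) * mon ?m \<in> part (vertices \<Delta>) \<Delta> G k" by (rule part_scale)
    moreover have "(\<Prod>u\<in>F. Const s * (if u \<in> vertices \<Delta> then Var u else 0)) = (\<Prod>u\<in>F. Const s * Var u)"
      using True by (intro prod.cong) auto
    moreover have "(\<Prod>u\<in>F. Const s * Var u) = Const (s ^ k) * mon ?m"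
      unfolding prod.distrib mon_squarefree[OF finite_F] by (simp only: prod_constant Const_power)
    ultimately show ?thesis by (simp only:)
  qed
  finally show ?thesis .
qed

text \<open>The substitution maps the rescaled ideal into that of the subdivision and is onto on
  forms, so bounds proved for the rescaled ring carry over.\<close>

lemma stellar_transfer:
  assumes s: "s \<noteq> 0" and \<theta>: "linear_forms V \<theta>" and c: "codim_le V C (rescaled_gens s \<theta> E) n c"
  shows "codim_le (vertices \<Delta>) \<Delta> (power_gens (\<lambda>i. subst (blowup s) (\<theta> i)) D E) n c"
proof -
  let ?\<theta> = "\<lambda>i. subst (blowup s) (\<theta> i)"
  let ?P = "part (vertices \<Delta>) \<Delta> (power_gens ?\<theta> D E)"
  have lin: "linear_forms (vertices \<Delta>) ?\<theta>" by (rule linear_forms_blowup[OF \<theta>])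
  have down: "down_closed \<Delta>"
    using simplicial_stellar by (auto simp: simplicial_complex_def down_closed_def)
  have finV: "finite V" using finite_W by simp
  show ?thesis
  proof (rule codim_transfer[OF finV graded_rescaled_gens[OF \<theta>] finite_vertices_stellar
        graded_gens_power_gens[OF lin] linear_subst _ _ c])
    show "forms (vertices \<Delta>) n \<subseteq> mp.span (?P n \<union> subst (blowup s) ` forms V n)"
      using forms_subset_blowup[OF s, of n] mp.span_superset[of "?P n \<union> subst (blowup s) ` forms V n"]
      by (meson Un_upper2 subset_trans)
    show "subst (blowup s) ` part V C (rescaled_gens s \<theta> E) n \<subseteq> ?P n"
    proof (rule image_part_subset[OF linear_subst])
      show "subst (blowup s) (mon m) \<in> ?P n" if "m \<in> mons V n" "keys m \<notin> C" for m
        using subst_blowup_nonface[OF that] by simp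
      fix g e m assume g: "(g, e) \<in> rescaled_gens s \<theta> E" "e \<le> n" "m \<in> mons V (n - e)"
      have m: "subst (blowup s) (mon m) \<in> forms (vertices \<Delta>) (n - e)"
        using g(3) by (intro subst_blowup_form) simp
      have "subst (blowup s) g * subst (blowup s) (mon m) \<in> ?P (e + (n - e))"
      proof (cases "(g, e) = (relation s, k)")
        case True
        then show ?thesis using part_mult[OF down subst_blowup_relation m] by simp
      next
        case False
        then have "(subst (blowup s) g, e) \<in> power_gens ?\<theta> D E"
          using g(1) by (auto simp: rescaled_gens_def power_gens_def thetas_def subst_power)
        then show ?thesis by (rule part_gen_forms[OF _ m])
      qed
      then show "subst (blowup s) (g * mon m) \<in> ?P n" using g(2) by (simp add: subst_mult)
    qed
  qed
qed

text \<open>Only \<open>relation s\<close> moves with \<open>s\<close>, and polynomially, so a bound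
  at the limit \<open>s = 0\<close> persists for all but finitely many \<open>s\<close>.\<close>

lemma codim_rescaled_generic:
  assumes E: "finite E" and c: "codim_le V C (rescaled_gens 0 \<theta> E) n c"
  shows "finite {s. \<not> codim_le V C (rescaled_gens s \<theta> E) n c}"
proof -
  let ?A = "insert None (Some ` power_gens \<theta> D E)"
  define g where "g a s = (case a of None \<Rightarrow> relation s | Some q \<Rightarrow> fst q)" for a :: "('v mpoly \<times> nat) option" and s
  define e where "e a = (case a of None \<Rightarrow> k | Some q \<Rightarrow> snd q)" for a :: "('v mpoly \<times> nat) option"
  have G: "rescaled_gens s \<theta> E = (\<lambda>a. (g a s, e a)) ` ?A" for s
    by (simp add: rescaled_gens_def g_def e_def image_image)
  have "curve relation"
    unfolding relation_def[abs_def] by (intro curve_prod curve_diff curve_mult curve_const curve_Const)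
  then have curve: "curve (g a)" for a
    unfolding g_def[abs_def] by (cases a) (auto simp: curve_const split_beta)
  have finA: "finite ?A" using E by (simp add: power_gens_def)
  have "finite {s. mp.dim (part V C (rescaled_gens s \<theta> E) n) < mp.dim (part V C (rescaled_gens 0 \<theta> E) n)}"
    unfolding G using finite_W finA curve by (intro dim_part_generic) auto
  then show ?thesis
    by (rule rev_finite_subset) (use c in \<open>auto simp: codim_le_def\<close>)
qed

lemma relation_0: "relation 0 = (- Var v) ^ k"
  by (simp add: relation_def)

text \<open>Four witnesses, two from \<open>S\<close> and two from the link, are merged. Those of
  the link are first turned into parameters for the star, so that all four families concern
  sequences of linear forms in the same variables.\<close>

lemma common_link_parameter:
  assumes "HL S" "HL L"
  obtains \<theta> where "linear_forms W \<theta>"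
    "\<And>n. n \<le> Suc D \<Longrightarrow> codim_le W S (thetas \<theta> D) n (nat (h_num S n))"
    "\<And>i. i \<le> D div 2 \<Longrightarrow> codim_le W S (power_gens \<theta> D {D - 2 * i}) (D - i) 0"
    "\<And>n. n \<le> Suc D \<Longrightarrow> codim_le W Q (thetas \<theta> D) n (nat (h_num L n))"
    "\<And>j. j \<le> d div 2 \<Longrightarrow> codim_le W Q (power_gens \<theta> D {d - 2 * j}) (d - j) 0"
    "\<And>n. 0 \<le> h_num S n" "\<And>n. 0 \<le> h_num L n"
proof -
  interpret fS: face_complex S by unfold_locales (rule S)
  interpret fL: face_complex L by unfold_locales (rule simplicial_link)
  obtain f where f: "bij_betw f {..<k} F"
    using ex_bij_betw_nat_finite[OF finite_F] by (auto simp: atLeast0LessThan)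
  obtain \<theta>1 where \<theta>1: "linear_forms W \<theta>1" "hilb W S (thetas \<theta>1 D) = hpoly S"
    by (rule fS.HL_imp_hilb[OF assms(1)])
  obtain \<theta>2 where \<theta>2: "linear_forms W \<theta>2"
    "\<And>i. i \<le> D div 2 \<Longrightarrow> part W S (power_gens \<theta>2 D {D - 2 * i}) (D - i) = forms W (D - i)"
    by (rule fS.HL_imp_surjective[OF assms(1)]) blast
  obtain \<theta>3 where \<theta>3: "linear_forms (vertices L) \<theta>3" "hilb (vertices L) L (thetas \<theta>3 d) = hpoly L"
    by (rule fL.HL_imp_hilb[OF assms(2)])
  obtain \<theta>4 where \<theta>4: "linear_forms (vertices L) \<theta>4"
    "\<And>i. i \<le> d div 2 \<Longrightarrow> part (vertices L) L (power_gens \<theta>4 d {d - 2 * i}) (d - i) = forms (vertices L) (d - i)"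
    by (rule fL.HL_imp_surjective[OF assms(2)]) blast
  have cS: "codim_le W S (thetas \<theta>1 D) n (nat (h_num S n))" and hS: "0 \<le> h_num S n" for n
    using codim_le_of_hilb[OF finite_W finite_S graded_gens_thetas[OF \<theta>1(1)] \<theta>1(2)] by auto
  have cL: "codim_le (vertices L) L (thetas \<theta>3 d) n (nat (h_num L n))" and hL: "0 \<le> h_num L n" for n
    using codim_le_of_hilb[OF fL.finite_W fL.finite_K graded_gens_thetas[OF \<theta>3(1)] \<theta>3(2)] by auto
  \<comment> \<open>Finitely many conditions suffice, since degrees up to \<open>Suc D\<close> are
    all that is used later. Writing \<open>power_gens\<close> with the empty set brings all of them
    into the form of \<open>line_open_codim\<close>.\<close>
  define J :: "((nat \<Rightarrow> 'v mpoly) \<Rightarrow> bool) set" where "J =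
    (\<lambda>n \<theta>. codim_le W S (power_gens \<theta> D {}) n (nat (h_num S n))) ` {..Suc D} \<union>
    (\<lambda>i \<theta>. codim_le W S (power_gens \<theta> D {D - 2 * i}) (D - i) 0) ` {..D div 2} \<union>
    (\<lambda>n \<theta>. codim_le W Q (power_gens \<theta> D {}) n (nat (h_num L n))) ` {..Suc D} \<union>
    (\<lambda>j \<theta>. codim_le W Q (power_gens \<theta> D {d - 2 * j}) (d - j) 0) ` {..d div 2}"
  have "\<exists>\<theta>. linear_forms W \<theta> \<and> (\<forall>C\<in>J. C \<theta>)"
  proof (rule common_parameter)
    show "finite J" by (simp add: J_def)
    show "line_open C" if "C \<in> J" for C
      using that line_open_codim[OF finite_W] by (auto simp: J_def simp del: power_gens_empty)
    fix C assume "C \<in> J"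
    then consider n where "C = (\<lambda>\<theta>. codim_le W S (power_gens \<theta> D {}) n (nat (h_num S n)))"
      | i where "i \<le> D div 2" "C = (\<lambda>\<theta>. codim_le W S (power_gens \<theta> D {D - 2 * i}) (D - i) 0)"
      | n where "C = (\<lambda>\<theta>. codim_le W Q (power_gens \<theta> D {}) n (nat (h_num L n)))"
      | j where "j \<le> d div 2" "C = (\<lambda>\<theta>. codim_le W Q (power_gens \<theta> D {d - 2 * j}) (d - j) 0)"
      unfolding J_def by auto
    then show "\<exists>\<theta>. linear_forms W \<theta> \<and> C \<theta>"
    proof cases
      case (1 n)
      then show ?thesis using \<theta>1(1) cS by (intro exI[of _ \<theta>1]) simp
    next
      case (2 i)
      have "codim_le W S (power_gens \<theta>2 D {D - 2 * i}) (D - i) 0"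
        using \<theta>2(2)[OF 2(1)] codim_le_0_iff[OF finite_W graded_gens_power_gens[OF \<theta>2(1)]] by blast
      then show ?thesis using 2 \<theta>2(1) by (intro exI[of _ \<theta>2]) simp
    next
      case (3 n)
      have "codim_le (vertices L) L (power_gens \<theta>3 d {}) n (nat (h_num L n))" using cL by simp
      from codim_star_of_link[OF S F(1) f \<theta>3(1) this]
      have "C (star_parameter \<theta>3 f d k)" by (simp only: 3 cdim_link)
      then show ?thesis using linear_forms_star_parameter[OF S F(1) f \<theta>3(1)] by blast
    next
      case (4 j)
      have "codim_le (vertices L) L (power_gens \<theta>4 d {d - 2 * j}) (d - j) 0"
        using \<theta>4(2)[OF 4(1)] codim_le_0_iff[OF fL.finite_W graded_gens_power_gens[OF \<theta>4(1)]] by blast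
      from codim_star_of_link[OF S F(1) f \<theta>4(1) this]
      have "C (star_parameter \<theta>4 f d k)" by (simp only: 4(2) cdim_link)
      then show ?thesis using linear_forms_star_parameter[OF S F(1) f \<theta>4(1)] by blast
    qed
  qed
  then obtain \<theta> where \<theta>: "linear_forms W \<theta>" "\<And>C. C \<in> J \<Longrightarrow> C \<theta>" by blast
  show ?thesis
  proof (rule that[OF \<theta>(1) _ _ _ _ hS hL])
    fix n assume "n \<le> Suc D"
    then show "codim_le W S (thetas \<theta> D) n (nat (h_num S n))" "codim_le W Q (thetas \<theta> D) n (nat (h_num L n))"
      using \<theta>(2)[of "\<lambda>\<theta>. codim_le W S (power_gens \<theta> D {}) n (nat (h_num S n))"]
        \<theta>(2)[of "\<lambda>\<theta>. codim_le W Q (power_gens \<theta> D {}) n (nat (h_num L n))"]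
      by (auto simp: J_def)
  next
    fix i assume "i \<le> D div 2"
    then show "codim_le W S (power_gens \<theta> D {D - 2 * i}) (D - i) 0"
      using \<theta>(2)[of "\<lambda>\<theta>. codim_le W S (power_gens \<theta> D {D - 2 * i}) (D - i) 0"] by (auto simp: J_def)
  next
    fix j assume "j \<le> d div 2"
    then show "codim_le W Q (power_gens \<theta> D {d - 2 * j}) (d - j) 0"
      using \<theta>(2)[of "\<lambda>\<theta>. codim_le W Q (power_gens \<theta> D {d - 2 * j}) (d - j) 0"] by (auto simp: J_def)
  qed
qed

lemma HL_stellar:
  assumes HL: "HL S" "HL L"
  shows "HL \<Delta>"
proof -
  obtain \<theta> where \<theta>: "linear_forms W \<theta>"
    and cS: "\<And>n. n \<le> Suc D \<Longrightarrow> codim_le W S (thetas \<theta> D) n (nat (h_num S n))"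
    and eS: "\<And>i. i \<le> D div 2 \<Longrightarrow> codim_le W S (power_gens \<theta> D {D - 2 * i}) (D - i) 0"
    and cQ: "\<And>n. n \<le> Suc D \<Longrightarrow> codim_le W Q (thetas \<theta> D) n (nat (h_num L n))"
    and eQ: "\<And>j. j \<le> d div 2 \<Longrightarrow> codim_le W Q (power_gens \<theta> D {d - 2 * j}) (d - j) 0"
    and hS: "\<And>n. 0 \<le> h_num S n" and hL: "\<And>n. 0 \<le> h_num L n"
    by (rule common_link_parameter[OF HL]) blast
  have finL: "finite L" using simplicial_link by (simp add: simplicial_complex_def)
  have downS: "down_closed S" using S_down by (auto simp: down_closed_def)
  have downQ: "down_closed Q"
    unfolding down_closed_def
  proof (intro ballI allI impI)
    fix T U assume T: "T \<in> Q" "U \<subseteq> T"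
    then have "T \<in> S" "T \<union> F \<in> S" "U \<union> F \<subseteq> T \<union> F" by (auto simp: star_def)
    then show "U \<in> Q" using T(2) S_down[of T U] S_down[of "T \<union> F" "U \<union> F"] by (simp add: star_def)
  qed
  interpret dg: degeneration W v S Q \<theta> D d k
    using finite_W v downS downQ \<theta> cdim_link k_pos by unfold_locales (auto simp: star_def)
  have e0: "part W S (power_gens \<theta> D {D - 2 * i}) (D - i) = forms W (D - i)" if "i \<le> D div 2" for i
    using eS[OF that] codim_le_0_iff[OF finite_W graded_gens_power_gens[OF \<theta>]] by blast
  have q0: "part W Q (power_gens \<theta> D {d - 2 * j}) (d - j) = forms W (d - j)" if "j \<le> d div 2" for j
    using eQ[OF that] codim_le_0_iff[OF finite_W graded_gens_power_gens[OF \<theta>]] by blast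
  \<comment> \<open>The quotient of the star vanishes in degree \<open>d + 1\<close>, hence in every
    degree above \<open>d\<close>.\<close>
  have "h_num L (Suc d) = 0"
    using hpoly_nth[OF finL, of "Suc d"] hpoly_nth_beyond[OF finL, of "Suc d"] by simp
  then have "codim_le W Q (thetas \<theta> D) (Suc d) 0"
    using cQ[of "Suc d"] cdim_link by simp
  then have "part W Q (thetas \<theta> D) (Suc d) = forms W (Suc d)"
    using codim_le_0_iff[OF finite_W graded_gens_thetas[OF \<theta>]] by blast
  then have top': "part W Q (thetas \<theta> D) (Suc d + j) = forms W (Suc d + j)" for j
    by (rule part_eq_forms_add[OF graded_gens_thetas[OF \<theta>] downQ])
  have top: "part W Q (thetas \<theta> D) j = forms W j" if dj: "d < j" for j
  proof -
    obtain m where "j = Suc d + m" using le_Suc_ex[OF Suc_leI[OF dj]] by blast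
    then show ?thesis by (simp only: top')
  qed
  \<comment> \<open>Only position \<open>D\<close> changes, so the parameters themselves are
    untouched. The minus sign gives \<open>\<theta> D = (\<theta> D - Var v) + Var v\<close>, an
    expansion without signs.\<close>
  define \<theta>' where "\<theta>' = \<theta>(D := \<theta> D - Var v)"
  have thetas': "thetas \<theta>' D = thetas \<theta> D" by (auto simp: thetas_def \<theta>'_def)
  have "\<theta> D - Var v \<in> forms V 1"
    using dg.linear_forms_V dg.xv_form unfolding linear_forms_def
    by (intro mp.subspace_diff[OF subspace_forms]) auto
  then have \<theta>': "linear_forms V \<theta>'"
    using dg.linear_forms_V unfolding linear_forms_def \<theta>'_def fun_upd_apply by metis
  define c where "c n = nat (h_num S n) + (\<Sum>j\<in>{j\<in>{1..<k}. j \<le> n}. nat (h_num L (n - j)))" for n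
  have c0: "codim_le V C (rescaled_gens 0 \<theta>' {}) n (c n)" if n: "n \<le> Suc D" for n
  proof -
    \<comment> \<open>\<open>codim_degeneration\<close> wants a bound in every degree. Beyond
      \<open>Suc D\<close> the trivial bound is inserted; with \<open>n \<le> Suc D\<close> those
      degrees never occur in the sum.\<close>
    define cQ' where "cQ' j = (if j \<le> Suc D then nat (h_num L j) else mp.dim (forms W j))" for j
    have "codim_le W Q (thetas \<theta> D) j (cQ' j)" for j
      using cQ[of j] by (auto simp: cQ'_def codim_le_def)
    then have "codim_le V C (rescaled_gens 0 \<theta>' {}) n
        (nat (h_num S n) + (\<Sum>j\<in>{j\<in>{1..<k}. j \<le> n}. cQ' (n - j)))"
      by (intro dg.codim_degeneration graded_rescaled_gens \<theta>' cS n)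
        (auto simp: rescaled_gens_def relation_0 thetas')
    moreover have "(\<Sum>j\<in>{j\<in>{1..<k}. j \<le> n}. cQ' (n - j)) = (\<Sum>j\<in>{j\<in>{1..<k}. j \<le> n}. nat (h_num L (n - j)))"
      using n by (intro sum.cong) (auto simp: cQ'_def)
    ultimately show ?thesis by (simp add: c_def)
  qed
  have s0: "codim_le V C (rescaled_gens 0 \<theta>' {D - 2 * i}) (D - i) 0" if i: "i \<le> D div 2" for i
  proof -
    \<comment> \<open>Positivity of \<open>D - i\<close> is what allows it to be written as
      \<open>Suc n\<close>, one degree being used up by a factor \<open>x_v\<close>.\<close>
    have "D \<ge> 1" using cdim_link k_pos by simp
    then have "0 < D - i" using i by simp
    from gr0_implies_Suc[OF this] obtain n where "D - i = Suc n" ..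
    note n = this[symmetric]
    have "forms V (D - i) \<subseteq> part V C (rescaled_gens 0 \<theta>' {D - 2 * i}) (D - i)"
    proof (rule dg.surjective_degeneration[of _ "\<theta> D" "\<theta> D - Var v" "D - 2 * i" i n])
      show "thetas \<theta> D \<subseteq> rescaled_gens 0 \<theta>' {D - 2 * i}"
        by (auto simp: rescaled_gens_def power_gens_def thetas')
      show "((- Var v) ^ k, k) \<in> rescaled_gens 0 \<theta>' {D - 2 * i}"
        by (simp add: rescaled_gens_def relation_0)
      show "\<theta> D \<in> forms W 1" using \<theta> by (simp add: linear_forms_def)
      show "((\<theta> D - Var v) ^ (D - 2 * i), D - 2 * i) \<in> rescaled_gens 0 \<theta>' {D - 2 * i}"
        by (simp add: rescaled_gens_def power_gens_def \<theta>'_def)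
      show "D = D - 2 * i + 2 * i" using i by simp
      show "Suc n = D - i" by (rule n)
      show "part W Q (thetas \<theta> D) j = forms W j" if "d < j" for j by (rule top[OF that])
      show "part W Q (insert (\<theta> D ^ (d - 2 * j), d - 2 * j) (thetas \<theta> D)) (d - j) = forms W (d - j)"
        if "j \<le> d div 2" for j using q0[OF that] by (simp add: power_gens_single)
      show "part W S (insert (\<theta> D ^ (D - 2 * i), D - 2 * i) (thetas \<theta> D)) (D - i) = forms W (D - i)"
        using e0[OF i] by (simp add: power_gens_single)
    qed simp
    then have "mp.dim (forms V (D - i)) \<le> mp.dim (part V C (rescaled_gens 0 \<theta>' {D - 2 * i}) (D - i))"
      using part_subset_forms[OF graded_rescaled_gens[OF \<theta>']] by (intro dim_mono_forms[OF dg.finite_V])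
    then show ?thesis by (simp add: codim_le_def)
  qed
  \<comment> \<open>The excluded values are 0, where the substitution is not onto the forms of the
    subdivision, and the finitely many values at which a bound fails.\<close>
  have "finite ({0} \<union> (\<Union>n\<le>Suc D. {s. \<not> codim_le V C (rescaled_gens s \<theta>' {}) n (c n)})
      \<union> (\<Union>i\<le>D div 2. {s. \<not> codim_le V C (rescaled_gens s \<theta>' {D - 2 * i}) (D - i) 0}))"
    using codim_rescaled_generic[OF _ c0] codim_rescaled_generic[OF _ s0] by auto
  from ex_new_if_finite[OF infinite_UNIV_char_0 this]
  obtain s where "s \<notin> {0} \<union> (\<Union>n\<le>Suc D. {s. \<not> codim_le V C (rescaled_gens s \<theta>' {}) n (c n)})
      \<union> (\<Union>i\<le>D div 2. {s. \<not> codim_le V C (rescaled_gens s \<theta>' {D - 2 * i}) (D - i) 0})" ..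
  then have s: "s \<noteq> 0" and cs: "\<And>n. n \<le> Suc D \<Longrightarrow> codim_le V C (rescaled_gens s \<theta>' {}) n (c n)"
    and ss: "\<And>i. i \<le> D div 2 \<Longrightarrow> codim_le V C (rescaled_gens s \<theta>' {D - 2 * i}) (D - i) 0"
    by auto
  let ?\<theta> = "\<lambda>i. subst (blowup s) (\<theta>' i)"
  have lin: "linear_forms (vertices \<Delta>) ?\<theta>" by (rule linear_forms_blowup[OF \<theta>'])
  interpret f: face_complex \<Delta> by unfold_locales (rule simplicial_stellar)
  show ?thesis
  proof (rule f.HL_intro[OF lin])
    show "symmetric_h \<Delta>" using HL by (intro symmetric_stellar) (auto simp: HL_def)
    fix n assume "n \<le> Suc (cdim \<Delta>)"
    then have n: "n \<le> Suc D" by (simp add: cdim_stellar)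
    have "codim_le (vertices \<Delta>) \<Delta> (thetas ?\<theta> D) n (c n)"
      using stellar_transfer[OF s \<theta>' cs[OF n]] by simp
    moreover have "fps_nth (hpoly \<Delta>) n = real (c n)"
      unfolding hpoly_stellar_nth hpoly_nth[OF finite_S] hpoly_nth[OF finL] c_def
      using hS hL by simp
    ultimately show "real (mp.dim (forms (vertices \<Delta>) n))
        \<le> real (mp.dim (part (vertices \<Delta>) \<Delta> (thetas ?\<theta> (cdim \<Delta>)) n)) + fps_nth (hpoly \<Delta>) n"
      unfolding codim_le_def cdim_stellar by linarith
  next
    fix i assume "i \<le> cdim \<Delta> div 2"
    then have i: "i \<le> D div 2" by (simp add: cdim_stellar)
    have "codim_le (vertices \<Delta>) \<Delta> (power_gens ?\<theta> D {D - 2 * i}) (D - i) 0"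
      by (rule stellar_transfer[OF s \<theta>' ss[OF i]])
    then show "part (vertices \<Delta>) \<Delta> (power_gens ?\<theta> (cdim \<Delta>) {cdim \<Delta> - 2 * i}) (cdim \<Delta> - i)
        = forms (vertices \<Delta>) (cdim \<Delta> - i)"
      unfolding cdim_stellar
      using codim_le_0_iff[OF finite_vertices_stellar graded_gens_power_gens[OF lin]] by blast
  qed
qed

end

text \<open>For \<open>F = {}\<close> the definition of \<open>stellar\<close> gives the void complex.\<close>

lemma HL_void: "HL ({} :: 'v set set)"
proof -
  interpret face_complex "{} :: 'v set set"
    by unfold_locales (simp add: simplicial_complex_def)
  have lin: "linear_forms W (\<lambda>_. 0)"
    by (simp add: linear_forms_def mp.subspace_0[OF subspace_forms])
  have part: "part W {} G n = forms W n" if "graded_gens W G" for G n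
  proof
    show "part W {} G n \<subseteq> forms W n" by (rule part_subset_forms[OF that])
    show "forms W n \<subseteq> part W {} G n"
      unfolding forms_eq_span by (rule mp.span_minimal) (auto simp: subspace_part intro: part_monomial)
  qed
  show ?thesis
  proof (rule HL_intro[OF lin])
    show "symmetric_h ({} :: 'v set set)" by (simp add: symmetric_h_def cdim_def)
    show "real (mp.dim (forms W n)) \<le> real (mp.dim (part W {} (thetas (\<lambda>_. 0) D) n)) + fps_nth (hpoly {}) n" for n
      by (simp add: part[OF graded_gens_thetas[OF lin]] hpoly_def)
    show "part W {} (power_gens (\<lambda>_. 0) D {D - 2 * i}) (D - i) = forms W (D - i)" for i
      by (rule part[OF graded_gens_power_gens[OF lin]])
  qed
qed

theorem mainTheorem10:
  fixes S :: "'v set set" and F :: "'v set" and v :: 'v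
  assumes "homology_sphere S"
    and "F \<in> S"
    and "v \<notin> vertices S"
    and "HL S"
    and "HL (link F S)"
  shows "HL (stellar v F S)"
proof (cases "F = {}")
  case True
  then have "stellar v F S = {}" by (simp add: stellar_def complex_join_def)
  then show ?thesis using HL_void by simp
next
  case False
  interpret stellar_setup S F v
    using assms False by unfold_locales (auto simp: homology_sphere_def)
  show ?thesis by (rule HL_stellar[OF assms(4,5)])
qed

end
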